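(* For every constant $c_0>0$ there is a constant $c>0$ such that the following holds for all positive integers $n,t$, with $d=2^n$. Let $\mathcal{F}$ be a $2t$-wise independent family of functions $f:[d]\to\{0,1\}$, and let $\mathcal{D}$ be a distribution over permutations $\pi:[d]\to[d]$ which is $\delta$-approximate $t$-wise independent with $\delta\le c_0\,t/d^{4t+\frac12}$. Let $\nu$ be the distribution on $\mathrm{U}(d)$ of $$U=P_\pi\,F_f\,C,\qquad \pi\sim\mathcal{D},\ f\sim\mathcal{F}\text{ uniform},\ C\sim\mathrm{C}(d)\text{ uniform},$$ where $\pi,f,C$ are independent. Then $\nu$ is a diamond $\epsilon$-approximate $t$-design with $\epsilon=c\,t/\sqrt d$.
   Context: Identify $[d]$ with $\{0,1\}^n$. $P_\pi:|x\rangle\mapsto|\pi(x)\rangle$, $F_f:|x\rangle\mapsto(-1)^{f(x)}|x\rangle$ on $\mathbb{C}^d$; $\mathrm{C}(d)$ is the $n$-qubit Clifford group. A family $\mathcal F$ of functions $[N]\to[M]$ is $k$-wise independent if for $f$ uniform in $\mathcal F$, all distinct $x_1,\dots,x_k\in[N]$ and all $y_1,\dots,y_k\in[M]$: $\Pr[f(x_1)=y_1\wedge\dots\wedge f(x_k)=y_k]=M^{-k}$ (here the codomain $\{0,1\}$ has $M=2$). A distribution $\mathcal D$ over permutations of $[N]$ is $\delta$-approximate $t$-wise independent if for all distinct $x_1,\dots,x_t\in[N]$ and all distinct $y_1,\dots,y_t\in[N]$: $\left|\Pr_{\pi\sim\mathcal D}[\pi(x_1)=y_1\wedge\dots\wedge\pi(x_t)=y_t]-\left(N(N-1)\cdots(N-t+1)\right)^{-1}\right|\le\delta$.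 For a distribution $\nu$ on $\mathrm U(d)$, $\mathcal{M}^{(t)}_\nu(X)=\mathbb{E}_{R\sim\nu}R^{\otimes t}X(R^{\otimes t})^\dagger$ on operators on $(\mathbb{C}^d)^{\otimes t}$, and $\mathcal M^{(t)}_{\mathrm{Haar}}$ is the case of the Haar measure. $\nu$ is a diamond $\epsilon$-approximate $t$-design if $\|\mathcal M^{(t)}_\nu-\mathcal M^{(t)}_{\mathrm{Haar}}\|_\Diamond\le\epsilon$, where $\|\mathcal M-\mathcal N\|_\Diamond=\max_{|\psi\rangle\in\mathcal H\otimes\mathcal H}\|(\mathcal M\otimes\mathrm{id})(|\psi\rangle\langle\psi|)-(\mathcal N\otimes\mathrm{id})(|\psi\rangle\langle\psi|)\|_1$ over unit vectors, with $\|\cdot\|_1$ the trace norm. *)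

theory Defs
  imports
    "HOL-Probability.Probability"
    "Jordan_Normal_Form.Schur_Decomposition"
    "Jordan_Normal_Form.Char_Poly"
begin

text \<open>
  Operators on a Hilbert space of dimension \<open>d\<close> are elements of \<open>carrier_mat d d\<close>; basis vectors
  are indexed from 0, so \<open>[N]\<close> is \<open>{..<N}\<close>.
\<close>

section \<open>Tensor products and unitaries\<close>

text \<open>
  The basis vector \<open>|i\<rangle> \<otimes> |j\<rangle>\<close> has index \<open>i * r + j\<close>, where \<open>r\<close> is the dimension of the second
  factor. In particular \<open>[2 ^ n]\<close> is identified with \<open>{0,1}\<^sup>n\<close> by binary expansion.
\<close>

definition kron :: "complex mat \<Rightarrow> complex mat \<Rightarrow> complex mat" where
  "kron A B = Matrix.mat (dim_row A * dim_row B) (dim_col A * dim_col B)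
     (\<lambda>(i, j). A $$ (i div dim_row B, j div dim_col B) * B $$ (i mod dim_row B, j mod dim_col B))"

fun tensor_power :: "nat \<Rightarrow> complex mat \<Rightarrow> complex mat" where
  "tensor_power 0 A = 1\<^sub>m 1"
| "tensor_power (Suc t) A = kron A (tensor_power t A)"

definition unitary_group :: "nat \<Rightarrow> complex mat set" where
  "unitary_group d = {U \<in> carrier_mat d d. mat_adjoint U * U = 1\<^sub>m d \<and> U * mat_adjoint U = 1\<^sub>m d}"

section \<open>Haar measure\<close>

text \<open>
  The type \<open>complex mat\<close> carries no topology. The Borel sigma-algebra of \<open>U(d)\<close>, as a subspace of
  \<open>\<complex>\<^bsup>d\<times>d\<^esup>\<close>, is the one generated by the matrix entries.
\<close>

definition unitary_borel :: "nat \<Rightarrow> complex mat measure" where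
  "unitary_borel d = vimage_algebra (unitary_group d)
     (\<lambda>U. \<lambda>ij\<in>{..<d} \<times> {..<d}. U $$ ij) (Pi\<^sub>M ({..<d} \<times> {..<d}) (\<lambda>_. borel))"

definition is_haar_measure :: "nat \<Rightarrow> complex mat measure \<Rightarrow> bool" where
  "is_haar_measure d \<mu> \<longleftrightarrow> prob_space \<mu> \<and> sets \<mu> = sets (unitary_borel d) \<and>
     (\<forall>V\<in>unitary_group d. distr \<mu> \<mu> (\<lambda>U. V * U) = \<mu> \<and> distr \<mu> \<mu> (\<lambda>U. U * V) = \<mu>)"

section \<open>Moment operators, diamond distance and approximate designs\<close>

definition moment_operator :: "nat \<Rightarrow> nat \<Rightarrow> complex mat measure \<Rightarrow> complex mat \<Rightarrow> complex mat" where
  "moment_operator d t \<nu> X = Matrix.mat (d ^ t) (d ^ t)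
     (\<lambda>ij. \<integral>R. (tensor_power t R * X * mat_adjoint (tensor_power t R)) $$ ij \<partial>\<nu>)"

text \<open>The sum of the singular values, with multiplicity.\<close>

definition trace_norm :: "complex mat \<Rightarrow> real" where
  "trace_norm A = (\<Sum>z\<in>#proots (char_poly (mat_adjoint A * A)). sqrt (Re z))"

text \<open>
  \<open>\<M> \<otimes> id\<close> for a linear map \<open>\<M>\<close> on operators on \<open>\<complex>\<^sup>D\<close>: writing \<open>X\<close> as the sum over \<open>b, b'\<close> of
  \<open>X\<^bsub>b,b'\<^esub> \<otimes> |b\<rangle>\<langle>b'|\<close>, the map is applied to every \<open>X\<^bsub>b,b'\<^esub>\<close>.
\<close>

definition tensor_id :: "nat \<Rightarrow> (complex mat \<Rightarrow> complex mat) \<Rightarrow> complex mat \<Rightarrow> complex mat" where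
  "tensor_id D M X = Matrix.mat (D * D) (D * D) (\<lambda>(i, j).
     M (Matrix.mat D D (\<lambda>(a, a'). X $$ (a * D + i mod D, a' * D + j mod D))) $$ (i div D, j div D))"

definition ket_bra :: "complex vec \<Rightarrow> complex mat" where
  "ket_bra \<psi> = Matrix.mat (dim_vec \<psi>) (dim_vec \<psi>) (\<lambda>(i, j). vec_index \<psi> i * cnj (vec_index \<psi> j))"

definition diamond_dist ::
  "nat \<Rightarrow> (complex mat \<Rightarrow> complex mat) \<Rightarrow> (complex mat \<Rightarrow> complex mat) \<Rightarrow> real" where
  "diamond_dist D M N =
     (SUP \<psi>\<in>{\<psi> \<in> carrier_vec (D * D). \<psi> \<bullet>c \<psi> = 1}.
        trace_norm (tensor_id D M (ket_bra \<psi>) - tensor_id D N (ket_bra \<psi>)))"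

text \<open>The argument \<open>\<mu>\<close> is the Haar measure.\<close>

definition diamond_approx_design ::
  "nat \<Rightarrow> complex mat measure \<Rightarrow> nat \<Rightarrow> real \<Rightarrow> complex mat measure \<Rightarrow> bool" where
  "diamond_approx_design d \<mu> t \<epsilon> \<nu> \<longleftrightarrow>
     diamond_dist (d ^ t) (moment_operator d t \<nu>) (moment_operator d t \<mu>) \<le> \<epsilon>"

section \<open>The Clifford group\<close>

definition pauli_matrices :: "complex mat set" where
  "pauli_matrices =
     {mat_of_rows_list 2 [[1, 0], [0, 1]], mat_of_rows_list 2 [[0, 1], [1, 0]],
      mat_of_rows_list 2 [[0, - \<i>], [\<i>, 0]], mat_of_rows_list 2 [[1, 0], [0, - 1]]}"

fun pauli_strings :: "nat \<Rightarrow> complex mat set" where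
  "pauli_strings 0 = {1\<^sub>m 1}"
| "pauli_strings (Suc n) = {kron P Q | P Q. P \<in> pauli_matrices \<and> Q \<in> pauli_strings n}"

definition pauli_group :: "nat \<Rightarrow> complex mat set" where
  "pauli_group n = {(\<i> ^ k) \<cdot>\<^sub>m P | k P. P \<in> pauli_strings n}"

definition pauli_normalizer :: "nat \<Rightarrow> complex mat set" where
  "pauli_normalizer n =
     {U \<in> unitary_group (2 ^ n). (\<lambda>P. U * P * mat_adjoint U) ` pauli_group n = pauli_group n}"

text \<open>
  The normalizer contains all scalars of modulus 1. The Clifford group is its quotient by them, which
  is finite. A uniform Clifford unitary is a representative of a uniform class; the choice of the
  phase does not affect \<open>R \<mapsto> R\<^bsup>\<otimes>t\<^esup> X (R\<^bsup>\<otimes>t\<^esup>)\<^bsup>\<dagger>\<^esup>\<close>.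
\<close>

definition clifford_group :: "nat \<Rightarrow> complex mat set set" where
  "clifford_group n = pauli_normalizer n //
     {(U, V). U \<in> pauli_normalizer n \<and> (\<exists>z. cmod z = 1 \<and> V = z \<cdot>\<^sub>m U)}"

definition uniform_clifford :: "nat \<Rightarrow> complex mat pmf" where
  "uniform_clifford n = map_pmf (\<lambda>A. SOME U. U \<in> A) (pmf_of_set (clifford_group n))"

section \<open>Limited independence\<close>

text \<open>
  A family is a multiset, so that a function may be drawn with any rational probability; a set of
  functions is the special case of multiplicities 1. Tuples \<open>x\<^sub>1, \<dots>, x\<^sub>k\<close> are lists.
\<close>

definition kwise_independent :: "nat \<Rightarrow> nat \<Rightarrow> nat \<Rightarrow> (nat \<Rightarrow> nat) multiset \<Rightarrow> bool" where
  "kwise_independent k N M F \<longleftrightarrow> F \<noteq> {#} \<and> set_mset F \<subseteq> {..<N} \<rightarrow> {..<M} \<and>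
     (\<forall>xs ys. length xs = k \<and> distinct xs \<and> set xs \<subseteq> {..<N} \<and> length ys = k \<and> set ys \<subseteq> {..<M} \<longrightarrow>
        measure_pmf.prob (pmf_of_multiset F) {f. map f xs = ys} = 1 / real M ^ k)"

definition approx_twise_independent_perm :: "real \<Rightarrow> nat \<Rightarrow> nat \<Rightarrow> (nat \<Rightarrow> nat) pmf \<Rightarrow> bool" where
  "approx_twise_independent_perm \<delta> t N \<D> \<longleftrightarrow> set_pmf \<D> \<subseteq> {\<pi>. \<pi> permutes {..<N}} \<and>
     (\<forall>xs ys. length xs = t \<and> distinct xs \<and> set xs \<subseteq> {..<N} \<and>
              length ys = t \<and> distinct ys \<and> set ys \<subseteq> {..<N} \<longrightarrow>
        \<bar>measure_pmf.prob \<D> {\<pi>. map \<pi> xs = ys} - inverse (\<Prod>i<t. real N - real i)\<bar> \<le> \<delta>)"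

section \<open>The PFC ensemble\<close>

definition perm_matrix :: "nat \<Rightarrow> (nat \<Rightarrow> nat) \<Rightarrow> complex mat" where
  "perm_matrix d \<pi> = Matrix.mat d d (\<lambda>(i, x). if i = \<pi> x then 1 else 0)"

definition phase_matrix :: "nat \<Rightarrow> (nat \<Rightarrow> nat) \<Rightarrow> complex mat" where
  "phase_matrix d f = Matrix.mat d d (\<lambda>(i, x). if i = x then (- 1) ^ f x else 0)"

definition pfc_ensemble ::
  "nat \<Rightarrow> (nat \<Rightarrow> nat) pmf \<Rightarrow> (nat \<Rightarrow> nat) multiset \<Rightarrow> complex mat pmf" where
  "pfc_ensemble n \<D> F =
     map_pmf (\<lambda>(\<pi>, f, C). perm_matrix (2 ^ n) \<pi> * phase_matrix (2 ^ n) f * C)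
       (pair_pmf \<D> (pair_pmf (pmf_of_multiset F) (uniform_clifford n)))"

end

(*
  Fix a Hermitian dual witness W for the trace norm, and let phi_R be the purified input after
  R^{(x)t}. Both moment operators have the form E_R <PF phi_R| W |PF phi_R>: R is Clifford for the
  PFC ensemble, and R is Haar for the Haar measure, which absorbs PF by left invariance. On the span
  of distinct t-tuples, 2t-wise independent signs and t-wise independent permutations act, up to
  delta, as the ideal twirl, a channel whose value at phi_R does not depend on the unitary R because
  R^{(x)t} commutes with the permutations of the tensor factors. It remains to show that phi_R
  is almost supported on distinct tuples on average. This holds for every distribution that is left
  invariant under the Cliffords V_theta = H^{(x)n} diag(theta), since averaging over the
  diagonal Cliffords theta turns the projector onto a collision of two given factors into
  (I + SWAP - collision) / d <= 2 / d. Gentle measurement loses a square root, hence t / sqrt d.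
*)
theory Submission
  imports Defs
begin

text \<open>Both ensembles are compared with one and the same number, so no formula for Haar moments
  enters. The two orders of independence differ for this reason: a term of the quadratic form
  involves two tuples, and the signs see the points of both, up to 2t of them. Once the signs have
  forced the two tuples to have the same set of values, they differ by a permutation of positions,
  and the joint image under \<pi> is known from the image of one tuple. The rate arises as follows.
  There are at most t^2 ordered pairs of factors, each with expected collision weight at most 2/d,
  so the weight q outside the distinct tuples has expectation at most 2t^2/d. The cross terms cost 2
  sqrt q, which is replaced by s q + 1/s to be linear in q under the integral; s = sqrt d / t
  balances the two summands. The error of \<D> is estimated entry by entry and costs \<delta>
  d^(3t): d^t images of a tuple times the dimension d^(2t) of the doubled space. For t \<ge> sqrt d
  the trivial bound 2 suffices; otherwise 2t \<le> d, and there are 2t distinct points to work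
  with.\<close>

section \<open>Hermitian matrices and the trace norm\<close>

lemma mat_adjoint_carrier [simp]:
  "A \<in> carrier_mat n m \<Longrightarrow> mat_adjoint A \<in> carrier_mat m n"
  by (auto simp: mat_adjoint_def)

lemma dim_mat_adjoint [simp]:
  "dim_row (mat_adjoint A) = dim_col A" "dim_col (mat_adjoint A) = dim_row A"
  by (auto simp: mat_adjoint_def)

lemma index_mat_adjoint [simp]:
  fixes A :: "complex mat"
  shows "i < dim_col A \<Longrightarrow> j < dim_row A \<Longrightarrow> mat_adjoint A $$ (i, j) = cnj (A $$ (j, i))"
  by (auto simp: mat_adjoint_def mat_of_rows_def)

lemma mat_adjoint_adjoint [simp]: "mat_adjoint (mat_adjoint A) = (A :: complex mat)"
  by (intro eq_matI) auto

lemma index_mult_mat_sum: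
  assumes "i < dim_row A" "j < dim_col B" "dim_col A = dim_row B"
  shows "(A * B) $$ (i, j) = (\<Sum>k<dim_row B. A $$ (i, k) * B $$ (k, j))"
  using assms by (auto simp: scalar_prod_def atLeast0LessThan intro!: sum.cong)

lemma mat_adjoint_mult:
  fixes A B :: "complex mat"
  assumes "dim_col A = dim_row B"
  shows "mat_adjoint (A * B) = mat_adjoint B * mat_adjoint A"
  using assms by (intro eq_matI) (auto simp: index_mult_mat_sum mult.commute simp del: index_mult_mat(1))

lemma mat_adjoint_smult: "mat_adjoint (c \<cdot>\<^sub>m (A :: complex mat)) = cnj c \<cdot>\<^sub>m mat_adjoint A"
  by (intro eq_matI) auto

lemma mat_adjoint_one [simp]: "mat_adjoint (1\<^sub>m n :: complex mat) = 1\<^sub>m n"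
  by (intro eq_matI) auto

lemma unitary_groupI:
  assumes "U \<in> carrier_mat n n" "mat_adjoint U * U = 1\<^sub>m n"
  shows "U \<in> unitary_group n"
  using assms mat_mult_left_right_inverse[of "mat_adjoint U" n U]
  by (auto simp: unitary_group_def)

lemma unitary_groupD:
  assumes "U \<in> unitary_group n"
  shows "U \<in> carrier_mat n n" "mat_adjoint U * U = 1\<^sub>m n" "U * mat_adjoint U = 1\<^sub>m n"
    "mat_adjoint U \<in> carrier_mat n n"
  using assms by (auto simp: unitary_group_def)

lemma unitary_group_one [simp]: "1\<^sub>m n \<in> unitary_group n"
  by (auto simp: unitary_group_def)

lemma unitary_group_adjoint: "U \<in> unitary_group n \<Longrightarrow> mat_adjoint U \<in> unitary_group n"
  by (auto simp: unitary_group_def)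

lemma unitary_group_mult:
  assumes U: "U \<in> unitary_group n" and V: "V \<in> unitary_group n"
  shows "U * V \<in> unitary_group n"
proof (rule unitary_groupI)
  note u = unitary_groupD[OF U] and v = unitary_groupD[OF V]
  show "U * V \<in> carrier_mat n n" using u v by auto
  have "mat_adjoint (U * V) * (U * V) = (mat_adjoint V * mat_adjoint U) * (U * V)"
    using u v by (subst mat_adjoint_mult) auto
  also have "\<dots> = mat_adjoint V * (mat_adjoint U * (U * V))"
    by (rule assoc_mult_mat[of _ n n _ n _ n]) (use u v in auto)
  also have "mat_adjoint U * (U * V) = (mat_adjoint U * U) * V"
    by (rule assoc_mult_mat[symmetric, of _ n n _ n _ n]) (use u v in auto)
  finally show "mat_adjoint (U * V) * (U * V) = 1\<^sub>m n"
    using u v by simp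
qed

lemma unitary_cancel:
  assumes "U \<in> unitary_group n" "X \<in> carrier_mat n m"
  shows "mat_adjoint U * (U * X) = X" "U * (mat_adjoint U * X) = X"
  using unitary_groupD[OF assms(1)] assms(2)
  by (simp_all flip: assoc_mult_mat[of _ n n _ n _ m])

section \<open>Spectral theorem for Hermitian matrices\<close>

lemma unitary_first_column:
  fixes v :: "complex Matrix.vec"
  assumes v: "v \<in> carrier_vec n" "v \<noteq> 0\<^sub>v n" and n: "n > 0"
  obtains W c where "W \<in> unitary_group n" "\<And>i. i < n \<Longrightarrow> W $$ (i, 0) = c * vec_index v i"
proof -
  interpret cof_vec_space n "TYPE(complex)" .
  define b where "b = basis_completion v"
  define ws where "ws = gram_schmidt n b"
  from basis_completion[OF v, folded b_def]
  have dist_b: "distinct b" and indep: "\<not> lin_dep (set b)" and b: "set b \<subseteq> carrier_vec n" and hdb: "hd b = v"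
    and len_b: "length b = n" by auto
  from hdb len_b n obtain vs where bv: "b = v # vs" by (cases b, auto)
  from gram_schmidt_result[OF b dist_b indep refl, folded ws_def]
  have ws: "set ws \<subseteq> carrier_vec n" "corthogonal ws" "length ws = n"
    by (auto simp: len_b)
  \<comment> \<open>Gram-Schmidt keeps its first vector and does not normalise. Dividing column j by
    its norm \<open>nr j\<close> makes the columns orthonormal and leaves column 0 proportional to
    \<open>v\<close>.\<close>
  from gram_schmidt_hd[OF v(1), of vs, folded bv] have hdws: "hd ws = v" unfolding ws_def .
  have ws0: "ws ! 0 = v" using hdws ws n by (cases ws) auto
  define nr where "nr j = sqrt (\<Sum>i<n. (cmod (vec_index (ws ! j) i))\<^sup>2)" for j
  have wsj: "ws ! j \<in> carrier_vec n" if "j < n" for j using ws that by auto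
  have ip: "ws ! j \<bullet>c ws ! i = (\<Sum>k<n. vec_index (ws ! j) k * cnj (vec_index (ws ! i) k))"
    if "i < n" "j < n" for i j
    using wsj[OF that(1)] wsj[OF that(2)] by (auto simp: scalar_prod_def atLeast0LessThan intro!: sum.cong)
  have nr2: "ws ! j \<bullet>c ws ! j = of_real ((nr j)\<^sup>2)" if "j < n" for j
    using that by (simp add: ip nr_def sum_nonneg complex_mult_cnj cmod_power2 flip: of_real_power)
  have nr0: "nr j \<noteq> 0" if "j < n" for j
    using nr2[OF that] corthogonalD[OF ws(2), of j j] that ws(3) by auto
  define W where "W = Matrix.mat n n (\<lambda>(i, j). vec_index (ws ! j) i / of_real (nr j))"
  have "mat_adjoint W * W = 1\<^sub>m n"
  proof (intro eq_matI)
    fix i j assume "i < dim_row (1\<^sub>m n :: complex mat)" "j < dim_col (1\<^sub>m n :: complex mat)"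
    hence ij: "i < n" "j < n" by auto
    have "(mat_adjoint W * W) $$ (i, j)
        = (\<Sum>k<n. cnj (vec_index (ws ! i) k) * vec_index (ws ! j) k / (of_real (nr i) * of_real (nr j)))"
      using ij by (subst index_mult_mat_sum) (auto simp: W_def)
    also have "\<dots> = (ws ! j \<bullet>c ws ! i) / (of_real (nr i) * of_real (nr j))"
      by (simp add: ip ij sum_divide_distrib mult.commute)
    also have "\<dots> = 1\<^sub>m n $$ (i, j)"
      using corthogonalD[OF ws(2), of j i] ij ws(3) nr2[OF ij(1)] nr0[OF ij(1)]
      by (cases "i = j") (auto simp: power2_eq_square)
    finally show "(mat_adjoint W * W) $$ (i, j) = 1\<^sub>m n $$ (i, j)" .
  qed (auto simp: W_def)
  hence "W \<in> unitary_group n" by (intro unitary_groupI) (auto simp: W_def)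
  moreover have "W $$ (i, 0) = (1 / of_real (nr 0)) * vec_index v i" if "i < n" for i
    using that n by (simp add: W_def ws0)
  ultimately show thesis by (rule that)
qed

lemma complex_eigenvector_exists:
  fixes A :: "complex mat"
  assumes A: "A \<in> carrier_mat n n" and n: "n > 0"
  obtains v e where "v \<in> carrier_vec n" "v \<noteq> 0\<^sub>v n" "A *\<^sub>v v = e \<cdot>\<^sub>v v"
proof -
  have "degree (char_poly A) = n" using degree_monic_char_poly[OF A] by auto
  hence "\<not> constant (poly (char_poly A))" using n by (simp add: constant_degree)
  then obtain e where "poly (char_poly A) e = 0" using fundamental_theorem_of_algebra by blast
  hence "eigenvalue A e" using eigenvalue_root_char_poly[OF A] by auto
  thus thesis using that A unfolding eigenvalue_def eigenvector_def by auto
qed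

definition real_diag :: "nat \<Rightarrow> (nat \<Rightarrow> real) \<Rightarrow> complex mat" where
  "real_diag n l = Matrix.mat n n (\<lambda>(i, j). if i = j then of_real (l i) else 0)"

lemma real_diag_carrier [simp]: "real_diag n l \<in> carrier_mat n n"
  by (simp add: real_diag_def)

lemma dim_real_diag [simp]: "dim_row (real_diag n l) = n" "dim_col (real_diag n l) = n"
  by (simp_all add: real_diag_def)

lemma real_diag_mult: "real_diag n l * real_diag n m = real_diag n (\<lambda>i. l i * m i)"
  by (intro eq_matI) (auto simp: real_diag_def index_mult_mat_sum if_distrib cong: if_cong simp del: index_mult_mat(1))

lemma real_diag_adjoint: "mat_adjoint (real_diag n l) = real_diag n l"
  by (intro eq_matI) (auto simp: real_diag_def)

lemma conj_mult_conj:
  fixes U :: "complex mat"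
  assumes U: "U \<in> unitary_group n" and A: "A \<in> carrier_mat n n" and B: "B \<in> carrier_mat n n"
  shows "(U * A * mat_adjoint U) * (U * B * mat_adjoint U) = U * (A * B) * mat_adjoint U"
proof -
  note u = unitary_groupD[OF U]
  show ?thesis
    using u A B unitary_cancel(1)[OF U, of "B * mat_adjoint U" n]
    by (simp add: assoc_mult_mat[of _ n n _ n _ n] mult_carrier_mat[of _ n n _ n])
qed

text \<open>Induction on the dimension. A unitary \<open>W\<close> whose first column is an
  eigenvector turns \<open>A\<close> into \<open>B = W* A W\<close> with first column (e, 0, ...,
  0). As \<open>B\<close> is Hermitian, its first row has the same shape and \<open>e\<close> is
  real, so the lower right block is Hermitian of size \<open>m\<close> and the induction hypothesis
  applies to it.\<close>

lemma hermitian_diagonalization: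
  fixes A :: "complex mat"
  assumes "A \<in> carrier_mat n n" "mat_adjoint A = A"
  shows "\<exists>U\<in>unitary_group n. \<exists>l. A = U * real_diag n l * mat_adjoint U"
  using assms
proof (induction n arbitrary: A)
  case 0
  thus ?case by (intro bexI[of _ "1\<^sub>m 0"] exI) auto
next
  case (Suc m A)
  let ?n = "Suc m"
  obtain v e where v: "v \<in> carrier_vec ?n" "v \<noteq> 0\<^sub>v ?n" "A *\<^sub>v v = e \<cdot>\<^sub>v v"
    using complex_eigenvector_exists[OF Suc.prems(1)] by auto
  obtain W c where W: "W \<in> unitary_group ?n" "\<And>i. i < ?n \<Longrightarrow> W $$ (i, 0) = c * vec_index v i"
    using unitary_first_column[OF v(1,2)] by auto
  note w = unitary_groupD[OF W(1)]
  define B where "B = mat_adjoint W * A * W"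
  have Bc: "B \<in> carrier_mat ?n ?n" using w Suc.prems by (auto simp: B_def)
  have Bh: "mat_adjoint B = B"
    using w Suc.prems unfolding B_def
    by (simp add: mat_adjoint_mult assoc_mult_mat[of _ ?n ?n _ ?n _ ?n] mult_carrier_mat[of _ ?n ?n _ ?n])
  have Bij: "B $$ (i, j) = cnj (B $$ (j, i))" if "i < ?n" "j < ?n" for i j
    using that Bc arg_cong[OF Bh, of "\<lambda>M. M $$ (i, j)"] by auto
  have AW: "(A * W) $$ (i, 0) = e * W $$ (i, 0)" if i: "i < ?n" for i
  proof -
    have "(A * W) $$ (i, 0) = c * (\<Sum>k<?n. A $$ (i, k) * vec_index v k)"
      using w Suc.prems i by (subst index_mult_mat_sum) (auto simp: W(2) sum_distrib_left mult_ac simp del: sum.lessThan_Suc)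
    also have "(\<Sum>k<?n. A $$ (i, k) * vec_index v k) = vec_index (A *\<^sub>v v) i"
      using i Suc.prems(1) v(1) by (auto simp: scalar_prod_def atLeast0LessThan simp del: sum.lessThan_Suc)
    also have "\<dots> = e * vec_index v i" using v i by simp
    finally show ?thesis using i by (simp add: W(2))
  qed
  have B0: "B $$ (i, 0) = (if i = 0 then e else 0)" if i: "i < ?n" for i
  proof -
    have "B = mat_adjoint W * (A * W)" unfolding B_def using w Suc.prems by (intro assoc_mult_mat) auto
    hence "B $$ (i, 0) = (mat_adjoint W * (A * W)) $$ (i, 0)" by simp
    also have "\<dots> = (\<Sum>k<?n. mat_adjoint W $$ (i, k) * (A * W) $$ (k, 0))"
      using w Suc.prems(1) i by (subst index_mult_mat_sum) auto
    also have "\<dots> = e * (\<Sum>k<?n. mat_adjoint W $$ (i, k) * W $$ (k, 0))"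
      by (auto simp: AW sum_distrib_left mult_ac simp del: sum.lessThan_Suc index_mult_mat(1))
    also have "(\<Sum>k<?n. mat_adjoint W $$ (i, k) * W $$ (k, 0)) = (mat_adjoint W * W) $$ (i, 0)"
      using w i by (subst index_mult_mat_sum) auto
    also have "\<dots> = (if i = 0 then 1 else 0)" using w i by simp
    finally show ?thesis by simp
  qed
  have ecnj: "cnj e = e"
    using B0[of 0] Bij[of 0 0] by simp
  hence ereal: "of_real (Re e) = e"
    by (simp add: complex_eq_iff)
  define A3 where "A3 = Matrix.mat m m (\<lambda>(i, j). B $$ (Suc i, Suc j))"
  have "mat_adjoint A3 = A3"
    by (intro eq_matI) (auto simp: A3_def Bij[symmetric])
  with Suc.IH[of A3] obtain U3 l where U3: "U3 \<in> unitary_group m"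
    and A3: "A3 = U3 * real_diag m l * mat_adjoint U3"
    by (auto simp: A3_def)
  note u3 = unitary_groupD[OF U3]
  \<comment> \<open>The unitary of the smaller block, extended by 1 on the eigenvector already split
    off.\<close>
  define V where "V = four_block_mat (1\<^sub>m 1) (0\<^sub>m 1 m) (0\<^sub>m m 1) U3"
  have Vc: "V \<in> carrier_mat ?n ?n" using u3 four_block_carrier_mat[of "1\<^sub>m 1" 1 1 U3 m m] by (auto simp: V_def)
  have Vadj: "mat_adjoint V = four_block_mat (1\<^sub>m 1) (0\<^sub>m 1 m) (0\<^sub>m m 1) (mat_adjoint U3)"
    using u3 by (intro eq_matI) (auto simp: V_def)
  have block: "four_block_mat P (0\<^sub>m 1 m) (0\<^sub>m m 1) X * four_block_mat Q (0\<^sub>m 1 m) (0\<^sub>m m 1) Y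
      = four_block_mat (P * Q) (0\<^sub>m 1 m) (0\<^sub>m m 1) (X * Y)"
    if "P \<in> carrier_mat 1 1" "Q \<in> carrier_mat 1 1" "X \<in> carrier_mat m m" "Y \<in> carrier_mat m m"
    for P Q X Y :: "complex mat"
    using that
    by (subst mult_four_block_mat[where ?nr1.0 = 1 and ?n1.0 = 1 and ?n2.0 = m and ?nr2.0 = m and ?nc1.0 = 1 and ?nc2.0 = m])
      (auto simp: left_add_zero_mat[of _ m m] right_add_zero_mat[of _ 1 1])
  have "mat_adjoint V * V = 1\<^sub>m ?n"
    unfolding Vadj unfolding V_def using u3 by (simp add: block del: One_nat_def) simp
  hence V: "V \<in> unitary_group ?n" using Vc by (intro unitary_groupI)
  define l' where "l' i = (case i of 0 \<Rightarrow> Re e | Suc i \<Rightarrow> l i)" for i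
  have diag4: "real_diag ?n l' = four_block_mat (Matrix.mat 1 1 (\<lambda>_. e)) (0\<^sub>m 1 m) (0\<^sub>m m 1) (real_diag m l)"
    using ereal by (intro eq_matI) (auto simp: real_diag_def l'_def split: nat.splits)
  have "V * real_diag ?n l' * mat_adjoint V = four_block_mat (Matrix.mat 1 1 (\<lambda>_. e)) (0\<^sub>m 1 m) (0\<^sub>m m 1) A3"
    unfolding Vadj diag4 unfolding V_def A3 using u3 by (simp add: block del: One_nat_def)
  also have "\<dots> = B"
    using Bc B0 Bij[of 0] ecnj by (intro eq_matI) (auto simp: A3_def)
  finally have B: "B = V * real_diag ?n l' * mat_adjoint V" ..
  have "W * B = A * W"
    unfolding B_def using w Suc.prems unitary_cancel(2)[OF W(1), of "A * W" ?n]
    by (simp add: assoc_mult_mat[of _ ?n ?n _ ?n _ ?n] mult_carrier_mat[of _ ?n ?n _ ?n])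
  hence "A = W * B * mat_adjoint W"
    using w Suc.prems by (simp add: assoc_mult_mat[of _ ?n ?n _ ?n _ ?n] mult_carrier_mat[of _ ?n ?n _ ?n])
  also have "\<dots> = (W * V) * real_diag ?n l' * mat_adjoint (W * V)"
    unfolding B using w Vc by (simp add: mat_adjoint_mult assoc_mult_mat[of _ ?n ?n _ ?n _ ?n] mult_carrier_mat[of _ ?n ?n _ ?n])
  finally show ?case using unitary_group_mult[OF W(1) V] by blast
qed

section \<open>Duality for the trace norm\<close>

lemma sum_diag_mult_commute:
  fixes X Y :: "complex mat"
  assumes "X \<in> carrier_mat n n" "Y \<in> carrier_mat n n"
  shows "(\<Sum>i<n. (X * Y) $$ (i, i)) = (\<Sum>i<n. (Y * X) $$ (i, i))"
proof -
  have "(\<Sum>i<n. (X * Y) $$ (i, i)) = (\<Sum>i<n. \<Sum>k<n. X $$ (i, k) * Y $$ (k, i))"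
    using assms by (intro sum.cong) (auto simp: index_mult_mat_sum simp del: index_mult_mat(1))
  also have "\<dots> = (\<Sum>k<n. \<Sum>i<n. Y $$ (k, i) * X $$ (i, k))"
    by (subst sum.swap) (simp add: mult.commute)
  also have "\<dots> = (\<Sum>i<n. (Y * X) $$ (i, i))"
    using assms by (intro sum.cong) (auto simp: index_mult_mat_sum simp del: index_mult_mat(1))
  finally show ?thesis .
qed

text \<open>The witness is the sign of \<open>A\<close> in its eigenbasis, for which tr(WA) is the
  sum of the absolute eigenvalues. That this equals \<open>trace_norm\<close> is read off from the
  similarity of A*A to the diagonal matrix of squared eigenvalues, whose characteristic polynomial
  splits with the right multiplicities.\<close>

lemma trace_norm_hermitian_dual:
  fixes A :: "complex mat"
  assumes A: "A \<in> carrier_mat n n" "mat_adjoint A = A"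
  obtains W where "W \<in> unitary_group n"
    "trace_norm A = Re (\<Sum>i<n. \<Sum>j<n. W $$ (i, j) * A $$ (j, i))"
proof -
  obtain U l where U: "U \<in> unitary_group n" and AU: "A = U * real_diag n l * mat_adjoint U"
    using hermitian_diagonalization[OF A] by blast
  note u = unitary_groupD[OF U]
  \<comment> \<open>A zero eigenvalue gets sign 1, which keeps \<open>W\<close> unitary when
    \<open>A\<close> is singular.\<close>
  let ?s = "\<lambda>i. if l i < 0 then - 1 else 1 :: real"
  define W where "W = U * real_diag n ?s * mat_adjoint U"
  have Wc: "W \<in> carrier_mat n n" using u by (auto simp: W_def)
  have d1: "real_diag n (\<lambda>_. 1) = 1\<^sub>m n" by (intro eq_matI) (auto simp: real_diag_def)
  have Wh: "mat_adjoint W = W" unfolding W_def using u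
    by (simp add: mat_adjoint_mult[of _ "mat_adjoint U"] mat_adjoint_mult[of U] real_diag_adjoint assoc_mult_mat[of _ n n _ n _ n] mult_carrier_mat[of _ n n _ n])
  have s2: "(\<lambda>i. ?s i * ?s i) = (\<lambda>_. 1)" by auto
  have "W * W = 1\<^sub>m n"
    unfolding W_def conj_mult_conj[OF U real_diag_carrier real_diag_carrier] real_diag_mult s2 d1
    using u by simp
  hence W: "W \<in> unitary_group n" using Wc Wh by (intro unitary_groupI) auto
  have AA: "mat_adjoint A * A = U * real_diag n (\<lambda>i. l i * l i) * mat_adjoint U"
    unfolding A(2) unfolding AU conj_mult_conj[OF U real_diag_carrier real_diag_carrier] real_diag_mult ..
  have "similar_mat (mat_adjoint A * A) (real_diag n (\<lambda>i. l i * l i))"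
    unfolding similar_mat_def
    by (intro exI, rule similar_mat_witI[of U "mat_adjoint U" n]) (use u AA A in auto)
  hence "char_poly (mat_adjoint A * A) = char_poly (real_diag n (\<lambda>i. l i * l i))"
    by (rule char_poly_similar)
  also have "\<dots> = (\<Prod>a\<leftarrow>diag_mat (real_diag n (\<lambda>i. l i * l i)). [:- a, 1:])"
    by (rule char_poly_upper_triangular[OF real_diag_carrier]) (auto simp: real_diag_def)
  finally have cp: "char_poly (mat_adjoint A * A) = \<dots>" .
  have pr: "proots (\<Prod>a\<leftarrow>xs. [:- a, 1:]) = mset xs" for xs :: "complex list"
  proof (induction xs)
    case (Cons a xs)
    have "(\<Prod>a\<leftarrow>xs. [:- a, 1:]) \<noteq> 0" by auto
    then show ?case using Cons proots_mult[of "[:- a, 1:]" "\<Prod>a\<leftarrow>xs. [:- a, 1:]"] by simp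
  qed auto
  have "trace_norm A = (\<Sum>i<n. \<bar>l i\<bar>)"
    unfolding trace_norm_def cp pr
    by (simp add: diag_mat_def real_diag_def sum_mset_sum_list o_def  sum_list_sum_nth atLeast0LessThan flip: mset_map)
  also have "\<dots> = Re (\<Sum>i<n. real_diag n (\<lambda>i. ?s i * l i) $$ (i, i))"
    by (auto simp: real_diag_def intro!: sum.cong)
  also have "real_diag n (\<lambda>i. ?s i * l i) = (real_diag n (\<lambda>i. ?s i * l i) * mat_adjoint U) * U"
    using u by (simp add: assoc_mult_mat[of _ n n _ n _ n] mult_carrier_mat[of _ n n _ n])
  also have "(\<Sum>i<n. \<dots> $$ (i, i)) = (\<Sum>i<n. (U * (real_diag n (\<lambda>i. ?s i * l i) * mat_adjoint U)) $$ (i, i))"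
    by (rule sum_diag_mult_commute) (use u in auto)
  also have "U * (real_diag n (\<lambda>i. ?s i * l i) * mat_adjoint U) = W * A"
    unfolding W_def AU conj_mult_conj[OF U real_diag_carrier real_diag_carrier] real_diag_mult
    by (rule assoc_mult_mat[symmetric, of _ n n _ n _ n]) (use u in auto)
  also have "(\<Sum>i<n. (W * A) $$ (i, i)) = (\<Sum>i<n. \<Sum>j<n. W $$ (i, j) * A $$ (j, i))"
    using Wc A(1) by (intro sum.cong) (auto simp: index_mult_mat_sum simp del: index_mult_mat(1))
  finally show thesis using that W by blast
qed


section \<open>Kronecker products and Pauli strings\<close>

lemma sum_div_mod:
  fixes f :: "nat \<Rightarrow> nat \<Rightarrow> 'a :: comm_monoid_add"
  shows "(\<Sum>k<a * b. f (k div b) (k mod b)) = (\<Sum>i<a. \<Sum>j<b. f i j)"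
proof -
  have "(\<Sum>i<a. \<Sum>j<b. f i j) = (\<Sum>(i, j)\<in>{..<a} \<times> {..<b}. f i j)"
    by (simp add: sum.cartesian_product)
  also have "\<dots> = (\<Sum>k<a * b. f (k div b) (k mod b))"
  proof (rule sum.reindex_bij_witness[of _ "\<lambda>k. (k div b, k mod b)" "\<lambda>(i, j). i * b + j"])
    fix k assume "k \<in> {..<a * b}"
    thus "(k div b, k mod b) \<in> {..<a} \<times> {..<b}"
      by (cases "b = 0") (auto simp: less_mult_imp_div_less)
  next
    fix p assume "p \<in> {..<a} \<times> {..<b}"
    then obtain i j where p: "p = (i, j)" "i < a" "j < b" by auto
    have "i * b + j < (i + 1) * b" using p by simp
    also have "\<dots> \<le> a * b" using p by (intro mult_right_mono) auto
    finally show "(case p of (i, j) \<Rightarrow> i * b + j) \<in> {..<a * b}" using p by simp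
  qed auto
  finally show ?thesis ..
qed

lemma dim_kron [simp]:
  "dim_row (kron A B) = dim_row A * dim_row B" "dim_col (kron A B) = dim_col A * dim_col B"
  by (simp_all add: kron_def)

lemma kron_carrier [simp]:
  "A \<in> carrier_mat a b \<Longrightarrow> B \<in> carrier_mat c d \<Longrightarrow> kron A B \<in> carrier_mat (a * c) (b * d)"
  by (auto simp: kron_def)

lemma index_kron:
  assumes "i < dim_row A * dim_row B" "j < dim_col A * dim_col B"
  shows "kron A B $$ (i, j) = A $$ (i div dim_row B, j div dim_col B) * B $$ (i mod dim_row B, j mod dim_col B)"
  using assms by (simp add: kron_def)

lemma mod_less_of_less_mult: "i < a * b \<Longrightarrow> i mod b < (b :: nat)"
  by (cases "b = 0") auto

lemmas kron_less = less_mult_imp_div_less mod_less_of_less_mult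

lemma kron_mult:
  assumes "A \<in> carrier_mat a b" "B \<in> carrier_mat c d" "C \<in> carrier_mat b e" "D \<in> carrier_mat d f"
  shows "kron A B * kron C D = kron (A * C) (B * D)"
proof (intro eq_matI)
  fix i j assume "i < dim_row (kron (A * C) (B * D))" "j < dim_col (kron (A * C) (B * D))"
  hence ij: "i < a * c" "j < e * f" using assms by auto
  have "(kron A B * kron C D) $$ (i, j) = (\<Sum>k<b * d. A $$ (i div c, k div d) * B $$ (i mod c, k mod d) *
      (C $$ (k div d, j div f) * D $$ (k mod d, j mod f)))"
    using assms ij by (subst index_mult_mat_sum) (auto simp: index_kron intro!: sum.cong)
  also have "\<dots> = (\<Sum>k<b. \<Sum>l<d. A $$ (i div c, k) * B $$ (i mod c, l) * (C $$ (k, j div f) * D $$ (l, j mod f)))"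
    by (rule sum_div_mod)
  also have "\<dots> = (\<Sum>k<b. A $$ (i div c, k) * C $$ (k, j div f)) * (\<Sum>l<d. B $$ (i mod c, l) * D $$ (l, j mod f))"
    by (simp add: sum_product mult_ac)
  also have "\<dots> = kron (A * C) (B * D) $$ (i, j)"
    using assms ij kron_less[OF ij(1)] kron_less[OF ij(2)]
    by (subst index_kron) (auto simp: index_mult_mat_sum simp del: index_mult_mat(1))
  finally show "(kron A B * kron C D) $$ (i, j) = kron (A * C) (B * D) $$ (i, j)" .
qed (use assms in auto)

lemma kron_adjoint: "mat_adjoint (kron A B) = kron (mat_adjoint A) (mat_adjoint B)"
  by (intro eq_matI) (auto simp: index_kron kron_less)

lemma kron_smult_left: "kron (c \<cdot>\<^sub>m A) B = c \<cdot>\<^sub>m kron A B"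
  by (intro eq_matI) (auto simp: index_kron kron_less)

lemma kron_smult_right: "kron A (c \<cdot>\<^sub>m B) = c \<cdot>\<^sub>m kron A B"
  by (intro eq_matI) (auto simp: index_kron kron_less)

lemma kron_add_left:
  "A \<in> carrier_mat a b \<Longrightarrow> A' \<in> carrier_mat a b \<Longrightarrow> kron (A + A') B = kron A B + kron A' B"
  by (intro eq_matI) (auto simp: index_kron kron_less algebra_simps)

lemma kron_add_right:
  "B \<in> carrier_mat a b \<Longrightarrow> B' \<in> carrier_mat a b \<Longrightarrow> kron A (B + B') = kron A B + kron A B'"
  by (intro eq_matI) (auto simp: index_kron kron_less algebra_simps)

lemma kron_one: "kron (1\<^sub>m a) (1\<^sub>m b) = 1\<^sub>m (a * b)"
proof (intro eq_matI)
  fix i j assume "i < dim_row (1\<^sub>m (a * b) :: complex mat)" "j < dim_col (1\<^sub>m (a * b) :: complex mat)"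
  hence ij: "i < a * b" "j < a * b" by auto
  have "i = j \<longleftrightarrow> i div b = j div b \<and> i mod b = j mod b" by (metis div_mult_mod_eq)
  thus "kron (1\<^sub>m a) (1\<^sub>m b) $$ (i, j) = 1\<^sub>m (a * b) $$ (i, j)"
    using ij kron_less[OF ij(1)] kron_less[OF ij(2)] by (auto simp: index_kron)
qed auto

section \<open>Tensor powers in base-d digits\<close>

lemma mod_power_div_mod:
  fixes d :: nat
  assumes "k < t"
  shows "(i mod d ^ t) div d ^ k mod d = i div d ^ k mod d"
proof (cases "d = 0")
  case True
  thus ?thesis using assms by (cases "k = 0") (auto simp: zero_power)
next
  case False
  have "d ^ t = d ^ k * d ^ (t - k)" using assms by (simp flip: power_add)
  hence "i mod d ^ t = d ^ k * (i div d ^ k mod d ^ (t - k)) + i mod d ^ k"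
    by (simp add: mod_mult2_eq)
  hence "(i mod d ^ t) div d ^ k = i div d ^ k mod d ^ (t - k)"
    using False by simp
  moreover have "d dvd d ^ (t - k)" using assms by simp
  ultimately show ?thesis by (simp add: mod_mod_cancel)
qed

lemma tensor_power_carrier [simp]:
  "A \<in> carrier_mat d e \<Longrightarrow> tensor_power t A \<in> carrier_mat (d ^ t) (e ^ t)"
  by (induction t) auto

text \<open>The indices of a tensor power are numbers with t digits in base d, and the entry is a
  product over digits. \<open>kron\<close> places the new factor in the leading digit, so the
  induction splits off digit \<open>t\<close>; position 0 is the least significant digit.\<close>

lemma tensor_power_index:
  assumes "A \<in> carrier_mat d d" "i < d ^ t" "j < d ^ t"
  shows "tensor_power t A $$ (i, j) = (\<Prod>k<t. A $$ (i div d ^ k mod d, j div d ^ k mod d))"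
  using assms(2,3)
proof (induction t arbitrary: i j)
  case (Suc t)
  have T: "tensor_power t A \<in> carrier_mat (d ^ t) (d ^ t)" using assms(1) by simp
  have "tensor_power (Suc t) A $$ (i, j)
      = A $$ (i div d ^ t, j div d ^ t) * tensor_power t A $$ (i mod d ^ t, j mod d ^ t)"
    using Suc.prems carrier_matD[OF T] assms(1) by (simp add: index_kron)
  also have "tensor_power t A $$ (i mod d ^ t, j mod d ^ t) = (\<Prod>k<t. A $$ (i div d ^ k mod d, j div d ^ k mod d))"
    using Suc.prems by (subst Suc.IH) (auto simp: mod_power_div_mod intro: mod_less_of_less_mult)
  also have "A $$ (i div d ^ t, j div d ^ t) = A $$ (i div d ^ t mod d, j div d ^ t mod d)"
    using Suc.prems by (simp add: less_mult_imp_div_less)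
  finally show ?case by (simp add: mult.commute)
qed auto

section \<open>Explicit two-by-two matrices\<close>

definition mat2 :: "complex \<Rightarrow> complex \<Rightarrow> complex \<Rightarrow> complex \<Rightarrow> complex mat" where
  "mat2 a b c d = mat_of_rows_list 2 [[a, b], [c, d]]"

lemma mat2_carrier [simp]: "mat2 a b c d \<in> carrier_mat 2 2"
  by (auto simp: mat2_def mat_of_rows_list_def numeral_2_eq_2)

lemma dim_mat2 [simp]: "dim_row (mat2 a b c d) = 2" "dim_col (mat2 a b c d) = 2"
  using mat2_carrier[of a b c d] by (simp_all only: carrier_matD)

lemma index_mat2 [simp]:
  "mat2 a b c d $$ (0, 0) = a" "mat2 a b c d $$ (0, Suc 0) = b"
  "mat2 a b c d $$ (Suc 0, 0) = c" "mat2 a b c d $$ (Suc 0, Suc 0) = d"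
  by (simp_all add: mat2_def mat_of_rows_list_def)

lemma eq_mat2I:
  assumes "A \<in> carrier_mat 2 2" "B \<in> carrier_mat 2 2" "A $$ (0, 0) = B $$ (0, 0)" "A $$ (0, Suc 0) = B $$ (0, Suc 0)"
    "A $$ (Suc 0, 0) = B $$ (Suc 0, 0)" "A $$ (Suc 0, Suc 0) = B $$ (Suc 0, Suc 0)"
  shows "A = B"
  using assms by (intro eq_matI) (auto simp: less_2_cases_iff)

lemma mat2_eq_iff [simp]: "mat2 a b c d = mat2 a' b' c' d' \<longleftrightarrow> a = a' \<and> b = b' \<and> c = c' \<and> d = d'"
  by (metis index_mat2)

lemma mat2_mult: "mat2 a b c d * mat2 a' b' c' d' =
    mat2 (a * a' + b * c') (a * b' + b * d') (c * a' + d * c') (c * b' + d * d')"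
  by (rule eq_mat2I) (auto simp: index_mult_mat_sum numeral_2_eq_2 simp del: index_mult_mat(1))

lemma mat2_smult: "k \<cdot>\<^sub>m mat2 a b c d = mat2 (k * a) (k * b) (k * c) (k * d)"
  by (rule eq_mat2I) auto

lemma mat2_add: "mat2 a b c d + mat2 a' b' c' d' = mat2 (a + a') (b + b') (c + c') (d + d')"
  by (rule eq_mat2I) auto

lemma mat2_adjoint: "mat_adjoint (mat2 a b c d) = mat2 (cnj a) (cnj c) (cnj b) (cnj d)"
  by (rule eq_mat2I) auto

lemma one_mat2: "1\<^sub>m 2 = mat2 1 0 0 1"
  by (rule eq_mat2I) auto

lemma mat2_exhaust:
  assumes "A \<in> carrier_mat 2 2"
  obtains a b c d where "A = mat2 a b c d"
  using assms by (metis eq_mat2I index_mat2 mat2_carrier)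

section \<open>Pauli matrices, strings and the Pauli group\<close>

lemma pauli_matrices_eq: "pauli_matrices = {mat2 1 0 0 1, mat2 0 1 1 0, mat2 0 (- \<i>) \<i> 0, mat2 1 0 0 (- 1)}"
  by (simp add: pauli_matrices_def mat2_def)

lemma pauli_matrices_carrier: "P \<in> pauli_matrices \<Longrightarrow> P \<in> carrier_mat 2 2"
  by (auto simp: pauli_matrices_eq)

lemma pauli_strings_carrier: "P \<in> pauli_strings n \<Longrightarrow> P \<in> carrier_mat (2 ^ n) (2 ^ n)"
  by (induction n arbitrary: P) (auto dest!: pauli_matrices_carrier intro!: kron_carrier)

definition phases :: "complex set" where "phases = {1, \<i>, - 1, - \<i>}"

lemma phases_mult: "a \<in> phases \<Longrightarrow> b \<in> phases \<Longrightarrow> a * b \<in> phases"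
  by (auto simp: phases_def)

lemma phases_cnj: "a \<in> phases \<Longrightarrow> a * cnj a = 1"
  by (auto simp: phases_def)

lemma phases_eq_range: "phases = range (\<lambda>k. \<i> ^ k)"
proof
  have "\<i> ^ 0 = 1" "\<i> ^ 1 = \<i>" "\<i> ^ 2 = - 1" "\<i> ^ 3 = - \<i>" by (simp_all add: power3_eq_cube)
  thus "phases \<subseteq> range (\<lambda>k. \<i> ^ k)" unfolding phases_def by (metis empty_subsetI insert_subset rangeI)
  have "\<i> ^ k \<in> phases" for k
  proof (induction k)
    case (Suc k)
    thus ?case using phases_mult[of \<i> "\<i> ^ k"] by (auto simp: phases_def)
  qed (simp add: phases_def)
  thus "range (\<lambda>k. \<i> ^ k) \<subseteq> phases" by auto
qed

lemma pauli_group_eq: "pauli_group n = {c \<cdot>\<^sub>m P | c P. c \<in> phases \<and> P \<in> pauli_strings n}"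
  unfolding pauli_group_def phases_eq_range by auto

lemma pauli_matrices_mult:
  assumes "P \<in> pauli_matrices" "Q \<in> pauli_matrices"
  shows "\<exists>c\<in>phases. \<exists>R\<in>pauli_matrices. P * Q = c \<cdot>\<^sub>m R"
  using assms unfolding pauli_matrices_eq phases_def by (auto simp: mat2_mult mat2_smult)

lemma pauli_matrices_commute:
  assumes "P \<in> pauli_matrices" "Q \<in> pauli_matrices"
  shows "\<exists>c\<in>{1, - 1}. P * Q = c \<cdot>\<^sub>m (Q * P)"
  using assms unfolding pauli_matrices_eq by (auto simp: mat2_mult mat2_smult)

lemma smult_smult_mat: "a \<cdot>\<^sub>m (b \<cdot>\<^sub>m A) = (a * b) \<cdot>\<^sub>m (A :: complex mat)"
  by (intro eq_matI) auto

lemma pauli_strings_mult: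
  assumes "P \<in> pauli_strings n" "Q \<in> pauli_strings n"
  shows "\<exists>c\<in>phases. \<exists>R\<in>pauli_strings n. P * Q = c \<cdot>\<^sub>m R"
  using assms
proof (induction n arbitrary: P Q)
  case 0
  thus ?case by (auto simp: phases_def intro!: bexI[of _ 1])
next
  case (Suc n)
  then obtain p P' q Q' where PQ: "P = kron p P'" "Q = kron q Q'" "p \<in> pauli_matrices" "q \<in> pauli_matrices"
    "P' \<in> pauli_strings n" "Q' \<in> pauli_strings n" by auto
  obtain c r where r: "c \<in> phases" "r \<in> pauli_matrices" "p * q = c \<cdot>\<^sub>m r" using pauli_matrices_mult PQ by blast
  obtain c' R where R: "c' \<in> phases" "R \<in> pauli_strings n" "P' * Q' = c' \<cdot>\<^sub>m R" using Suc.IH PQ by blast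
  have "P * Q = (c * c') \<cdot>\<^sub>m kron r R"
    unfolding PQ using PQ
    by (subst kron_mult[of _ 2 2 _ "2 ^ n" "2 ^ n" _ 2 _ "2 ^ n"])
      (auto simp: pauli_matrices_carrier pauli_strings_carrier r R kron_smult_left kron_smult_right smult_smult_mat mult.commute)
  moreover have "kron r R \<in> pauli_strings (Suc n)" using r R by auto
  ultimately show ?case using phases_mult r R by blast
qed

text \<open>Each pair of tensor factors commutes or anticommutes, and the signs multiply. This
  dichotomy is the case distinction behind \<open>half_phase_normalizer\<close>.\<close>

lemma pauli_strings_commute:
  assumes "P \<in> pauli_strings n" "Q \<in> pauli_strings n"
  shows "\<exists>c\<in>{1, - 1}. P * Q = c \<cdot>\<^sub>m (Q * P)"
  using assms
proof (induction n arbitrary: P Q)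
  case (Suc n)
  then obtain p P' q Q' where PQ: "P = kron p P'" "Q = kron q Q'" "p \<in> pauli_matrices" "q \<in> pauli_matrices"
    "P' \<in> pauli_strings n" "Q' \<in> pauli_strings n" by auto
  obtain c where c: "c \<in> {1, - 1}" "p * q = c \<cdot>\<^sub>m (q * p)" using pauli_matrices_commute PQ by blast
  obtain c' where c': "c' \<in> {1, - 1}" "P' * Q' = c' \<cdot>\<^sub>m (Q' * P')" using Suc.IH PQ by blast
  have "P * Q = kron (p * q) (P' * Q')" "Q * P = kron (q * p) (Q' * P')"
    unfolding PQ using PQ
    by (auto intro!: kron_mult[of _ 2 2 _ "2 ^ n" "2 ^ n" _ 2 _ "2 ^ n"] simp: pauli_matrices_carrier pauli_strings_carrier)
  hence "P * Q = (c * c') \<cdot>\<^sub>m (Q * P)"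
    by (simp add: c(2) c'(2) kron_smult_left kron_smult_right smult_smult_mat mult.commute)
  moreover have "c * c' \<in> {1, - 1}" using c c' by auto
  ultimately show ?case by blast
qed (auto intro!: eq_matI)

lemma pauli_strings_finite: "finite (pauli_strings n)"
proof (induction n)
  case (Suc n)
  have "pauli_strings (Suc n) = (\<lambda>(P, Q). kron P Q) ` (pauli_matrices \<times> pauli_strings n)" by auto
  thus ?case using Suc by (simp add: pauli_matrices_eq)
qed auto

lemma pauli_group_finite: "finite (pauli_group n)"
proof -
  have "pauli_group n = (\<lambda>(c, P). c \<cdot>\<^sub>m P) ` (phases \<times> pauli_strings n)"
    by (auto simp: pauli_group_eq)
  thus ?thesis by (simp add: phases_def pauli_strings_finite)
qed

lemma pauli_group_carrier: "P \<in> pauli_group n \<Longrightarrow> P \<in> carrier_mat (2 ^ n) (2 ^ n)"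
  by (auto simp: pauli_group_eq pauli_strings_carrier)

lemma pauli_strings_in_group: "P \<in> pauli_strings n \<Longrightarrow> P \<in> pauli_group n"
  unfolding pauli_group_eq phases_def by (auto intro!: exI[of _ 1] exI[of _ P] eq_matI)

lemma pauli_group_smult: "c \<in> phases \<Longrightarrow> P \<in> pauli_group n \<Longrightarrow> c \<cdot>\<^sub>m P \<in> pauli_group n"
  by (auto simp: pauli_group_eq smult_smult_mat) (use phases_mult in blast)

section \<open>The normalizer of the Pauli group\<close>

abbreviation "unitary_conj U P \<equiv> U * P * mat_adjoint U"

lemma unitary_conj_smult:
  assumes "U \<in> carrier_mat d d" "P \<in> carrier_mat d d"
  shows "unitary_conj U (c \<cdot>\<^sub>m P) = c \<cdot>\<^sub>m unitary_conj U P"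
  using assms by (simp add: mult_smult_distrib[of _ d d _ d] mult_smult_assoc_mat[of _ d d _ d])

lemma unitary_conj_mult:
  fixes U V P :: "complex mat"
  assumes "U \<in> carrier_mat d d" "V \<in> carrier_mat d d" "P \<in> carrier_mat d d"
  shows "unitary_conj (U * V) P = unitary_conj U (unitary_conj V P)"
  using assms by (simp add: mat_adjoint_mult assoc_mult_mat[of _ d d _ d _ d] mult_carrier_mat[of _ d d _ d])

lemma unitary_conj_cancel:
  assumes "U \<in> unitary_group d" "P \<in> carrier_mat d d"
  shows "mat_adjoint U * unitary_conj U P * U = P"
  using unitary_groupD[OF assms(1)] assms(2) unitary_cancel(1)[OF assms(1), of "P * mat_adjoint U * U" d]
  by (simp add: assoc_mult_mat[of _ d d _ d _ d] mult_carrier_mat[of _ d d _ d])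

text \<open>An inclusion suffices for the equality of sets in \<open>pauli_normalizer\<close>,
  because conjugation by a unitary is injective and the Pauli group is finite. Scalars pass through
  the conjugation, so only strings have to be checked.\<close>

lemma pauli_normalizerI:
  assumes U: "U \<in> unitary_group (2 ^ n)"
    and P: "\<And>P. P \<in> pauli_strings n \<Longrightarrow> unitary_conj U P \<in> pauli_group n"
  shows "U \<in> pauli_normalizer n"
proof -
  have sub: "unitary_conj U ` pauli_group n \<subseteq> pauli_group n"
  proof
    fix Q assume "Q \<in> unitary_conj U ` pauli_group n"
    then obtain c P where cP: "Q = unitary_conj U (c \<cdot>\<^sub>m P)" "c \<in> phases" "P \<in> pauli_strings n"
      by (auto simp: pauli_group_eq)
    thus "Q \<in> pauli_group n"
      using P[OF cP(3)] unitary_conj_smult[OF unitary_groupD(1)[OF U] pauli_strings_carrier[OF cP(3)]]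
      by (simp add: pauli_group_smult)
  qed
  have "inj_on (unitary_conj U) (pauli_group n)"
    by (intro inj_on_inverseI[where g = "\<lambda>P. mat_adjoint U * P * U"]) (metis U pauli_group_carrier unitary_conj_cancel)
  hence "unitary_conj U ` pauli_group n = pauli_group n"
    using sub endo_inj_surj[OF pauli_group_finite] by blast
  thus ?thesis using U by (simp add: pauli_normalizer_def)
qed

lemma pauli_normalizer_unitary: "U \<in> pauli_normalizer n \<Longrightarrow> U \<in> unitary_group (2 ^ n)"
  by (simp add: pauli_normalizer_def)

lemma pauli_normalizer_conj: "U \<in> pauli_normalizer n \<Longrightarrow> P \<in> pauli_group n \<Longrightarrow> unitary_conj U P \<in> pauli_group n"
  by (auto simp: pauli_normalizer_def)

lemma pauli_normalizer_mult:
  assumes "U \<in> pauli_normalizer n" "V \<in> pauli_normalizer n"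
  shows "U * V \<in> pauli_normalizer n"
proof (rule pauli_normalizerI)
  show "U * V \<in> unitary_group (2 ^ n)" using assms by (simp add: unitary_group_mult pauli_normalizer_unitary)
  fix P assume P: "P \<in> pauli_strings n"
  hence "unitary_conj (U * V) P = unitary_conj U (unitary_conj V P)"
    using assms by (intro unitary_conj_mult[of _ "2 ^ n"]) (auto simp: pauli_strings_carrier unitary_groupD pauli_normalizer_unitary)
  thus "unitary_conj (U * V) P \<in> pauli_group n"
    using assms P by (simp add: pauli_normalizer_conj pauli_strings_in_group)
qed

lemma pauli_normalizer_phase:
  assumes U: "U \<in> pauli_normalizer n" and z: "cmod z = 1"
  shows "z \<cdot>\<^sub>m U \<in> pauli_normalizer n"
proof (rule pauli_normalizerI)
  have zz: "z * cnj z = 1" "cnj z * z = 1" using z by (simp_all add: complex_norm_square[symmetric] mult.commute)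
  note u = unitary_groupD[OF pauli_normalizer_unitary[OF U]]
  have s: "unitary_conj (z \<cdot>\<^sub>m U) P = unitary_conj U P" if "P \<in> carrier_mat (2 ^ n) (2 ^ n)" for P
  proof -
    have "unitary_conj (z \<cdot>\<^sub>m U) P = (z * cnj z) \<cdot>\<^sub>m unitary_conj U P"
      using u that by (intro eq_matI) (auto simp: mat_adjoint_smult mult_smult_assoc_mat[of _ "2 ^ n" "2 ^ n" _ "2 ^ n"]
        mult_smult_distrib[of _ "2 ^ n" "2 ^ n" _ "2 ^ n"] mult_ac)
    thus ?thesis using zz by (intro eq_matI) auto
  qed
  show "z \<cdot>\<^sub>m U \<in> unitary_group (2 ^ n)"
  proof (rule unitary_groupI)
    have "mat_adjoint (z \<cdot>\<^sub>m U) * (z \<cdot>\<^sub>m U) = (cnj z * z) \<cdot>\<^sub>m (mat_adjoint U * U)"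
      using u by (intro eq_matI) (auto simp: mat_adjoint_smult mult_smult_assoc_mat[of _ "2 ^ n" "2 ^ n" _ "2 ^ n"]
        mult_smult_distrib[of _ "2 ^ n" "2 ^ n" _ "2 ^ n"] mult_ac)
    thus "mat_adjoint (z \<cdot>\<^sub>m U) * (z \<cdot>\<^sub>m U) = 1\<^sub>m (2 ^ n)" using zz u by (auto intro!: eq_matI)
  qed (use u in auto)
  fix P assume "P \<in> pauli_strings n"
  thus "unitary_conj (z \<cdot>\<^sub>m U) P \<in> pauli_group n"
    using s[of P] pauli_normalizer_conj[OF U, of P] by (simp add: pauli_strings_carrier pauli_strings_in_group)
qed

lemma pauli_normalizer_one: "1\<^sub>m (2 ^ n) \<in> pauli_normalizer n"
  by (rule pauli_normalizerI) (use pauli_strings_carrier pauli_strings_in_group in fastforce)+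


section \<open>Clifford unitaries\<close>

definition diag_of :: "nat \<Rightarrow> (nat \<Rightarrow> complex) \<Rightarrow> complex mat" where
  "diag_of d \<theta> = Matrix.mat d d (\<lambda>(i, j). if i = j then \<theta> i else 0)"

lemma diag_of_carrier [simp]: "diag_of d \<theta> \<in> carrier_mat d d"
  by (simp add: diag_of_def)

lemma dim_diag_of [simp]: "dim_row (diag_of d \<theta>) = d" "dim_col (diag_of d \<theta>) = d"
  by (simp_all add: diag_of_def)

lemma diag_of_mult_left:
  assumes "A \<in> carrier_mat d d"
  shows "diag_of d \<theta> * A = Matrix.mat d d (\<lambda>(i, j). \<theta> i * A $$ (i, j))"
proof (intro eq_matI)
  fix i j assume "i < dim_row (Matrix.mat d d (\<lambda>(i, j). \<theta> i * A $$ (i, j)))" "j < dim_col (Matrix.mat d d (\<lambda>(i, j). \<theta> i * A $$ (i, j)))"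
  hence ij: "i < d" "j < d" by auto
  have "(diag_of d \<theta> * A) $$ (i, j) = (\<Sum>k<d. if i = k then \<theta> i * A $$ (k, j) else 0)"
    using assms ij by (subst index_mult_mat_sum) (auto simp: diag_of_def mult_delta_left mult_delta_right)
  thus "(diag_of d \<theta> * A) $$ (i, j) = Matrix.mat d d (\<lambda>(i, j). \<theta> i * A $$ (i, j)) $$ (i, j)"
    using ij by simp
qed (use assms in auto)

lemma diag_of_mult_right:
  assumes "A \<in> carrier_mat d d"
  shows "A * diag_of d \<theta> = Matrix.mat d d (\<lambda>(i, j). A $$ (i, j) * \<theta> j)"
proof (intro eq_matI)
  fix i j assume "i < dim_row (Matrix.mat d d (\<lambda>(i, j). A $$ (i, j) * \<theta> j))" "j < dim_col (Matrix.mat d d (\<lambda>(i, j). A $$ (i, j) * \<theta> j))"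
  hence ij: "i < d" "j < d" by auto
  have "(A * diag_of d \<theta>) $$ (i, j) = (\<Sum>k<d. if k = j then A $$ (i, k) * \<theta> j else 0)"
    using assms ij by (subst index_mult_mat_sum) (auto simp: diag_of_def mult_delta_left mult_delta_right)
  thus "(A * diag_of d \<theta>) $$ (i, j) = Matrix.mat d d (\<lambda>(i, j). A $$ (i, j) * \<theta> j) $$ (i, j)"
    using ij by simp
qed (use assms in auto)

lemma diag_of_mult: "diag_of d \<theta> * diag_of d \<eta> = diag_of d (\<lambda>x. \<theta> x * \<eta> x)"
  by (subst diag_of_mult_left) (auto simp: diag_of_def)

lemma diag_of_adjoint: "mat_adjoint (diag_of d \<theta>) = diag_of d (\<lambda>x. cnj (\<theta> x))"
  by (intro eq_matI) (auto simp: diag_of_def)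

lemma diag_of_cong: "(\<And>x. x < d \<Longrightarrow> \<theta> x = \<eta> x) \<Longrightarrow> diag_of d \<theta> = diag_of d \<eta>"
  by (intro eq_matI) (auto simp: diag_of_def)

lemma diag_of_conj:
  assumes "A \<in> carrier_mat d d"
  shows "unitary_conj (diag_of d \<theta>) A = Matrix.mat d d (\<lambda>(i, j). \<theta> i * A $$ (i, j) * cnj (\<theta> j))"
  using assms unfolding diag_of_adjoint diag_of_mult_left[OF assms]
  by (subst diag_of_mult_right) auto

lemma diag_of_unitary:
  assumes "\<And>x. x < d \<Longrightarrow> cmod (\<theta> x) = 1"
  shows "diag_of d \<theta> \<in> unitary_group d"
proof (rule unitary_groupI)
  have "\<theta> x * cnj (\<theta> x) = 1" if "x < d" for x
    using assms[OF that] by (simp flip: complex_norm_square)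
  thus "mat_adjoint (diag_of d \<theta>) * diag_of d \<theta> = 1\<^sub>m d"
    unfolding diag_of_adjoint diag_of_mult by (intro eq_matI) (auto simp: diag_of_def mult.commute)
qed auto

text \<open>The character of x given by the parity of the bits of x in S. It is the diagonal of the
  Pauli string with Z on the qubits in S and the identity elsewhere, where qubit k is the binary
  digit of weight 2^k.\<close>

definition z_sign :: "nat \<Rightarrow> nat set \<Rightarrow> nat \<Rightarrow> complex" where
  "z_sign n S x = (\<Prod>k<n. if k \<in> S \<and> odd (x div 2 ^ k) then - 1 else 1)"

lemma z_sign_values: "z_sign n S x \<in> {1, - 1}"
  unfolding z_sign_def by (induction n) auto

lemma diag_z_sign_pauli: "diag_of (2 ^ n) (z_sign n S) \<in> pauli_strings n"
proof (induction n)
  case 0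
  have "diag_of 1 (z_sign 0 S) = 1\<^sub>m 1" by (intro eq_matI) (auto simp: diag_of_def z_sign_def)
  thus ?case by simp
next
  case (Suc n)
  define P where "P = (if n \<in> S then mat2 1 0 0 (- 1) else mat2 1 0 0 1)"
  have Pp: "P \<in> pauli_matrices" and Pc: "P \<in> carrier_mat 2 2" by (auto simp: P_def pauli_matrices_eq)
  have Pe: "P $$ (a, b) = (if a = b then if n \<in> S \<and> odd a then - 1 else 1 else 0)" if "a < 2" "b < 2" for a b
    using that by (auto simp: P_def less_2_cases_iff)
  \<comment> \<open>The leading binary digit belongs to the new qubit \<open>n\<close>, and the
    remaining digits are those of x mod 2^n.\<close>
  have z: "z_sign (Suc n) S x = (if n \<in> S \<and> odd (x div 2 ^ n) then - 1 else 1) * z_sign n S (x mod 2 ^ n)" for x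
  proof -
    have "odd ((x mod 2 ^ n) div 2 ^ k) = odd (x div 2 ^ k)" if "k < n" for k
      using mod_power_div_mod[OF that, of x 2] by (metis odd_iff_mod_2_eq_one)
    hence "z_sign n S (x mod 2 ^ n) = z_sign n S x" by (simp add: z_sign_def)
    thus ?thesis by (simp add: z_sign_def mult.commute)
  qed
  have "diag_of (2 ^ Suc n) (z_sign (Suc n) S) = kron P (diag_of (2 ^ n) (z_sign n S))"
  proof (intro eq_matI)
    fix i j assume "i < dim_row (kron P (diag_of (2 ^ n) (z_sign n S)))" "j < dim_col (kron P (diag_of (2 ^ n) (z_sign n S)))"
    hence ij: "i < 2 * 2 ^ n" "j < 2 * 2 ^ n" using Pc by auto
    have "i = j \<longleftrightarrow> i div 2 ^ n = j div 2 ^ n \<and> i mod 2 ^ n = j mod 2 ^ n" by (metis div_mult_mod_eq)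
    thus "diag_of (2 ^ Suc n) (z_sign (Suc n) S) $$ (i, j) = kron P (diag_of (2 ^ n) (z_sign n S)) $$ (i, j)"
      using ij Pc kron_less[OF ij(1)] kron_less[OF ij(2)]
      by (auto simp: index_kron Pe diag_of_def z)
  qed (use Pc in auto)
  thus ?case using Pp Suc by auto
qed

text \<open>The diagonal of a square root of the Z-string on S. For one qubit it is the phase gate;
  for two qubits it is the product of both phase gates and a controlled Z, since the phase is a
  power of \<i> with the parity of two bits as its exponent.\<close>

definition half_phase :: "nat \<Rightarrow> nat set \<Rightarrow> nat \<Rightarrow> complex" where
  "half_phase n S x = (if z_sign n S x = 1 then 1 else \<i>)"

text \<open>Let Z be the Z-string on S. If P commutes with Z, its nonzero entries join indices of
  equal sign, so the square root of Z commutes with P as well. If P anticommutes with Z, its nonzero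
  entries join indices of opposite sign, and conjugation turns P into -\<i> Z P, again a Pauli up to
  a phase.\<close>

lemma half_phase_normalizer: "diag_of (2 ^ n) (half_phase n S) \<in> pauli_normalizer n"
proof (rule pauli_normalizerI)
  let ?d = "2 ^ n :: nat" and ?\<theta> = "half_phase n S" and ?e = "z_sign n S"
  show "diag_of ?d ?\<theta> \<in> unitary_group ?d"
    by (rule diag_of_unitary) (auto simp: half_phase_def)
  let ?Z = "diag_of ?d ?e"
  fix P assume P: "P \<in> pauli_strings n"
  note Pc = pauli_strings_carrier[OF P]
  obtain c where c: "c \<in> {1, - 1}" "?Z * P = c \<cdot>\<^sub>m (P * ?Z)"
    using pauli_strings_commute[OF diag_z_sign_pauli P] by blast
  have ent: "?e i * P $$ (i, j) = c * (P $$ (i, j) * ?e j)" if "i < ?d" "j < ?d" for i j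
    using arg_cong[OF c(2), of "\<lambda>M. M $$ (i, j)"] that Pc
    by (simp add: diag_of_mult_left[OF Pc] diag_of_mult_right[OF Pc])
  have ev: "?e i = 1 \<or> ?e i = - 1" for i using z_sign_values[of n S i] by auto
  show "unitary_conj (diag_of ?d ?\<theta>) P \<in> pauli_group n"
  proof (cases "c = 1")
    case True
    have "?\<theta> i * P $$ (i, j) * cnj (?\<theta> j) = P $$ (i, j)" if ij: "i < ?d" "j < ?d" for i j
    proof -
      have "P $$ (i, j) = 0 \<or> ?e i = ?e j" using ent[OF ij] True by auto
      thus ?thesis by (auto simp: half_phase_def)
    qed
    hence "unitary_conj (diag_of ?d ?\<theta>) P = P"
      unfolding diag_of_conj[OF Pc] using Pc by (intro eq_matI) auto
    thus ?thesis using P by (simp add: pauli_strings_in_group)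
  next
    case False
    hence c1: "c = - 1" using c by auto
    have "?\<theta> i * P $$ (i, j) * cnj (?\<theta> j) = - \<i> * (?e i * P $$ (i, j))" if ij: "i < ?d" "j < ?d" for i j
    proof -
      have "(?e i + ?e j) * P $$ (i, j) = 0" using ent[OF ij] c1 by (simp add: algebra_simps)
      hence "P $$ (i, j) = 0 \<or> ?e i = - ?e j" by (auto simp: eq_neg_iff_add_eq_0)
      thus ?thesis using ev[of i] ev[of j] by (auto simp: half_phase_def)
    qed
    hence "unitary_conj (diag_of ?d ?\<theta>) P = (- \<i>) \<cdot>\<^sub>m (?Z * P)"
      unfolding diag_of_conj[OF Pc] unfolding diag_of_mult_left[OF Pc] by (intro eq_matI) auto
    moreover have "- \<i> \<in> phases" by (simp add: phases_def)
    moreover obtain b R where "b \<in> phases" "R \<in> pauli_strings n" "?Z * P = b \<cdot>\<^sub>m R"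
      using pauli_strings_mult[OF diag_z_sign_pauli P] by blast
    ultimately show ?thesis
      by (metis pauli_group_smult pauli_strings_in_group)
  qed
qed

section \<open>The Hadamard transform\<close>

definition hadamard1 :: "complex mat" where
  "hadamard1 = (1 / of_real (sqrt 2)) \<cdot>\<^sub>m mat2 1 1 1 (- 1)"

abbreviation "hadamard n \<equiv> tensor_power n hadamard1"

lemma hadamard1_carrier [simp]: "hadamard1 \<in> carrier_mat 2 2"
  by (simp add: hadamard1_def)

lemma sqrt2_inverse_square: "(1 / complex_of_real (sqrt 2)) * (1 / complex_of_real (sqrt 2)) = 1 / 2"
  by (simp flip: of_real_mult)

lemma hadamard1_conj:
  assumes "P \<in> pauli_matrices"
  shows "\<exists>c\<in>phases. \<exists>R\<in>pauli_matrices. unitary_conj hadamard1 P = c \<cdot>\<^sub>m R"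
proof -
  define s where "s = 1 / complex_of_real (sqrt 2)"
  have s: "s * s = 1 / 2" "cnj s = s"
    using sqrt2_inverse_square by (simp_all add: s_def)
  have h: "hadamard1 = mat2 s s s (- s)" "mat_adjoint hadamard1 = mat2 s s s (- s)"
    by (simp_all add: hadamard1_def s_def[symmetric] mat2_smult mat2_adjoint s)
  have "unitary_conj hadamard1 (mat2 1 0 0 1) = 1 \<cdot>\<^sub>m mat2 1 0 0 1"
    "unitary_conj hadamard1 (mat2 0 1 1 0) = 1 \<cdot>\<^sub>m mat2 1 0 0 (- 1)"
    "unitary_conj hadamard1 (mat2 0 (- \<i>) \<i> 0) = (- 1) \<cdot>\<^sub>m mat2 0 (- \<i>) \<i> 0"
    "unitary_conj hadamard1 (mat2 1 0 0 (- 1)) = 1 \<cdot>\<^sub>m mat2 0 1 1 0"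
    unfolding h(2) unfolding h(1) by (simp_all add: mat2_mult mat2_smult s mult.assoc mult.left_commute[of \<i>] mult.commute[of \<i>])
  thus ?thesis
    using assms unfolding pauli_matrices_eq phases_def by blast
qed

lemma hadamard1_unitary: "hadamard1 \<in> unitary_group 2"
proof (rule unitary_groupI)
  define s where "s = 1 / complex_of_real (sqrt 2)"
  have s: "s * s = 1 / 2" "cnj s = s" using sqrt2_inverse_square by (simp_all add: s_def)
  show "mat_adjoint hadamard1 * hadamard1 = 1\<^sub>m 2"
    unfolding hadamard1_def s_def[symmetric] one_mat2 by (simp add: mat2_mult mat2_smult mat2_adjoint s)
qed simp

lemma tensor_power_unitary:
  assumes "U \<in> unitary_group d"
  shows "tensor_power t U \<in> unitary_group (d ^ t)"
proof (rule unitary_groupI)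
  note u = unitary_groupD[OF assms]
  show "tensor_power t U \<in> carrier_mat (d ^ t) (d ^ t)" using u by simp
  show "mat_adjoint (tensor_power t U) * tensor_power t U = 1\<^sub>m (d ^ t)"
  proof (induction t)
    case (Suc t)
    have "mat_adjoint (tensor_power (Suc t) U) * tensor_power (Suc t) U
        = kron (mat_adjoint U * U) (mat_adjoint (tensor_power t U) * tensor_power t U)"
      using u by (simp add: kron_adjoint kron_mult[of _ d d _ "d ^ t" "d ^ t" _ d _ "d ^ t"])
    thus ?case using u Suc by (simp add: kron_one)
  qed auto
qed

lemma hadamard_normalizer: "hadamard n \<in> pauli_normalizer n"
proof (rule pauli_normalizerI)
  show "hadamard n \<in> unitary_group (2 ^ n)" by (rule tensor_power_unitary[OF hadamard1_unitary])
  have "\<exists>c\<in>phases. \<exists>R\<in>pauli_strings n. unitary_conj (hadamard n) P = c \<cdot>\<^sub>m R"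
    if "P \<in> pauli_strings n" for P
    using that
  proof (induction n arbitrary: P)
    case 0
    thus ?case by (auto simp: phases_def)
  next
    case (Suc n)
    then obtain p Q where P: "P = kron p Q" "p \<in> pauli_matrices" "Q \<in> pauli_strings n" by auto
    note pc = pauli_matrices_carrier[OF P(2)] and Qc = pauli_strings_carrier[OF P(3)]
    obtain c r where r: "c \<in> phases" "r \<in> pauli_matrices" "unitary_conj hadamard1 p = c \<cdot>\<^sub>m r"
      using hadamard1_conj P by blast
    obtain c' R where R: "c' \<in> phases" "R \<in> pauli_strings n" "unitary_conj (hadamard n) Q = c' \<cdot>\<^sub>m R"
      using Suc.IH P by blast
    have h: "hadamard n \<in> carrier_mat (2 ^ n) (2 ^ n)" by simp
    have "unitary_conj (hadamard (Suc n)) P = kron (unitary_conj hadamard1 p) (unitary_conj (hadamard n) Q)"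
      unfolding P(1) using pc Qc h
      by (simp add: kron_adjoint kron_mult[of _ 2 2 _ "2 ^ n" "2 ^ n" _ 2 _ "2 ^ n"] mult_carrier_mat[of _ 2 2 _ 2]
          mult_carrier_mat[of _ "2 ^ n" "2 ^ n" _ "2 ^ n"])
    also have "\<dots> = (c * c') \<cdot>\<^sub>m kron r R"
      by (simp add: r R kron_smult_left kron_smult_right smult_smult_mat mult.commute)
    moreover have "kron r R \<in> pauli_strings (Suc n)" using r R by auto
    ultimately show ?case using phases_mult r R by metis
  qed
  thus "unitary_conj (hadamard n) P \<in> pauli_group n" if "P \<in> pauli_strings n" for P
    using that by (metis pauli_group_smult pauli_strings_in_group)
qed

section \<open>Pauli strings span all matrices, and Schur's lemma\<close>

lemma pauli_strings_span:
  assumes "\<And>A B. A \<in> S \<Longrightarrow> B \<in> S \<Longrightarrow> A + B \<in> S" "\<And>c A. A \<in> S \<Longrightarrow> c \<cdot>\<^sub>m A \<in> S" "pauli_strings n \<subseteq> S"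
  shows "carrier_mat (2 ^ n) (2 ^ n) \<subseteq> S"
  using assms
proof (induction n arbitrary: S)
  case 0
  have "A = (A $$ (0, 0)) \<cdot>\<^sub>m 1\<^sub>m 1" if "A \<in> carrier_mat 1 1" for A :: "complex mat"
    using that by (intro eq_matI) auto
  thus ?case using 0 by (metis insert_subset pauli_strings.simps(1) power_0 subsetI)
next
  case (Suc n)
  let ?d = "2 ^ n :: nat"
  note add = Suc.prems(1) and smult = Suc.prems(2)
  \<comment> \<open>For a fixed first factor, the matrices B with \<open>kron P B\<close> in
    \<open>S\<close> are again closed under sums and scalars and contain the shorter strings. The
    induction hypothesis is applied to this set, which is why \<open>S\<close> is
    generalised.\<close>
  have k1: "kron P B \<in> S" if P: "P \<in> pauli_matrices" and B: "B \<in> carrier_mat ?d ?d" for P B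
  proof -
    have "carrier_mat ?d ?d \<subseteq> {B \<in> carrier_mat ?d ?d. kron P B \<in> S}"
    proof (rule Suc.IH)
      show "pauli_strings n \<subseteq> {B \<in> carrier_mat ?d ?d. kron P B \<in> S}"
        using P Suc.prems(3) pauli_strings_carrier by auto
    qed (auto simp: kron_add_right kron_smult_right intro: add smult)
    thus ?thesis using B by blast
  qed
  have k2: "kron A B \<in> S" if A: "A \<in> carrier_mat 2 2" and B: "B \<in> carrier_mat ?d ?d" for A B
  proof -
    obtain a b c e where A: "A = mat2 a b c e" using A by (rule mat2_exhaust)
    \<comment> \<open>The coefficient of each Pauli matrix P is tr(PA)/2.\<close>
    have "A = ((a + e) / 2) \<cdot>\<^sub>m mat2 1 0 0 1 + (((b + c) / 2) \<cdot>\<^sub>m mat2 0 1 1 0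
        + (((\<i> * (b - c) / 2) \<cdot>\<^sub>m mat2 0 (- \<i>) \<i> 0) + ((a - e) / 2) \<cdot>\<^sub>m mat2 1 0 0 (- 1)))"
      unfolding A by (simp add: mat2_smult mat2_add field_simps)
    hence "kron A B = ((a + e) / 2) \<cdot>\<^sub>m kron (mat2 1 0 0 1) B + (((b + c) / 2) \<cdot>\<^sub>m kron (mat2 0 1 1 0) B
        + (((\<i> * (b - c) / 2) \<cdot>\<^sub>m kron (mat2 0 (- \<i>) \<i> 0) B) + ((a - e) / 2) \<cdot>\<^sub>m kron (mat2 1 0 0 (- 1)) B))"
      by (simp add: kron_add_left[of _ 2 2] kron_smult_left)
    also have "\<dots> \<in> S" by (intro add smult k1 B) (auto simp: pauli_matrices_eq)
    finally show ?thesis .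
  qed
  show ?case
  proof
    fix M :: "complex mat" assume M: "M \<in> carrier_mat (2 ^ Suc n) (2 ^ Suc n)"
    define blk where "blk a b = Matrix.mat ?d ?d (\<lambda>(i, j). M $$ (a * ?d + i, b * ?d + j))" for a b
    have "M = kron (mat2 1 0 0 0) (blk 0 0) + (kron (mat2 0 1 0 0) (blk 0 1)
       + (kron (mat2 0 0 1 0) (blk 1 0) + kron (mat2 0 0 0 1) (blk 1 1)))" (is "M = ?R")
    proof (intro eq_matI)
      fix i j assume "i < dim_row ?R" "j < dim_col ?R"
      hence ij: "i < 2 * ?d" "j < 2 * ?d" by (auto simp: blk_def)
      have "M $$ (i, j) = M $$ (i div ?d * ?d + i mod ?d, j div ?d * ?d + j mod ?d)"
        by (simp only: div_mult_mod_eq)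
      moreover have "i div ?d = 0 \<or> i div ?d = Suc 0" "j div ?d = 0 \<or> j div ?d = Suc 0"
        using kron_less(1)[OF ij(1)] kron_less(1)[OF ij(2)] by auto
      ultimately show "M $$ (i, j) = ?R $$ (i, j)"
        using ij kron_less[OF ij(1)] kron_less[OF ij(2)] by (auto simp: index_kron blk_def)
    qed (use M in \<open>auto simp: blk_def\<close>)
    also have "?R \<in> S" by (intro add k2) (auto simp: blk_def)
    finally show "M \<in> S" .
  qed
qed

text \<open>By the spanning lemma, commuting with all strings means commuting with all matrices, in
  particular with the matrix units \<open>E a b\<close>.\<close>

lemma pauli_commutant_scalar:
  assumes M: "M \<in> carrier_mat (2 ^ n) (2 ^ n)" and comm: "\<And>P. P \<in> pauli_strings n \<Longrightarrow> M * P = P * M"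
  obtains z where "M = z \<cdot>\<^sub>m 1\<^sub>m (2 ^ n)"
proof -
  let ?d = "2 ^ n :: nat"
  have all: "carrier_mat ?d ?d \<subseteq> {B \<in> carrier_mat ?d ?d. M * B = B * M}"
  proof (rule pauli_strings_span)
    show "pauli_strings n \<subseteq> {B \<in> carrier_mat ?d ?d. M * B = B * M}"
      using comm pauli_strings_carrier by auto
  qed (use M in \<open>auto simp: mult_add_distrib_mat[of _ ?d ?d _ ?d] add_mult_distrib_mat[of _ ?d ?d _ _ ?d]
      mult_smult_distrib[of _ ?d ?d _ ?d] mult_smult_assoc_mat[of _ ?d ?d _ ?d]\<close>)
  define E where "E a b = Matrix.mat ?d ?d (\<lambda>(i, j). if i = a \<and> j = b then 1 else 0 :: complex)" for a b
  have ME: "(M * E a b) $$ (i, j) = (if j = b then M $$ (i, a) else 0)"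
    and EM: "(E a b * M) $$ (i, j) = (if i = a then M $$ (b, j) else 0)"
    if "i < ?d" "j < ?d" "a < ?d" "b < ?d" for i j a b
  proof -
    have "(M * E a b) $$ (i, j) = (\<Sum>k<?d. if k = a then if j = b then M $$ (i, a) else 0 else 0)"
      using M that by (subst index_mult_mat_sum) (auto simp: E_def mult_delta_left mult_delta_right)
    thus "(M * E a b) $$ (i, j) = (if j = b then M $$ (i, a) else 0)" using that by simp
    have "(E a b * M) $$ (i, j) = (\<Sum>k<?d. if k = b then if i = a then M $$ (b, j) else 0 else 0)"
      using M that by (subst index_mult_mat_sum) (auto simp: E_def mult_delta_left mult_delta_right)
    thus "(E a b * M) $$ (i, j) = (if i = a then M $$ (b, j) else 0)" using that by simp
  qed
  have eq: "(M * E a b) $$ (i, j) = (E a b * M) $$ (i, j)" for a b i j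
  proof -
    have "E a b \<in> carrier_mat ?d ?d" by (simp add: E_def)
    hence "M * E a b = E a b * M" using all by blast
    thus ?thesis by simp
  qed
  have "M = M $$ (0, 0) \<cdot>\<^sub>m 1\<^sub>m ?d"
  proof (intro eq_matI)
    fix i j assume "i < dim_row (M $$ (0, 0) \<cdot>\<^sub>m 1\<^sub>m ?d)" "j < dim_col (M $$ (0, 0) \<cdot>\<^sub>m 1\<^sub>m ?d)"
    hence ij: "i < ?d" "j < ?d" by auto
    \<comment> \<open>Entry (i, 0) of M E = E M for the matrix unit at (j, 0): the left side is M at
      (i, j), the right side is M at (0, 0) if i = j and 0 otherwise.\<close>
    show "M $$ (i, j) = (M $$ (0, 0) \<cdot>\<^sub>m 1\<^sub>m ?d) $$ (i, j)"
      using eq[of j 0 i 0] ij ME[of i 0 j 0] EM[of i 0 j 0] by auto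
  qed (use M in auto)
  thus thesis by (rule that)
qed


section \<open>The finite Clifford group\<close>

definition phase_rel :: "nat \<Rightarrow> (complex mat \<times> complex mat) set" where
  "phase_rel n = {(U, V). U \<in> pauli_normalizer n \<and> (\<exists>z. cmod z = 1 \<and> V = z \<cdot>\<^sub>m U)}"

lemma clifford_group_eq: "clifford_group n = pauli_normalizer n // phase_rel n"
  by (simp add: clifford_group_def phase_rel_def)

lemma one_smult_mat [simp]: "1 \<cdot>\<^sub>m A = (A :: complex mat)"
  by (intro eq_matI) auto

lemma equiv_phase_rel: "equiv (pauli_normalizer n) (phase_rel n)"
proof (rule equivI)
  show "refl_on (pauli_normalizer n) (phase_rel n)"
    unfolding refl_on_def phase_rel_def by (auto intro!: exI[of _ "1 :: complex"])
  show "sym (phase_rel n)"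
  proof (rule symI)
    fix U V assume "(U, V) \<in> phase_rel n"
    then obtain z where z: "U \<in> pauli_normalizer n" "cmod z = 1" "V = z \<cdot>\<^sub>m U" by (auto simp: phase_rel_def)
    have "cnj z \<cdot>\<^sub>m V = U" using z by (simp add: smult_smult_mat mult.commute[of "cnj z"] flip: complex_norm_square)
    hence "\<exists>w. cmod w = 1 \<and> U = w \<cdot>\<^sub>m V" using z(2) by (intro exI[of _ "cnj z"] conjI) (simp, rule sym)
    moreover have "V \<in> pauli_normalizer n" using z pauli_normalizer_phase by simp
    ultimately show "(V, U) \<in> phase_rel n" unfolding phase_rel_def by blast
  qed
  show "trans (phase_rel n)"
  proof (rule transI)
    fix U V W assume "(U, V) \<in> phase_rel n" "(V, W) \<in> phase_rel n"
    then obtain y z where "U \<in> pauli_normalizer n" "cmod y = 1" "V = y \<cdot>\<^sub>m U" "cmod z = 1" "W = z \<cdot>\<^sub>m V"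
      by (auto simp: phase_rel_def)
    thus "(U, W) \<in> phase_rel n"
      by (auto simp: phase_rel_def smult_smult_mat norm_mult intro!: exI[of _ "z * y"])
  qed
  show "phase_rel n \<subseteq> pauli_normalizer n \<times> pauli_normalizer n"
    unfolding phase_rel_def by (auto intro: pauli_normalizer_phase)
qed

abbreviation "class_rep A \<equiv> (SOME U. U \<in> (A :: complex mat set))"

lemma class_rep:
  assumes "A \<in> clifford_group n"
  shows "class_rep A \<in> pauli_normalizer n" "phase_rel n `` {class_rep A} = A"
proof -
  have "class_rep A \<in> A"
    using assms in_quotient_imp_non_empty[OF equiv_phase_rel] unfolding clifford_group_eq by (metis ex_in_conv someI_ex)
  moreover from this show "class_rep A \<in> pauli_normalizer n"
    using assms in_quotient_imp_subset[OF equiv_phase_rel] unfolding clifford_group_eq by blast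
  ultimately show "phase_rel n `` {class_rep A} = A"
    using assms unfolding clifford_group_eq quotient_def
    by (auto simp: equiv_class_eq_iff[OF equiv_phase_rel])
qed

text \<open>If U and V act in the same way on Pauli strings, then V* U commutes with all of them. It
  is therefore a scalar, and of modulus 1 because it is unitary.\<close>

lemma same_conj_phase:
  assumes U: "U \<in> pauli_normalizer n" and V: "V \<in> pauli_normalizer n"
    and eq: "\<And>P. P \<in> pauli_strings n \<Longrightarrow> unitary_conj U P = unitary_conj V P"
  shows "(V, U) \<in> phase_rel n"
proof -
  let ?d = "2 ^ n :: nat"
  note Uu = pauli_normalizer_unitary[OF U] and Vu = pauli_normalizer_unitary[OF V]
  note u = unitary_groupD[OF Uu] and v = unitary_groupD[OF Vu]
  define M where "M = mat_adjoint V * U"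
  have Mc: "M \<in> carrier_mat ?d ?d" using u v by (auto simp: M_def)
  have Mu: "M \<in> unitary_group ?d" unfolding M_def by (intro unitary_group_mult unitary_group_adjoint Uu Vu)
  have comm: "M * P = P * M" if P: "P \<in> pauli_strings n" for P
  proof -
    note Pc = pauli_strings_carrier[OF P]
    have "mat_adjoint V * unitary_conj U P * U = M * P"
      using u v Pc by (simp add: M_def assoc_mult_mat[of _ ?d ?d _ ?d _ ?d] mult_carrier_mat[of _ ?d ?d _ ?d])
    moreover have "mat_adjoint V * unitary_conj V P * U = P * M"
      using u v Pc unitary_cancel(1)[OF Vu, of "P * (mat_adjoint V * U)" ?d]
      by (simp add: M_def assoc_mult_mat[of _ ?d ?d _ ?d _ ?d] mult_carrier_mat[of _ ?d ?d _ ?d])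
    ultimately show ?thesis using eq[OF P] by simp
  qed
  obtain z where z: "M = z \<cdot>\<^sub>m 1\<^sub>m ?d" using pauli_commutant_scalar[OF Mc comm] by auto
  have "mat_adjoint M * M = (z * cnj z) \<cdot>\<^sub>m 1\<^sub>m ?d"
    unfolding z by (simp add: mat_adjoint_smult mult_smult_assoc_mat[of _ ?d ?d _ ?d]
        mult_smult_distrib[of _ ?d ?d _ ?d] smult_smult_mat)
  hence "((z * cnj z) \<cdot>\<^sub>m 1\<^sub>m ?d) $$ (0, 0) = (1\<^sub>m ?d :: complex mat) $$ (0, 0)"
    using unitary_groupD(2)[OF Mu] by simp
  hence "z * cnj z = 1" by simp
  hence "cmod z = 1" by (metis complex_norm_square norm_ge_zero of_real_eq_1_iff power2_eq_1_iff norm_one of_real_1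
        less_le_not_le abs_norm_cancel abs_square_eq_1 power2_eq_square)
  moreover have "U = z \<cdot>\<^sub>m V"
  proof -
    have "U = V * M" unfolding M_def using unitary_cancel(2)[OF Vu u(1)] by simp
    also have "\<dots> = z \<cdot>\<^sub>m V" unfolding z using v by (simp add: mult_smult_distrib[of _ ?d ?d _ ?d])
    finally show ?thesis .
  qed
  ultimately show ?thesis using V by (auto simp: phase_rel_def)
qed

text \<open>A class is determined by the conjugation action of its representative on the Pauli
  group, and a finite set has only finitely many self-maps. Without finiteness
  \<open>pmf_of_set\<close> in \<open>uniform_clifford\<close> would not be the uniform
  distribution.\<close>

lemma clifford_group_finite: "finite (clifford_group n)"
proof -
  let ?act = "\<lambda>A. restrict (unitary_conj (class_rep A)) (pauli_group n)"
  have "?act ` clifford_group n \<subseteq> pauli_group n \<rightarrow>\<^sub>E pauli_group n"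
    using class_rep(1) pauli_normalizer_conj by fastforce
  moreover have "finite (pauli_group n \<rightarrow>\<^sub>E pauli_group n)"
    by (intro finite_PiE pauli_group_finite)
  ultimately have "finite (?act ` clifford_group n)" by (rule finite_subset)
  moreover have "inj_on ?act (clifford_group n)"
  proof (rule inj_onI)
    fix A B assume AB: "A \<in> clifford_group n" "B \<in> clifford_group n" "?act A = ?act B"
    have "unitary_conj (class_rep A) P = unitary_conj (class_rep B) P" if "P \<in> pauli_strings n" for P
      using fun_cong[OF AB(3), of P] that by (simp add: pauli_strings_in_group)
    hence "(class_rep B, class_rep A) \<in> phase_rel n"
      using class_rep(1) AB by (intro same_conj_phase) auto
    hence "phase_rel n `` {class_rep B} = phase_rel n `` {class_rep A}"
      by (rule equiv_class_eq[OF equiv_phase_rel])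
    thus "A = B" using class_rep(2) AB by auto
  qed
  ultimately show ?thesis by (rule finite_imageD)
qed

lemma clifford_group_nonempty: "clifford_group n \<noteq> {}"
  using pauli_normalizer_one by (auto simp: clifford_group_eq quotient_is_empty)

lemma set_uniform_clifford: "set_pmf (uniform_clifford n) \<subseteq> pauli_normalizer n"
  using class_rep(1) by (auto simp: uniform_clifford_def clifford_group_finite clifford_group_nonempty)

lemma finite_set_uniform_clifford: "finite (set_pmf (uniform_clifford n))"
  by (auto simp: uniform_clifford_def clifford_group_finite clifford_group_nonempty)

text \<open>Multiplication by \<open>V\<close> permutes the finitely many classes. It does not map
  chosen representatives to chosen representatives, only up to a phase, hence the restriction to
  functions \<open>f\<close> that do not see phases.\<close>

lemma uniform_clifford_left_invariant:
  fixes f :: "complex mat \<Rightarrow> real"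
  assumes V: "V \<in> pauli_normalizer n"
    and f: "\<And>z U. cmod z = 1 \<Longrightarrow> U \<in> pauli_normalizer n \<Longrightarrow> f (z \<cdot>\<^sub>m U) = f U"
  shows "(\<integral>U. f (V * U) \<partial>uniform_clifford n) = (\<integral>U. f U \<partial>uniform_clifford n)"
proof -
  let ?d = "2 ^ n :: nat"
  note Vu = pauli_normalizer_unitary[OF V]
  \<comment> \<open>The permutation of the classes that left multiplication by \<open>V\<close>
    induces.\<close>
  define \<tau> where "\<tau> A = phase_rel n `` {V * class_rep A}" for A
  have N: "V * class_rep A \<in> pauli_normalizer n" if "A \<in> clifford_group n" for A
    using that V class_rep(1) by (intro pauli_normalizer_mult)
  have \<tau>: "\<tau> A \<in> clifford_group n" if "A \<in> clifford_group n" for A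
    using N[OF that] unfolding \<tau>_def clifford_group_eq by (rule quotientI)
  have rel: "(V * class_rep A, class_rep (\<tau> A)) \<in> phase_rel n" if A: "A \<in> clifford_group n" for A
    by (rule eq_equiv_class[OF _ equiv_phase_rel class_rep(1)[OF \<tau>[OF A]]])
      (unfold class_rep(2)[OF \<tau>[OF A]], simp add: \<tau>_def)
  have "inj_on \<tau> (clifford_group n)"
  proof (rule inj_onI)
    fix A B assume AB: "A \<in> clifford_group n" "B \<in> clifford_group n" "\<tau> A = \<tau> B"
    hence "(V * class_rep A, V * class_rep B) \<in> phase_rel n"
      using eq_equiv_class_iff[OF equiv_phase_rel N[OF AB(1)] N[OF AB(2)]] by (simp add: \<tau>_def)
    then obtain z where z: "cmod z = 1" "V * class_rep B = z \<cdot>\<^sub>m (V * class_rep A)"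
      unfolding phase_rel_def by blast
    have c: "class_rep A \<in> carrier_mat ?d ?d" "class_rep B \<in> carrier_mat ?d ?d"
      using class_rep(1) AB pauli_normalizer_unitary unitary_groupD(1) by blast+
    have "mat_adjoint V * (V * class_rep B) = z \<cdot>\<^sub>m (mat_adjoint V * (V * class_rep A))"
      unfolding z using c unitary_groupD[OF Vu]
      by (simp add: mult_smult_distrib[of _ ?d ?d _ ?d] mult_carrier_mat[of _ ?d ?d _ ?d])
    hence "class_rep B = z \<cdot>\<^sub>m class_rep A" using unitary_cancel(1)[OF Vu] c by simp
    hence "(class_rep A, class_rep B) \<in> phase_rel n" using z class_rep(1) AB by (auto simp: phase_rel_def)
    thus "A = B" using class_rep(2) AB equiv_class_eq[OF equiv_phase_rel] by metis
  qed
  hence bij: "bij_betw \<tau> (clifford_group n) (clifford_group n)"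
    using \<tau> endo_inj_surj[OF clifford_group_finite, of \<tau> n] by (auto simp: bij_betw_def)
  have fr: "f (V * class_rep A) = f (class_rep (\<tau> A))" if A: "A \<in> clifford_group n" for A
    using rel[OF A] f N[OF A] by (auto simp: phase_rel_def)
  have "(\<Sum>A\<in>clifford_group n. f (V * class_rep A)) = (\<Sum>A\<in>clifford_group n. f (class_rep A))"
    using fr sum.reindex_bij_betw[OF bij, of "\<lambda>A. f (class_rep A)"] by simp
  thus ?thesis
    by (simp add: uniform_clifford_def integral_pmf_of_set clifford_group_finite clifford_group_nonempty)
qed


section \<open>Sesquilinear forms and tuples of indices\<close>

definition sesq :: "'a set \<Rightarrow> ('a \<Rightarrow> 'a \<Rightarrow> complex) \<Rightarrow> ('a \<Rightarrow> complex) \<Rightarrow> ('a \<Rightarrow> complex) \<Rightarrow> complex" where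
  "sesq I W x y = (\<Sum>p\<in>I. \<Sum>q\<in>I. cnj (x p) * W p q * y q)"

definition norm_sq :: "'a set \<Rightarrow> ('a \<Rightarrow> complex) \<Rightarrow> real" where
  "norm_sq I x = (\<Sum>p\<in>I. (cmod (x p))\<^sup>2)"

text \<open>Operator norm at most 1, expressed through the sesquilinear form. Kernels on arbitrary
  finite index sets can thus be relabelled and averaged without fixing an ordering of the
  basis.\<close>

definition contraction :: "'a set \<Rightarrow> ('a \<Rightarrow> 'a \<Rightarrow> complex) \<Rightarrow> bool" where
  "contraction I W \<longleftrightarrow> (\<forall>x y. cmod (sesq I W x y) \<le> sqrt (norm_sq I x) * sqrt (norm_sq I y))"

lemma norm_sq_nonneg [simp]: "norm_sq I x \<ge> 0"
  by (simp add: norm_sq_def sum_nonneg)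

lemma norm_sq_cong: "(\<And>p. p \<in> I \<Longrightarrow> cmod (x p) = cmod (y p)) \<Longrightarrow> norm_sq I x = norm_sq I y"
  unfolding norm_sq_def by (intro sum.cong) auto

lemma sesq_Times:
  "sesq (A \<times> B) W x y = (\<Sum>a\<in>A. \<Sum>b\<in>B. \<Sum>a'\<in>A. \<Sum>b'\<in>B. cnj (x (a, b)) * W (a, b) (a', b') * y (a', b'))"
  unfolding sesq_def sum.cartesian_product' ..

lemma norm_sq_Times: "norm_sq (A \<times> B) x = (\<Sum>a\<in>A. \<Sum>b\<in>B. (cmod (x (a, b)))\<^sup>2)"
  unfolding norm_sq_def sum.cartesian_product' ..

lemma contractionD:
  "contraction I W \<Longrightarrow> cmod (sesq I W x y) \<le> sqrt (norm_sq I x) * sqrt (norm_sq I y)"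
  by (simp add: contraction_def)

lemma contraction_diagD: "contraction I W \<Longrightarrow> cmod (sesq I W x x) \<le> norm_sq I x"
  using contractionD[of I W x x] by simp

lemma contraction_entry:
  assumes W: "contraction I W" and I: "finite I" "p \<in> I" "q \<in> I"
  shows "cmod (W p q) \<le> 1"
proof -
  let ?e = "\<lambda>r s. if s = r then 1 else 0 :: complex"
  have "sesq I W (?e p) (?e q) = (\<Sum>p'\<in>I. \<Sum>q'\<in>I. if q' = q then (if p' = p then W p q else 0) else 0)"
    unfolding sesq_def by (intro sum.cong) auto
  also have "\<dots> = W p q" using I by simp
  finally have "sesq I W (?e p) (?e q) = W p q" .
  moreover have "norm_sq I (?e r) = 1" if "r \<in> I" for r
  proof -
    have "norm_sq I (?e r) = (\<Sum>s\<in>I. if s = r then 1 else 0)" unfolding norm_sq_def by (intro sum.cong) auto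
    thus ?thesis using I that by simp
  qed
  ultimately show ?thesis using contractionD[OF W, of "?e p" "?e q"] I by simp
qed

lemma sesq_sum:
  "sesq I (\<lambda>p q. \<Sum>k\<in>K. of_real (w k) * W k p q) x y = (\<Sum>k\<in>K. of_real (w k) * sesq I (W k) x y)"
proof -
  have "sesq I (\<lambda>p q. \<Sum>k\<in>K. of_real (w k) * W k p q) x y = (\<Sum>p\<in>I. \<Sum>q\<in>I. \<Sum>k\<in>K. of_real (w k) * (cnj (x p) * W k p q * y q))"
    unfolding sesq_def by (simp add: sum_distrib_left sum_distrib_right mult_ac)
  also have "\<dots> = (\<Sum>p\<in>I. \<Sum>k\<in>K. \<Sum>q\<in>I. of_real (w k) * (cnj (x p) * W k p q * y q))"
    by (intro sum.cong refl sum.swap)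
  also have "\<dots> = (\<Sum>k\<in>K. of_real (w k) * sesq I (W k) x y)"
    unfolding sesq_def sum_distrib_left by (rule sum.swap)
  finally show ?thesis .
qed

lemma contraction_convex:
  fixes W :: "'k \<Rightarrow> 'a \<Rightarrow> 'a \<Rightarrow> complex"
  assumes "\<And>k. k \<in> K \<Longrightarrow> contraction I (W k)" "\<And>k. k \<in> K \<Longrightarrow> w k \<ge> 0" "sum w K = 1"
  shows "contraction I (\<lambda>p q. \<Sum>k\<in>K. of_real (w k) * W k p q)"
  unfolding contraction_def
proof (intro allI)
  fix x y :: "'a \<Rightarrow> complex"
  show "cmod (sesq I (\<lambda>p q. \<Sum>k\<in>K. of_real (w k) * W k p q) x y) \<le> sqrt (norm_sq I x) * sqrt (norm_sq I y)"
    unfolding sesq_sum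
  proof (rule order.trans[OF norm_sum])
    have "(\<Sum>k\<in>K. cmod (of_real (w k) * sesq I (W k) x y)) \<le> (\<Sum>k\<in>K. w k * (sqrt (norm_sq I x) * sqrt (norm_sq I y)))"
      using assms(2) contractionD[OF assms(1)] by (intro sum_mono) (auto simp: norm_mult intro!: mult_left_mono)
    thus "(\<Sum>k\<in>K. cmod (of_real (w k) * sesq I (W k) x y)) \<le> sqrt (norm_sq I x) * sqrt (norm_sq I y)"
      using assms(3) by (simp flip: sum_distrib_right)
  qed
qed

text \<open>Pulling a kernel back along an injection selects and renames rows and columns. Test
  vectors on \<open>J\<close> are extended by zero to \<open>I\<close>, which changes neither their
  norm nor the form.\<close>

lemma contraction_inj_on:
  assumes W: "contraction I W" and \<iota>: "inj_on \<iota> J" "\<iota> ` J \<subseteq> I" and I: "finite I"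
  shows "contraction J (\<lambda>p q. W (\<iota> p) (\<iota> q))"
  unfolding contraction_def
proof (intro allI)
  fix x y :: "'b \<Rightarrow> complex"
  let ?ext = "\<lambda>x p. if p \<in> \<iota> ` J then x (the_inv_into J \<iota> p) else 0 :: complex"
  have ext: "?ext x (\<iota> p) = x p" if "p \<in> J" for x p
    using that \<iota> by (simp add: the_inv_into_f_f)
  have s: "(\<Sum>p\<in>I. F p) = (\<Sum>p\<in>J. F (\<iota> p))" if "\<And>p. p \<notin> \<iota> ` J \<Longrightarrow> F p = 0" for F :: "'a \<Rightarrow> 'c :: comm_monoid_add"
    using that I \<iota> by (subst sum.mono_neutral_right[OF I \<iota>(2)]) (auto simp: sum.reindex)
  have "norm_sq I (?ext x) = norm_sq J x" for x
  proof -
    have "norm_sq I (?ext x) = (\<Sum>p\<in>J. (cmod (?ext x (\<iota> p)))\<^sup>2)"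
      unfolding norm_sq_def by (rule s) auto
    also have "\<dots> = norm_sq J x"
      unfolding norm_sq_def by (intro sum.cong refl) (simp only: ext)
    finally show ?thesis .
  qed
  moreover have "sesq I W (?ext x) (?ext y) = sesq J (\<lambda>p q. W (\<iota> p) (\<iota> q)) x y"
  proof -
    have "sesq I W (?ext x) (?ext y) = (\<Sum>p\<in>J. \<Sum>q\<in>I. cnj (?ext x (\<iota> p)) * W (\<iota> p) q * ?ext y q)"
      unfolding sesq_def by (rule s) auto
    also have "\<dots> = (\<Sum>p\<in>J. \<Sum>q\<in>J. cnj (?ext x (\<iota> p)) * W (\<iota> p) (\<iota> q) * ?ext y (\<iota> q))"
      by (intro sum.cong refl s) auto
    also have "\<dots> = sesq J (\<lambda>p q. W (\<iota> p) (\<iota> q)) x y"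
      unfolding sesq_def by (intro sum.cong refl) (simp only: ext)
    finally show ?thesis .
  qed
  ultimately show "cmod (sesq J (\<lambda>p q. W (\<iota> p) (\<iota> q)) x y) \<le> sqrt (norm_sq J x) * sqrt (norm_sq J y)"
    using contractionD[OF W, of "?ext x" "?ext y"] by simp
qed

lemma contraction_phase:
  assumes W: "contraction I W" and s: "\<And>p. p \<in> I \<Longrightarrow> cmod (s p) = 1"
  shows "contraction I (\<lambda>p q. cnj (s p) * W p q * s q)"
  unfolding contraction_def
proof (intro allI)
  fix x y :: "'a \<Rightarrow> complex"
  have "sesq I (\<lambda>p q. cnj (s p) * W p q * s q) x y = sesq I W (\<lambda>p. s p * x p) (\<lambda>p. s p * y p)"
    unfolding sesq_def by (intro sum.cong) auto
  moreover have "norm_sq I (\<lambda>p. s p * x p) = norm_sq I x" for x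
    by (rule norm_sq_cong) (simp add: s norm_mult)
  ultimately show "cmod (sesq I (\<lambda>p q. cnj (s p) * W p q * s q) x y) \<le> sqrt (norm_sq I x) * sqrt (norm_sq I y)"
    using contractionD[OF W, of "\<lambda>p. s p * x p" "\<lambda>p. s p * y p"] by simp
qed

lemma sesq_add_left: "sesq I W (\<lambda>p. x p + x' p) y = sesq I W x y + sesq I W x' y"
  unfolding sesq_def by (simp add: algebra_simps sum.distrib)

lemma sesq_add_right: "sesq I W x (\<lambda>p. y p + y' p) = sesq I W x y + sesq I W x y'"
  unfolding sesq_def by (simp add: algebra_simps sum.distrib)

section \<open>Tuples and permutations of positions\<close>

definition tuples :: "nat \<Rightarrow> nat \<Rightarrow> (nat \<Rightarrow> nat) set" where
  "tuples t d = ({..<t} \<rightarrow>\<^sub>E {..<d})"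

definition inj_tuples :: "nat \<Rightarrow> nat \<Rightarrow> (nat \<Rightarrow> nat) set" where
  "inj_tuples t d = {u \<in> tuples t d. inj_on u {..<t}}"

abbreviation "perms t \<equiv> {\<sigma>. \<sigma> permutes {..<t::nat}}"

lemma finite_tuples [simp]: "finite (tuples t d)"
  by (simp add: tuples_def finite_PiE)

lemma card_tuples: "card (tuples t d) = d ^ t"
  by (simp add: tuples_def card_PiE)

lemma inj_tuples_subset: "inj_tuples t d \<subseteq> tuples t d"
  by (auto simp: inj_tuples_def)

lemma finite_inj_tuples [simp]: "finite (inj_tuples t d)"
  by (rule finite_subset[OF inj_tuples_subset]) simp

lemma card_inj_tuples:
  assumes "t \<le> d"
  shows "real (card (inj_tuples t d)) = (\<Prod>i<t. real d - real i)"
proof -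
  have "card (inj_tuples t d) = (\<Prod>i<t. d - i)"
    using card_inj_on_subset_funcset[of "{..<t}" "{..<d}" "{..<t}"]
    by (simp add: inj_tuples_def tuples_def atLeast0LessThan)
  thus ?thesis using assms by (simp add: of_nat_prod of_nat_diff)
qed

text \<open>Composition with \<open>\<sigma>\<close> permutes the tensor factors of a basis vector.
  As \<open>\<sigma>\<close> fixes every position outside {..<t}, the result is extensional again,
  and the inverse permutation undoes it.\<close>

lemma perm_comp_bij:
  assumes "\<sigma> \<in> perms t"
  shows "bij_betw (\<lambda>u. u \<circ> \<sigma>) (tuples t d) (tuples t d)" "bij_betw (\<lambda>u. u \<circ> \<sigma>) (inj_tuples t d) (inj_tuples t d)"
proof -
  have s: "\<sigma> permutes {..<t}" using assms by simp
  note i = permutes_inv[OF s]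
  have T: "u \<circ> \<tau> \<in> tuples t d" if "u \<in> tuples t d" "\<tau> permutes {..<t}" for u \<tau>
    using that permutes_in_image[OF that(2)] permutes_not_in[OF that(2)]
    by (auto simp: tuples_def PiE_iff extensional_def)
  have D: "u \<circ> \<tau> \<in> inj_tuples t d" if "u \<in> inj_tuples t d" "\<tau> permutes {..<t}" for u \<tau>
    using that T permutes_inj_on[OF that(2)] permutes_image[OF that(2)]
    by (auto simp: inj_tuples_def intro!: comp_inj_on)
  have inv: "(u \<circ> \<sigma>) \<circ> inv_into UNIV \<sigma> = u" "(u \<circ> inv_into UNIV \<sigma>) \<circ> \<sigma> = u" for u :: "nat \<Rightarrow> nat"
    using permutes_inv_o[OF s] by (simp_all add: comp_assoc)
  show "bij_betw (\<lambda>u. u \<circ> \<sigma>) (tuples t d) (tuples t d)"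
    by (rule bij_betw_byWitness[of _ "\<lambda>u. u \<circ> inv_into UNIV \<sigma>"]) (use inv T[OF _ s] T[OF _ i] in auto)
  show "bij_betw (\<lambda>u. u \<circ> \<sigma>) (inj_tuples t d) (inj_tuples t d)"
    by (rule bij_betw_byWitness[of _ "\<lambda>u. u \<circ> inv_into UNIV \<sigma>"]) (use inv D[OF _ s] D[OF _ i] in auto)
qed

lemma perm_comp_tuples: "\<sigma> \<in> perms t \<Longrightarrow> u \<in> tuples t d \<Longrightarrow> u \<circ> \<sigma> \<in> tuples t d"
  using perm_comp_bij(1)[of \<sigma> t d] by (auto simp: bij_betw_def)

lemma perm_comp_inj_tuples_iff:
  assumes "\<sigma> \<in> perms t" "u \<in> tuples t d"
  shows "u \<circ> \<sigma> \<in> inj_tuples t d \<longleftrightarrow> u \<in> inj_tuples t d"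
proof
  assume "u \<circ> \<sigma> \<in> inj_tuples t d"
  then obtain v where "v \<in> inj_tuples t d" "v \<circ> \<sigma> = u \<circ> \<sigma>"
    using perm_comp_bij(2)[OF assms(1), of d] unfolding bij_betw_def by (metis imageE)
  moreover from this have "v = u"
    using perm_comp_bij(1)[OF assms(1), of d] assms(2) inj_tuples_subset unfolding bij_betw_def by (metis inj_onD subsetD)
  ultimately show "u \<in> inj_tuples t d" by simp
qed (use perm_comp_bij(2)[OF assms(1), of d] in \<open>auto simp: bij_betw_def\<close>)

text \<open>Distinct tuples with the same set of values form one free orbit of the permutations of
  positions: the permutation is recovered by inverting \<open>u\<close> on its image. This replaces
  a sum over partner tuples by a sum over \<open>\<sigma>\<close>.\<close>

lemma sum_same_image:
  fixes X :: "(nat \<Rightarrow> nat) \<Rightarrow> 'a :: comm_monoid_add"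
  assumes u: "u \<in> inj_tuples t d"
  shows "(\<Sum>w\<in>{w \<in> inj_tuples t d. w ` {..<t} = u ` {..<t}}. X w) = (\<Sum>\<sigma>\<in>perms t. X (u \<circ> \<sigma>))"
    and "inj_on (\<lambda>\<sigma>. u \<circ> \<sigma>) (perms t)"
proof -
  have ui: "inj_on u {..<t}" "u \<in> tuples t d" using u by (auto simp: inj_tuples_def)
  show inj: "inj_on (\<lambda>\<sigma>. u \<circ> \<sigma>) (perms t)"
  proof (rule inj_onI, clarify)
    fix \<sigma> \<tau> assume s: "\<sigma> permutes {..<t}" and s': "\<tau> permutes {..<t}" and eq: "u \<circ> \<sigma> = u \<circ> \<tau>"
    show "\<sigma> = \<tau>"
    proof
      fix k show "\<sigma> k = \<tau> k"
      proof (cases "k < t")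
        case True
        thus ?thesis using inj_onD[OF ui(1) fun_cong[OF eq[unfolded comp_def], of k]]
            permutes_in_image[OF s, of k] permutes_in_image[OF s', of k] by auto
      next
        case False
        thus ?thesis using permutes_not_in[OF s, of k] permutes_not_in[OF s', of k] by auto
      qed
    qed
  qed
  have "(\<lambda>\<sigma>. u \<circ> \<sigma>) ` perms t = {w \<in> inj_tuples t d. w ` {..<t} = u ` {..<t}}"
  proof (intro equalityI subsetI)
    fix w assume "w \<in> (\<lambda>\<sigma>. u \<circ> \<sigma>) ` perms t"
    then obtain \<sigma> where s: "\<sigma> \<in> perms t" "w = u \<circ> \<sigma>" by auto
    hence "w ` {..<t} = u ` {..<t}" using permutes_image[of \<sigma> "{..<t}"] by (metis image_comp mem_Collect_eq)
    thus "w \<in> {w \<in> inj_tuples t d. w ` {..<t} = u ` {..<t}}"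
      using perm_comp_inj_tuples_iff[OF s(1) ui(2)] u s(2) by simp
  next
    fix w assume w: "w \<in> {w \<in> inj_tuples t d. w ` {..<t} = u ` {..<t}}"
    hence wi: "inj_on w {..<t}" "w \<in> tuples t d" "w ` {..<t} = u ` {..<t}" by (auto simp: inj_tuples_def)
    \<comment> \<open>Outside {..<t} it is the identity, as \<open>permutes\<close> demands.\<close>
    define \<sigma> where "\<sigma> k = (if k < t then the_inv_into {..<t} u (w k) else k)" for k
    have us: "u (\<sigma> k) = w k" "\<sigma> k < t" if "k < t" for k
    proof -
      have "w k \<in> u ` {..<t}" using wi(3) that by blast
      thus "u (\<sigma> k) = w k" "\<sigma> k < t"
        using that f_the_inv_into_f[OF ui(1)] the_inv_into_into[OF ui(1), of "w k" "{..<t}"] by (auto simp: \<sigma>_def)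
    qed
    have "inj_on \<sigma> {..<t}"
      by (rule inj_onI) (metis us(1) wi(1) inj_onD lessThan_iff)
    moreover from this have "\<sigma> ` {..<t} = {..<t}"
      using us(2) by (intro endo_inj_surj) auto
    ultimately have "bij_betw \<sigma> {..<t} {..<t}" by (simp add: bij_betw_def)
    hence "\<sigma> permutes {..<t}" by (rule bij_imp_permutes) (simp add: \<sigma>_def)
    moreover have "w = u \<circ> \<sigma>"
    proof
      fix k show "w k = (u \<circ> \<sigma>) k"
        using us(1)[of k] ui(2) wi(2) by (cases "k < t") (auto simp: \<sigma>_def tuples_def PiE_iff extensional_def)
    qed
    ultimately show "w \<in> (\<lambda>\<sigma>. u \<circ> \<sigma>) ` perms t" by auto
  qed
  thus "(\<Sum>w\<in>{w \<in> inj_tuples t d. w ` {..<t} = u ` {..<t}}. X w) = (\<Sum>\<sigma>\<in>perms t. X (u \<circ> \<sigma>))"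
    using inj by (metis (no_types, lifting) comp_apply sum.reindex sum.cong)
qed

text \<open>The eigenvalue of F_f^(\<otimes>t) on the basis vector labelled by
  \<open>u\<close>.\<close>

definition tuple_sign :: "nat \<Rightarrow> (nat \<Rightarrow> nat) \<Rightarrow> (nat \<Rightarrow> nat) \<Rightarrow> complex" where
  "tuple_sign t f u = (\<Prod>k<t. (- 1) ^ f (u k))"

text \<open>The label of the basis vector to which P_\<pi>^(\<otimes>t) sends that of
  \<open>u\<close>; the restriction keeps the label extensional.\<close>

definition tuple_map :: "nat \<Rightarrow> (nat \<Rightarrow> nat) \<Rightarrow> (nat \<Rightarrow> nat) \<Rightarrow> nat \<Rightarrow> nat" where
  "tuple_map t \<pi> u = (\<lambda>k\<in>{..<t}. \<pi> (u k))"

lemma cmod_tuple_sign [simp]: "cmod (tuple_sign t f u) = 1"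
  by (simp add: tuple_sign_def norm_power flip: prod_norm)

lemma cnj_tuple_sign [simp]: "cnj (tuple_sign t f u) = tuple_sign t f u"
  by (simp add: tuple_sign_def)

lemma tuple_map_perm_comp:
  assumes "\<sigma> \<in> perms t"
  shows "tuple_map t \<pi> (u \<circ> \<sigma>) = tuple_map t \<pi> u \<circ> \<sigma>"
proof
  fix k
  have "\<sigma> k < t \<longleftrightarrow> k < t" using permutes_in_image[of \<sigma> "{..<t}" k] assms by simp
  thus "tuple_map t \<pi> (u \<circ> \<sigma>) k = (tuple_map t \<pi> u \<circ> \<sigma>) k" by (simp add: tuple_map_def)
qed

lemma tuple_map_inj:
  assumes "\<pi> permutes {..<d}" "u \<in> tuples t d" "v \<in> tuples t d" "tuple_map t \<pi> u = tuple_map t \<pi> v"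
  shows "u = v"
proof
  fix k
  show "u k = v k"
  proof (cases "k < t")
    case True
    thus ?thesis using fun_cong[OF assms(4), of k] permutes_inj[OF assms(1)] by (auto simp: tuple_map_def inj_eq)
  next
    case False
    thus ?thesis using assms by (auto simp: tuples_def PiE_iff extensional_def)
  qed
qed

lemma tuple_map_tuples:
  assumes "\<pi> permutes {..<d}"
  shows "u \<in> tuples t d \<Longrightarrow> tuple_map t \<pi> u \<in> tuples t d"
    and "u \<in> inj_tuples t d \<Longrightarrow> tuple_map t \<pi> u \<in> inj_tuples t d"
proof -
  have T: "tuple_map t \<pi> u \<in> tuples t d" if "u \<in> tuples t d" for u
  proof -
    have "\<pi> (u k) < d" if "k < t" for k
      using permutes_in_image[OF assms, of "u k"] that \<open>u \<in> tuples t d\<close> by (auto simp: tuples_def PiE_iff)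
    thus ?thesis by (auto simp: tuple_map_def tuples_def)
  qed
  thus "u \<in> tuples t d \<Longrightarrow> tuple_map t \<pi> u \<in> tuples t d" .
  assume u: "u \<in> inj_tuples t d"
  have "inj_on (tuple_map t \<pi> u) {..<t}"
  proof (rule inj_onI)
    fix j k assume jk: "j \<in> {..<t}" "k \<in> {..<t}" "tuple_map t \<pi> u j = tuple_map t \<pi> u k"
    hence "u j = u k" using permutes_inj[OF assms] by (simp add: tuple_map_def inj_eq)
    thus "j = k" using u jk by (auto simp: inj_tuples_def dest: inj_onD)
  qed
  thus "tuple_map t \<pi> u \<in> inj_tuples t d" using T u by (simp add: inj_tuples_def)
qed

section \<open>Averages of signs under limited independence\<close>

lemma sum_lists_Cons:
  fixes g :: "'a list \<Rightarrow> 'b :: comm_monoid_add"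
  shows "(\<Sum>ys\<in>{ys. set ys \<subseteq> A \<and> length ys = Suc n}. g ys)
    = (\<Sum>ys\<in>{ys. set ys \<subseteq> A \<and> length ys = n}. \<Sum>a\<in>A. g (a # ys))"
proof -
  have "inj_on (\<lambda>(xs, n). n # xs) ({xs. set xs \<subseteq> A \<and> length xs = n} \<times> A)" by (auto simp: inj_on_def)
  thus ?thesis
    unfolding lists_length_Suc_eq by (subst sum.reindex) (simp_all add: sum.cartesian_product case_prod_beta)
qed

text \<open>The values of a random f on k points are uniform bit strings, and a nontrivial character
  has mean zero under the uniform distribution.\<close>

lemma kwise_independent_character_sum:
  assumes F: "kwise_independent k d 2 F" and Y: "Y \<subseteq> {..<d}" "Y \<noteq> {}" "card Y \<le> k" and k: "k \<le> d"
  shows "(\<Sum>f\<in>set_mset F. of_real (pmf (pmf_of_multiset F) f) * (\<Prod>y\<in>Y. (- 1) ^ f y)) = (0 :: complex)"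
proof -
  have F0: "F \<noteq> {#}" and Fr: "\<And>f. f \<in># F \<Longrightarrow> f \<in> {..<d} \<rightarrow> {..<2}" using F by (auto simp: kwise_independent_def)
  let ?G = "pmf_of_multiset F"
  \<comment> \<open>\<open>kwise_independent\<close> speaks of exactly k points, so Y is filled up
    to size k; points of Z outside Y enter the character with factor 1.\<close>
  obtain Z where Z: "Y \<subseteq> Z" "Z \<subseteq> {..<d}" "card Z = k"
    using exists_subset_between[OF Y(3) _ Y(1)] k by auto
  have fZ: "finite Z" using Z finite_subset by blast
  obtain a where a: "a \<in> Y" using Y by auto
  \<comment> \<open>A point of Y comes first, so that the sum over its bit can be split off with
    \<open>sum_lists_Cons\<close> and vanishes as 1 + (-1).\<close>
  define xs where "xs = a # sorted_list_of_set (Z - {a})"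
  have xs: "distinct xs" "set xs = Z" using a Z fZ by (auto simp: xs_def)
  hence lxs: "length xs = k" using Z distinct_card by fastforce
  let ?g = "\<lambda>x y. if x \<in> Y then (- 1) ^ y else 1 :: complex"
  define \<phi> where "\<phi> ys = prod_list (map2 ?g xs ys)" for ys
  have \<phi>: "(\<Prod>y\<in>Y. (- 1) ^ f y) = \<phi> (map f xs)" for f
  proof -
    have "\<phi> (map f xs) = prod_list (map (\<lambda>x. ?g x (f x)) xs)"
      unfolding \<phi>_def by (simp add: zip_map2 zip_same_conv_map o_def)
    also have "\<dots> = (\<Prod>x\<in>Z. ?g x (f x))" using prod.distinct_set_conv_list[OF xs(1), of "\<lambda>x. ?g x (f x)"] unfolding xs(2) by simp
    also have "\<dots> = (\<Prod>y\<in>Y. (- 1) ^ f y)" using Z fZ by (intro prod.mono_neutral_cong_right) auto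
    finally show ?thesis ..
  qed
  let ?L = "{ys. set ys \<subseteq> {..<2 :: nat} \<and> length ys = k}"
  have fL: "finite ?L" by (rule finite_lists_length_eq) simp
  have pr: "(\<Sum>f\<in>{f \<in> set_mset F. map f xs = ys}. of_real (pmf ?G f)) = (of_real (1 / 2 ^ k) :: complex)" if "ys \<in> ?L" for ys
  proof -
    have "measure_pmf.prob ?G {f. map f xs = ys} = measure_pmf.prob ?G {f \<in> set_mset F. map f xs = ys}"
      using F0 by (intro measure_prob_cong_0) (auto simp: pmf_eq_0_set_pmf not_in_iff)
    also have "\<dots> = (\<Sum>f\<in>{f \<in> set_mset F. map f xs = ys}. pmf ?G f)"
      by (rule measure_measure_pmf_finite) auto
    also have "measure_pmf.prob ?G {f. map f xs = ys} = 1 / 2 ^ k"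
      using F that xs Z lxs unfolding kwise_independent_def by auto
    finally have "(\<Sum>f\<in>{f \<in> set_mset F. map f xs = ys}. pmf ?G f) = 1 / 2 ^ k" ..
    thus ?thesis by (simp only: of_real_sum[symmetric])
  qed
  have "(\<Sum>f\<in>set_mset F. of_real (pmf ?G f) * \<phi> (map f xs))
      = (\<Sum>ys\<in>?L. \<Sum>f\<in>{f \<in> set_mset F. map f xs = ys}. of_real (pmf ?G f) * \<phi> (map f xs))"
  proof (rule sum.group[symmetric])
    have "f x < 2" if "f \<in># F" "x \<in> Z" for f x
      using Pi_mem[OF Fr[OF that(1)], of x] Z(2) that(2) by auto
    thus "(\<lambda>f. map f xs) ` set_mset F \<subseteq> ?L" using xs(2) lxs by auto
  qed (simp_all add: fL)
  also have "\<dots> = (\<Sum>ys\<in>?L. of_real (1 / 2 ^ k) * \<phi> ys)"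
  proof (intro sum.cong refl)
    fix ys assume ys: "ys \<in> ?L"
    have "(\<Sum>f\<in>{f \<in> set_mset F. map f xs = ys}. of_real (pmf ?G f) * \<phi> (map f xs))
        = (\<Sum>f\<in>{f \<in> set_mset F. map f xs = ys}. of_real (pmf ?G f)) * \<phi> ys"
      by (simp add: sum_distrib_right)
    thus "(\<Sum>f\<in>{f \<in> set_mset F. map f xs = ys}. of_real (pmf ?G f) * \<phi> (map f xs)) = of_real (1 / 2 ^ k) * \<phi> ys"
      using pr[OF ys] by simp
  qed
  also have "\<dots> = of_real (1 / 2 ^ k) * (\<Sum>ys\<in>?L. \<phi> ys)" by (simp add: sum_distrib_left)
  also have "(\<Sum>ys\<in>?L. \<phi> ys) = 0"
  proof -
    obtain k' where k': "k = Suc k'" using lxs by (cases k) (auto simp: xs_def)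
    have "(\<Sum>a\<in>{..<2 :: nat}. \<phi> (a # ys)) = 0" for ys
      using a by (simp add: \<phi>_def xs_def numeral_2_eq_2)
    thus ?thesis unfolding k' by (subst sum_lists_Cons) simp
  qed
  finally show ?thesis using \<phi> by simp
qed

text \<open>Points common to both tuples contribute squared signs, which are 1. What remains is the
  character of the symmetric difference of the two value sets; it has at most 2t points, whence the
  order 2t of independence.\<close>

lemma tuple_sign_average:
  assumes F: "kwise_independent (2 * t) d 2 F" and td: "2 * t \<le> d"
    and u: "u \<in> inj_tuples t d" and v: "v \<in> inj_tuples t d"
  shows "(\<Sum>f\<in>set_mset F. of_real (pmf (pmf_of_multiset F) f) * (tuple_sign t f u * tuple_sign t f v))
    = (if u ` {..<t} = v ` {..<t} then 1 else 0)"
proof -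
  let ?A = "u ` {..<t}" and ?B = "v ` {..<t}" and ?G = "pmf_of_multiset F"
  let ?Y = "(?A - ?B) \<union> (?B - ?A)"
  have F0: "F \<noteq> {#}" using F by (auto simp: kwise_independent_def)
  have s: "tuple_sign t f u * tuple_sign t f v = (\<Prod>y\<in>?Y. (- 1) ^ f y)" for f
  proof -
    let ?h = "\<lambda>y. (- 1 :: complex) ^ f y"
    have "tuple_sign t f u = prod ?h ?A" "tuple_sign t f v = prod ?h ?B"
      using u v by (simp_all add: tuple_sign_def inj_tuples_def prod.reindex)
    moreover have "prod ?h ?A = prod ?h (?A \<inter> ?B) * prod ?h (?A - ?B)"
      by (rule prod.Int_Diff) simp
    moreover have "prod ?h ?B = prod ?h (?A \<inter> ?B) * prod ?h (?B - ?A)"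
      by (subst Int_commute, rule prod.Int_Diff) simp
    moreover have "prod ?h ?Y = prod ?h (?A - ?B) * prod ?h (?B - ?A)"
      by (rule prod.union_disjoint) auto
    moreover have i1: "prod ?h (?A \<inter> ?B) * prod ?h (?A \<inter> ?B) = 1"
      by (simp add: prod.distrib[symmetric] power_add[symmetric])
    ultimately have "tuple_sign t f u * tuple_sign t f v = (prod ?h (?A \<inter> ?B) * prod ?h (?A \<inter> ?B)) * prod ?h ?Y"
      by (simp only: mult_ac)
    thus ?thesis by (simp only: i1 mult_1_left)
  qed
  show ?thesis
  proof (cases "?A = ?B")
    case True
    have "(\<Sum>f\<in>set_mset F. pmf ?G f) = 1" using F0 by (intro sum_pmf_eq_1) auto
    hence "(\<Sum>f\<in>set_mset F. complex_of_real (pmf ?G f)) = 1" by (metis of_real_1 of_real_sum)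
    thus ?thesis unfolding s using True by simp
  next
    case False
    have "card ?Y \<le> card ?A + card ?B"
      by (rule order.trans[OF card_Un_le]) (intro add_mono card_mono, auto)
    also have "\<dots> \<le> 2 * t" using card_image_le[of "{..<t}" u] card_image_le[of "{..<t}" v] by simp
    finally have "card ?Y \<le> 2 * t" .
    moreover have "?Y \<subseteq> {..<d}" using u v by (auto simp: inj_tuples_def tuples_def PiE_iff)
    ultimately show ?thesis unfolding s using False kwise_independent_character_sum[OF F, of ?Y] td by auto
  qed
qed

lemma approx_twise_tuple_prob:
  assumes D: "approx_twise_independent_perm \<delta> t d \<D>" and u: "u \<in> inj_tuples t d" and v: "v \<in> inj_tuples t d"
  shows "\<bar>measure_pmf.prob \<D> {\<pi>. tuple_map t \<pi> u = v} - inverse (\<Prod>i<t. real d - real i)\<bar> \<le> \<delta>"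
proof -
  let ?l = "\<lambda>u. map u [0..<t]"
  have eq: "{\<pi>. tuple_map t \<pi> u = v} = {\<pi>. map \<pi> (?l u) = ?l v}"
    using v by (auto simp: tuple_map_def inj_tuples_def tuples_def PiE_iff extensional_def fun_eq_iff restrict_def)
  have "length (?l u) = t" "length (?l v) = t" "distinct (?l u)" "distinct (?l v)" "set (?l u) \<subseteq> {..<d}" "set (?l v) \<subseteq> {..<d}"
    using u v by (auto simp: inj_tuples_def tuples_def PiE_iff distinct_map atLeast0LessThan)
  thus ?thesis using D unfolding approx_twise_independent_perm_def eq by blast
qed


section \<open>The twirl by permutations and phases\<close>

text \<open>\<open>W\<close> plays the role of the dual witness and \<open>m\<close> that of the
  dimension of the reference system. The assumption \<open>td\<close> provides 2t distinct points
  for the independence of signs and makes the number of distinct t-tuples positive.\<close>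

locale pf_twirl =
  fixes t d m :: nat and W :: "(nat \<Rightarrow> nat) \<times> nat \<Rightarrow> (nat \<Rightarrow> nat) \<times> nat \<Rightarrow> complex"
    and F :: "(nat \<Rightarrow> nat) multiset" and \<D> :: "(nat \<Rightarrow> nat) pmf" and \<delta> :: real
  assumes W: "contraction (tuples t d \<times> {..<m}) W"
    and F: "kwise_independent (2 * t) d 2 F"
    and D: "approx_twise_independent_perm \<delta> t d \<D>"
    and td: "2 * t \<le> d"
begin

abbreviation "G \<equiv> pmf_of_multiset F"

abbreviation "I \<equiv> tuples t d \<times> {..<m}"

definition pf_weight :: "(nat \<Rightarrow> nat) \<times> (nat \<Rightarrow> nat) \<Rightarrow> real" where
  "pf_weight = (\<lambda>(\<pi>, f). pmf \<D> \<pi> * pmf G f)"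

text \<open>The witness in the Heisenberg picture: \<open>W\<close> conjugated by (P_\<pi>
  F_f)^(\<otimes>t) on the tuple part and by the identity on the reference.\<close>

definition pf_form :: "(nat \<Rightarrow> nat) \<times> (nat \<Rightarrow> nat) \<Rightarrow> (nat \<Rightarrow> nat) \<times> nat \<Rightarrow> (nat \<Rightarrow> nat) \<times> nat \<Rightarrow> complex" where
  "pf_form = (\<lambda>(\<pi>, f) p q. cnj (tuple_sign t f (fst p)) *
     W (tuple_map t \<pi> (fst p), snd p) (tuple_map t \<pi> (fst q), snd q) * tuple_sign t f (fst q))"

definition pf_average :: "(nat \<Rightarrow> nat) \<times> nat \<Rightarrow> (nat \<Rightarrow> nat) \<times> nat \<Rightarrow> complex" where
  "pf_average p q = (\<Sum>\<omega>\<in>set_pmf \<D> \<times> set_mset F. of_real (pf_weight \<omega>) * pf_form \<omega> p q)"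

lemma finite_I [simp]: "finite I"
  by simp

lemma F_nonempty: "F \<noteq> {#}"
  using F by (simp add: kwise_independent_def)

lemma D_permutes: "\<pi> \<in> set_pmf \<D> \<Longrightarrow> \<pi> permutes {..<d}"
  using D by (auto simp: approx_twise_independent_perm_def)

lemma finite_D: "finite (set_pmf \<D>)"
  using D finite_permutations[of "{..<d}"] by (auto simp: approx_twise_independent_perm_def intro: finite_subset)

lemma sum_D: "(\<Sum>\<pi>\<in>set_pmf \<D>. pmf \<D> \<pi>) = 1"
  by (rule sum_pmf_eq_1) (auto simp: finite_D)

lemma sum_G: "(\<Sum>f\<in>set_mset F. pmf G f) = 1"
  by (rule sum_pmf_eq_1) (auto simp: F_nonempty)

lemma sum_pf_weight: "(\<Sum>\<omega>\<in>set_pmf \<D> \<times> set_mset F. pf_weight \<omega>) = 1"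
  by (simp add: pf_weight_def sum.cartesian_product[symmetric] sum_distrib_left[symmetric] sum_G sum_D)

lemma contraction_pf_form:
  assumes "\<omega> \<in> set_pmf \<D> \<times> set_mset F"
  shows "contraction I (pf_form \<omega>)"
proof -
  obtain \<pi> f where \<omega>: "\<omega> = (\<pi>, f)" "\<pi> permutes {..<d}" using assms D_permutes by auto
  let ?\<iota> = "\<lambda>p. (tuple_map t \<pi> (fst p), snd p)"
  have "contraction I (\<lambda>p q. W (?\<iota> p) (?\<iota> q))"
  proof (rule contraction_inj_on[OF W])
    show "inj_on ?\<iota> I" using tuple_map_inj[OF \<omega>(2)] by (auto simp: inj_on_def)
    show "?\<iota> ` I \<subseteq> I" using tuple_map_tuples(1)[OF \<omega>(2)] by auto
  qed simp
  hence "contraction I (\<lambda>p q. cnj (tuple_sign t f (fst p)) * W (?\<iota> p) (?\<iota> q) * tuple_sign t f (fst q))"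
    by (rule contraction_phase) simp
  thus ?thesis by (simp add: pf_form_def \<omega>)
qed

lemma contraction_pf_average: "contraction I pf_average"
  unfolding pf_average_def
proof (rule contraction_convex[OF contraction_pf_form])
  show "pf_weight \<omega> \<ge> 0" for \<omega> by (simp add: pf_weight_def case_prod_beta)
qed (auto simp: sum_pf_weight)

text \<open>
  The exact twirl of an operator on the subspace of distinct tuples, in dual form: on a vector
  supported there, the average over a uniform permutation and uniform signs of the form \<open>W\<close>.
\<close>

definition ideal_form :: "((nat \<Rightarrow> nat) \<times> nat \<Rightarrow> complex) \<Rightarrow> complex" where
  "ideal_form \<phi> = of_real (inverse (\<Prod>i<t. real d - real i)) *
     (\<Sum>z\<in>tuples t d. \<Sum>y\<in>inj_tuples t d. \<Sum>\<sigma>\<in>perms t. \<Sum>b<m. \<Sum>b'<m.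
        cnj (\<phi> (z \<circ> \<sigma>, b)) * W (y \<circ> \<sigma>, b) (y, b') * \<phi> (z, b'))"

definition on_inj :: "((nat \<Rightarrow> nat) \<times> nat \<Rightarrow> complex) \<Rightarrow> (nat \<Rightarrow> nat) \<times> nat \<Rightarrow> complex" where
  "on_inj \<phi> p = (if fst p \<in> inj_tuples t d then \<phi> p else 0)"

definition off_inj :: "((nat \<Rightarrow> nat) \<times> nat \<Rightarrow> complex) \<Rightarrow> (nat \<Rightarrow> nat) \<times> nat \<Rightarrow> complex" where
  "off_inj \<phi> p = (if fst p \<in> inj_tuples t d then 0 else \<phi> p)"

text \<open>There are no cross terms: \<open>z\<close> and \<open>z \<circ> \<sigma>\<close> are
  both distinct tuples or both not, so the form never pairs the two parts of a vector.\<close>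

lemma ideal_form_split: "ideal_form \<phi> = ideal_form (on_inj \<phi>) + ideal_form (off_inj \<phi>)"
proof -
  have "cnj (\<phi> (z \<circ> \<sigma>, b)) * W (y \<circ> \<sigma>, b) (y, b') * \<phi> (z, b') =
      cnj (on_inj \<phi> (z \<circ> \<sigma>, b)) * W (y \<circ> \<sigma>, b) (y, b') * on_inj \<phi> (z, b') +
      cnj (off_inj \<phi> (z \<circ> \<sigma>, b)) * W (y \<circ> \<sigma>, b) (y, b') * off_inj \<phi> (z, b')"
    if "z \<in> tuples t d" "\<sigma> \<in> perms t" for z y \<sigma> b b'
    using perm_comp_inj_tuples_iff[OF that(2,1)] by (simp add: on_inj_def off_inj_def)
  hence "(\<Sum>z\<in>tuples t d. \<Sum>y\<in>inj_tuples t d. \<Sum>\<sigma>\<in>perms t. \<Sum>b<m. \<Sum>b'<m.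
        cnj (\<phi> (z \<circ> \<sigma>, b)) * W (y \<circ> \<sigma>, b) (y, b') * \<phi> (z, b')) =
     (\<Sum>z\<in>tuples t d. \<Sum>y\<in>inj_tuples t d. \<Sum>\<sigma>\<in>perms t. \<Sum>b<m. \<Sum>b'<m.
        cnj (on_inj \<phi> (z \<circ> \<sigma>, b)) * W (y \<circ> \<sigma>, b) (y, b') * on_inj \<phi> (z, b') +
        cnj (off_inj \<phi> (z \<circ> \<sigma>, b)) * W (y \<circ> \<sigma>, b) (y, b') * off_inj \<phi> (z, b'))"
    by (intro sum.cong refl) blast
  thus ?thesis by (simp add: ideal_form_def sum.distrib distrib_left)
qed

lemma prod_falling_pos: "(\<Prod>i<t. real d - real i) > 0"
  using td by (intro prod_pos) auto

lemma card_perms: "card (perms t) = fact t"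
  using card_permutations[of "{..<t}" t] by simp

text \<open>
  The Kraus operators \<open>\<Sum>\<^sub>\<sigma> |y \<circ> \<sigma>\<rangle>\<langle>z \<circ> \<sigma>|\<close> show that the map dual to \<open>ideal_form\<close> is completely
  positive and trace preserving.
\<close>

lemma ideal_form_kraus:
  "fact t * ideal_form \<phi> = of_real (inverse (\<Prod>i<t. real d - real i)) *
     (\<Sum>z\<in>tuples t d. \<Sum>y\<in>inj_tuples t d.
       sesq (perms t \<times> {..<m}) (\<lambda>p q. W (y \<circ> fst p, snd p) (y \<circ> fst q, snd q))
         (\<lambda>p. \<phi> (z \<circ> fst p, snd p)) (\<lambda>p. \<phi> (z \<circ> fst p, snd p)))"
proof -
  define A where "A u v w x = (\<Sum>b<m. \<Sum>b'<m. cnj (\<phi> (u, b)) * W (v, b) (x, b') * \<phi> (w, b'))" for u v w x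
  let ?P = "perms t"
  have sesq: "sesq (?P \<times> {..<m}) (\<lambda>p q. W (y \<circ> fst p, snd p) (y \<circ> fst q, snd q))
         (\<lambda>p. \<phi> (z \<circ> fst p, snd p)) (\<lambda>p. \<phi> (z \<circ> fst p, snd p))
      = (\<Sum>\<tau>'\<in>?P. \<Sum>\<tau>\<in>?P. A (z \<circ> \<tau>) (y \<circ> \<tau>) (z \<circ> \<tau>') (y \<circ> \<tau>'))" for z y
  proof -
    have "sesq (?P \<times> {..<m}) (\<lambda>p q. W (y \<circ> fst p, snd p) (y \<circ> fst q, snd q))
         (\<lambda>p. \<phi> (z \<circ> fst p, snd p)) (\<lambda>p. \<phi> (z \<circ> fst p, snd p))
      = (\<Sum>\<tau>\<in>?P. \<Sum>b<m. \<Sum>\<tau>'\<in>?P. \<Sum>b'<m. cnj (\<phi> (z \<circ> \<tau>, b)) * W (y \<circ> \<tau>, b) (y \<circ> \<tau>', b') * \<phi> (z \<circ> \<tau>', b'))"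
      unfolding sesq_Times by simp
    also have "\<dots> = (\<Sum>\<tau>\<in>?P. \<Sum>\<tau>'\<in>?P. A (z \<circ> \<tau>) (y \<circ> \<tau>) (z \<circ> \<tau>') (y \<circ> \<tau>'))"
      unfolding A_def by (intro sum.cong refl sum.swap)
    also have "\<dots> = (\<Sum>\<tau>'\<in>?P. \<Sum>\<tau>\<in>?P. A (z \<circ> \<tau>) (y \<circ> \<tau>) (z \<circ> \<tau>') (y \<circ> \<tau>'))"
      by (rule sum.swap)
    finally show ?thesis .
  qed
  \<comment> \<open>Substituting \<tau> = \<tau>' \<sigma> and then relabelling \<open>y\<close> and
    \<open>z\<close> by \<tau>' removes \<tau>'. Every \<tau>' contributes equally, which produces
    the factor t! in front of \<open>ideal_form\<close>.\<close>
  have step: "(\<Sum>z\<in>tuples t d. \<Sum>y\<in>inj_tuples t d. \<Sum>\<tau>\<in>?P. A (z \<circ> \<tau>) (y \<circ> \<tau>) (z \<circ> \<tau>') (y \<circ> \<tau>'))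
      = (\<Sum>z\<in>tuples t d. \<Sum>y\<in>inj_tuples t d. \<Sum>\<sigma>\<in>?P. A (z \<circ> \<sigma>) (y \<circ> \<sigma>) z y)" if \<tau>': "\<tau>' \<in> ?P" for \<tau>'
  proof -
    have "(\<Sum>\<tau>\<in>?P. A (z \<circ> \<tau>) (y \<circ> \<tau>) (z \<circ> \<tau>') (y \<circ> \<tau>')) =
        (\<Sum>\<sigma>\<in>?P. A ((z \<circ> \<tau>') \<circ> \<sigma>) ((y \<circ> \<tau>') \<circ> \<sigma>) (z \<circ> \<tau>') (y \<circ> \<tau>'))" for z y
      using \<tau>' by (subst setum_permutations_compose_left[of \<tau>' "{..<t}"]) (simp_all add: comp_assoc)
    hence "(\<Sum>z\<in>tuples t d. \<Sum>y\<in>inj_tuples t d. \<Sum>\<tau>\<in>?P. A (z \<circ> \<tau>) (y \<circ> \<tau>) (z \<circ> \<tau>') (y \<circ> \<tau>'))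
      = (\<Sum>z\<in>tuples t d. \<Sum>y\<in>inj_tuples t d. \<Sum>\<sigma>\<in>?P. A ((z \<circ> \<tau>') \<circ> \<sigma>) ((y \<circ> \<tau>') \<circ> \<sigma>) (z \<circ> \<tau>') (y \<circ> \<tau>'))"
      by simp
    also have "\<dots> = (\<Sum>z\<in>tuples t d. \<Sum>y\<in>inj_tuples t d. \<Sum>\<sigma>\<in>?P. A ((z \<circ> \<tau>') \<circ> \<sigma>) (y \<circ> \<sigma>) (z \<circ> \<tau>') y)"
    proof (rule sum.cong[OF refl])
      fix z
      show "(\<Sum>y\<in>inj_tuples t d. \<Sum>\<sigma>\<in>?P. A ((z \<circ> \<tau>') \<circ> \<sigma>) ((y \<circ> \<tau>') \<circ> \<sigma>) (z \<circ> \<tau>') (y \<circ> \<tau>'))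
        = (\<Sum>y\<in>inj_tuples t d. \<Sum>\<sigma>\<in>?P. A ((z \<circ> \<tau>') \<circ> \<sigma>) (y \<circ> \<sigma>) (z \<circ> \<tau>') y)"
        by (rule sum.reindex_bij_betw[OF perm_comp_bij(2)[OF \<tau>'],
            where g = "\<lambda>y. \<Sum>\<sigma>\<in>?P. A ((z \<circ> \<tau>') \<circ> \<sigma>) (y \<circ> \<sigma>) (z \<circ> \<tau>') y"])
    qed
    also have "\<dots> = (\<Sum>z\<in>tuples t d. \<Sum>y\<in>inj_tuples t d. \<Sum>\<sigma>\<in>?P. A (z \<circ> \<sigma>) (y \<circ> \<sigma>) z y)"
      by (rule sum.reindex_bij_betw[OF perm_comp_bij(1)[OF \<tau>'], where g = "\<lambda>z. \<Sum>y\<in>inj_tuples t d. \<Sum>\<sigma>\<in>?P. A (z \<circ> \<sigma>) (y \<circ> \<sigma>) z y"])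
    finally show ?thesis .
  qed
  have "(\<Sum>z\<in>tuples t d. \<Sum>y\<in>inj_tuples t d. \<Sum>\<tau>'\<in>?P. \<Sum>\<tau>\<in>?P. A (z \<circ> \<tau>) (y \<circ> \<tau>) (z \<circ> \<tau>') (y \<circ> \<tau>'))
      = (\<Sum>z\<in>tuples t d. \<Sum>\<tau>'\<in>?P. \<Sum>y\<in>inj_tuples t d. \<Sum>\<tau>\<in>?P. A (z \<circ> \<tau>) (y \<circ> \<tau>) (z \<circ> \<tau>') (y \<circ> \<tau>'))"
    by (intro sum.cong refl sum.swap)
  also have "\<dots> = (\<Sum>\<tau>'\<in>?P. \<Sum>z\<in>tuples t d. \<Sum>y\<in>inj_tuples t d. \<Sum>\<tau>\<in>?P. A (z \<circ> \<tau>) (y \<circ> \<tau>) (z \<circ> \<tau>') (y \<circ> \<tau>'))"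
    by (rule sum.swap)
  also have "\<dots> = (\<Sum>\<tau>'\<in>?P. \<Sum>z\<in>tuples t d. \<Sum>y\<in>inj_tuples t d. \<Sum>\<sigma>\<in>?P. A (z \<circ> \<sigma>) (y \<circ> \<sigma>) z y)"
    by (intro sum.cong refl step)
  also have "\<dots> = fact t * (\<Sum>z\<in>tuples t d. \<Sum>y\<in>inj_tuples t d. \<Sum>\<sigma>\<in>?P. A (z \<circ> \<sigma>) (y \<circ> \<sigma>) z y)"
    by (simp add: card_perms)
  finally show ?thesis unfolding sesq ideal_form_def A_def by (simp only: mult_ac)
qed

text \<open>Each term of \<open>ideal_form_kraus\<close> pulls \<open>W\<close> back along an
  injection and so remains a contraction. The sum over \<open>y\<close> cancels against the
  normalisation, the number of distinct tuples, and the sum over \<open>z\<close> counts every tuple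
  t! times, which cancels the factor on the left.\<close>

lemma ideal_form_bound: "cmod (ideal_form \<phi>) \<le> norm_sq I \<phi>"
proof -
  let ?P = "perms t" and ?c = "inverse (\<Prod>i<t. real d - real i)"
  have c0: "?c \<ge> 0" using prod_falling_pos by simp
  have cc: "?c * real (card (inj_tuples t d)) = 1"
    using prod_falling_pos td card_inj_tuples[of t d] by simp
  have ns: "(\<Sum>z\<in>tuples t d. norm_sq (?P \<times> {..<m}) (\<lambda>p. \<phi> (z \<circ> fst p, snd p))) = fact t * norm_sq I \<phi>"
  proof -
    have "(\<Sum>z\<in>tuples t d. norm_sq (?P \<times> {..<m}) (\<lambda>p. \<phi> (z \<circ> fst p, snd p)))
        = (\<Sum>z\<in>tuples t d. \<Sum>\<tau>\<in>?P. \<Sum>b<m. (cmod (\<phi> (z \<circ> \<tau>, b)))\<^sup>2)"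
      unfolding norm_sq_def by (simp add: sum.cartesian_product case_prod_beta)
    also have "\<dots> = (\<Sum>\<tau>\<in>?P. \<Sum>z\<in>tuples t d. \<Sum>b<m. (cmod (\<phi> (z \<circ> \<tau>, b)))\<^sup>2)"
      by (rule sum.swap)
    also have "\<dots> = (\<Sum>\<tau>\<in>?P. \<Sum>z\<in>tuples t d. \<Sum>b<m. (cmod (\<phi> (z, b)))\<^sup>2)"
      by (intro sum.cong refl sum.reindex_bij_betw[OF perm_comp_bij(1), where g = "\<lambda>z. \<Sum>b<m. (cmod (\<phi> (z, b)))\<^sup>2"])
    also have "\<dots> = fact t * norm_sq I \<phi>"
      unfolding norm_sq_def by (simp add: sum.cartesian_product case_prod_beta card_perms)
    finally show ?thesis .
  qed
  have K: "cmod (sesq (?P \<times> {..<m}) (\<lambda>p q. W (y \<circ> fst p, snd p) (y \<circ> fst q, snd q)) x x) \<le> norm_sq (?P \<times> {..<m}) x"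
    if y: "y \<in> inj_tuples t d" for y x
  proof (rule contraction_diagD, rule contraction_inj_on[OF W])
    show "inj_on (\<lambda>p. (y \<circ> fst p, snd p)) (?P \<times> {..<m})"
      using sum_same_image(2)[OF y] by (auto simp: inj_on_def)
    have "y \<in> tuples t d" using y inj_tuples_subset by blast
    thus "(\<lambda>p. (y \<circ> fst p, snd p)) ` (?P \<times> {..<m}) \<subseteq> I"
      using perm_comp_tuples by auto
  qed simp
  have "fact t * cmod (ideal_form \<phi>) = cmod (fact t * ideal_form \<phi>)" by (simp add: norm_mult)
  also have "\<dots> = ?c * cmod (\<Sum>z\<in>tuples t d. \<Sum>y\<in>inj_tuples t d.
       sesq (?P \<times> {..<m}) (\<lambda>p q. W (y \<circ> fst p, snd p) (y \<circ> fst q, snd q))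
         (\<lambda>p. \<phi> (z \<circ> fst p, snd p)) (\<lambda>p. \<phi> (z \<circ> fst p, snd p)))"
    unfolding ideal_form_kraus norm_mult norm_of_real using c0 by simp
  also have "\<dots> \<le> ?c * (\<Sum>z\<in>tuples t d. \<Sum>y\<in>inj_tuples t d. norm_sq (?P \<times> {..<m}) (\<lambda>p. \<phi> (z \<circ> fst p, snd p)))"
    by (intro mult_left_mono[OF _ c0] order.trans[OF norm_sum] sum_mono K)
  also have "\<dots> = (?c * real (card (inj_tuples t d))) * (fact t * norm_sq I \<phi>)"
    unfolding ns[symmetric] by (simp add: sum_distrib_left mult_ac)
  finally show ?thesis unfolding cc by simp
qed

text \<open>\<pi> and f are independent, so the average over signs factors out and kills every pair
  of tuples with different value sets.\<close>

lemma pf_average_inj: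
  assumes w: "w \<in> inj_tuples t d" and u: "u \<in> inj_tuples t d"
  shows "pf_average (w, b) (u, b') = (if w ` {..<t} = u ` {..<t}
    then \<Sum>\<pi>\<in>set_pmf \<D>. of_real (pmf \<D> \<pi>) * W (tuple_map t \<pi> w, b) (tuple_map t \<pi> u, b') else 0)"
proof -
  have "pf_average (w, b) (u, b') = (\<Sum>\<pi>\<in>set_pmf \<D>. \<Sum>f\<in>set_mset F. of_real (pmf \<D> \<pi>) *
      W (tuple_map t \<pi> w, b) (tuple_map t \<pi> u, b') * (of_real (pmf G f) * (tuple_sign t f w * tuple_sign t f u)))"
    unfolding pf_average_def sum.cartesian_product
    by (intro sum.cong refl) (auto simp: pf_weight_def pf_form_def mult_ac)
  also have "\<dots> = (\<Sum>\<pi>\<in>set_pmf \<D>. of_real (pmf \<D> \<pi>) * W (tuple_map t \<pi> w, b) (tuple_map t \<pi> u, b') *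
      (if w ` {..<t} = u ` {..<t} then 1 else 0))"
    unfolding sum_distrib_left[symmetric] tuple_sign_average[OF F td w u] ..
  finally show ?thesis by simp
qed

lemma D_average_tuple:
  assumes u: "u \<in> inj_tuples t d"
  shows "(\<Sum>\<pi>\<in>set_pmf \<D>. of_real (pmf \<D> \<pi>) * X (tuple_map t \<pi> u))
    = (\<Sum>v\<in>inj_tuples t d. of_real (measure_pmf.prob \<D> {\<pi>. tuple_map t \<pi> u = v}) * (X v :: complex))"
proof -
  have "(\<Sum>\<pi>\<in>set_pmf \<D>. of_real (pmf \<D> \<pi>) * X (tuple_map t \<pi> u))
     = (\<Sum>v\<in>inj_tuples t d. \<Sum>\<pi>\<in>{\<pi> \<in> set_pmf \<D>. tuple_map t \<pi> u = v}. of_real (pmf \<D> \<pi>) * X (tuple_map t \<pi> u))"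
    using tuple_map_tuples(2)[OF D_permutes u] finite_D by (intro sum.group[symmetric]) auto
  also have "\<dots> = (\<Sum>v\<in>inj_tuples t d. of_real (measure_pmf.prob \<D> {\<pi>. tuple_map t \<pi> u = v}) * X v)"
  proof (intro sum.cong refl)
    fix v
    have "measure_pmf.prob \<D> {\<pi>. tuple_map t \<pi> u = v} = measure_pmf.prob \<D> {\<pi> \<in> set_pmf \<D>. tuple_map t \<pi> u = v}"
      by (intro measure_prob_cong_0) (auto simp: pmf_eq_0_set_pmf)
    also have "\<dots> = (\<Sum>\<pi>\<in>{\<pi> \<in> set_pmf \<D>. tuple_map t \<pi> u = v}. pmf \<D> \<pi>)"
      using finite_D by (intro measure_measure_pmf_finite) auto
    finally show "(\<Sum>\<pi>\<in>{\<pi> \<in> set_pmf \<D>. tuple_map t \<pi> u = v}. of_real (pmf \<D> \<pi>) * X (tuple_map t \<pi> u))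
      = of_real (measure_pmf.prob \<D> {\<pi>. tuple_map t \<pi> u = v}) * X v"
      by (simp add: sum_distrib_right)
  qed
  finally show ?thesis .
qed

text \<open>After the average over signs the partner of \<open>u\<close> is
  \<open>u \<circ> \<sigma>\<close>, and the average over \<pi> turns into a sum over the image
  \<open>v\<close> of \<open>u\<close> weighted by its probability. \<open>ideal_form\<close> has
  the same shape with the uniform weight, so the difference carries the deviation
  \<open>e u v\<close>.\<close>

lemma pf_average_ideal_diff:
  fixes \<phi> :: "(nat \<Rightarrow> nat) \<times> nat \<Rightarrow> complex"
  assumes supp: "\<And>p. fst p \<notin> inj_tuples t d \<Longrightarrow> \<phi> p = 0"
  defines "e \<equiv> \<lambda>u v. measure_pmf.prob \<D> {\<pi>. tuple_map t \<pi> u = v} - inverse (\<Prod>i<t. real d - real i)"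
  shows "sesq I pf_average \<phi> \<phi> - ideal_form \<phi> =
    (\<Sum>u\<in>inj_tuples t d. \<Sum>\<sigma>\<in>perms t. \<Sum>b<m. \<Sum>b'<m. cnj (\<phi> (u \<circ> \<sigma>, b)) *
       (\<Sum>v\<in>inj_tuples t d. of_real (e u v) * W (v \<circ> \<sigma>, b) (v, b')) * \<phi> (u, b'))"
proof -
  let ?T = "tuples t d" and ?E = "inj_tuples t d" and ?P = "perms t" and ?c = "inverse (\<Prod>i<t. real d - real i)"
  let ?pr = "\<lambda>u v. measure_pmf.prob \<D> {\<pi>. tuple_map t \<pi> u = v}"
  have restr: "(\<Sum>u\<in>?T. X u) = (\<Sum>u\<in>?E. X u)" if "\<And>u. u \<notin> ?E \<Longrightarrow> X u = 0" for X :: "(nat \<Rightarrow> nat) \<Rightarrow> complex"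
    using that inj_tuples_subset by (intro sum.mono_neutral_right) auto
  have inner: "(\<Sum>w\<in>?E. \<Sum>b<m. \<Sum>b'<m. cnj (\<phi> (w, b)) * pf_average (w, b) (u, b') * \<phi> (u, b')) =
      (\<Sum>\<sigma>\<in>?P. \<Sum>b<m. \<Sum>b'<m. cnj (\<phi> (u \<circ> \<sigma>, b)) * (\<Sum>v\<in>?E. of_real (?pr u v) * W (v \<circ> \<sigma>, b) (v, b')) * \<phi> (u, b'))"
    if u: "u \<in> ?E" for u
  proof -
    let ?X = "\<lambda>w. \<Sum>b<m. \<Sum>b'<m. cnj (\<phi> (w, b)) * (\<Sum>\<pi>\<in>set_pmf \<D>. of_real (pmf \<D> \<pi>) * W (tuple_map t \<pi> w, b) (tuple_map t \<pi> u, b')) * \<phi> (u, b')"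
    have "(\<Sum>w\<in>?E. \<Sum>b<m. \<Sum>b'<m. cnj (\<phi> (w, b)) * pf_average (w, b) (u, b') * \<phi> (u, b')) =
       (\<Sum>w\<in>?E. if w ` {..<t} = u ` {..<t} then ?X w else 0)"
      by (intro sum.cong refl) (simp add: pf_average_inj[OF _ u])
    also have "\<dots> = (\<Sum>w\<in>{w \<in> ?E. w ` {..<t} = u ` {..<t}}. ?X w)"
      by (simp add: sum.inter_filter)
    also have "\<dots> = (\<Sum>\<sigma>\<in>?P. ?X (u \<circ> \<sigma>))" by (rule sum_same_image(1)[OF u])
    also have "\<dots> = (\<Sum>\<sigma>\<in>?P. \<Sum>b<m. \<Sum>b'<m. cnj (\<phi> (u \<circ> \<sigma>, b)) * (\<Sum>v\<in>?E. of_real (?pr u v) * W (v \<circ> \<sigma>, b) (v, b')) * \<phi> (u, b'))"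
    proof (intro sum.cong refl)
      fix \<sigma> b b' assume \<sigma>: "\<sigma> \<in> ?P"
      show "cnj (\<phi> (u \<circ> \<sigma>, b)) * (\<Sum>\<pi>\<in>set_pmf \<D>. of_real (pmf \<D> \<pi>) * W (tuple_map t \<pi> (u \<circ> \<sigma>), b) (tuple_map t \<pi> u, b')) * \<phi> (u, b')
        = cnj (\<phi> (u \<circ> \<sigma>, b)) * (\<Sum>v\<in>?E. of_real (?pr u v) * W (v \<circ> \<sigma>, b) (v, b')) * \<phi> (u, b')"
        \<comment> \<open>\<pi> acts on values and \<sigma> on positions, so they commute. Both
          arguments of \<open>W\<close> are then functions of the image of \<open>u\<close> alone,
          which is why t-wise independence of \<pi> is enough.\<close>
        unfolding tuple_map_perm_comp[OF \<sigma>]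
        by (subst D_average_tuple[OF u, where X = "\<lambda>v. W (v \<circ> \<sigma>, b) (v, b')"]) simp
    qed
    finally show ?thesis .
  qed
  have "sesq I pf_average \<phi> \<phi> = (\<Sum>w\<in>?T. \<Sum>b<m. \<Sum>u\<in>?T. \<Sum>b'<m. cnj (\<phi> (w, b)) * pf_average (w, b) (u, b') * \<phi> (u, b'))"
    unfolding sesq_Times by simp
  also have "\<dots> = (\<Sum>w\<in>?T. \<Sum>u\<in>?T. \<Sum>b<m. \<Sum>b'<m. cnj (\<phi> (w, b)) * pf_average (w, b) (u, b') * \<phi> (u, b'))"
    by (intro sum.cong refl sum.swap)
  also have "\<dots> = (\<Sum>u\<in>?T. \<Sum>w\<in>?T. \<Sum>b<m. \<Sum>b'<m. cnj (\<phi> (w, b)) * pf_average (w, b) (u, b') * \<phi> (u, b'))"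
    by (rule sum.swap)
  also have "\<dots> = (\<Sum>u\<in>?E. \<Sum>w\<in>?T. \<Sum>b<m. \<Sum>b'<m. cnj (\<phi> (w, b)) * pf_average (w, b) (u, b') * \<phi> (u, b'))"
    by (rule restr) (simp add: supp)
  also have "\<dots> = (\<Sum>u\<in>?E. \<Sum>w\<in>?E. \<Sum>b<m. \<Sum>b'<m. cnj (\<phi> (w, b)) * pf_average (w, b) (u, b') * \<phi> (u, b'))"
    by (intro sum.cong refl restr) (simp add: supp)
  also have "\<dots> = (\<Sum>u\<in>?E. \<Sum>\<sigma>\<in>?P. \<Sum>b<m. \<Sum>b'<m. cnj (\<phi> (u \<circ> \<sigma>, b)) * (\<Sum>v\<in>?E. of_real (?pr u v) * W (v \<circ> \<sigma>, b) (v, b')) * \<phi> (u, b'))"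
    by (intro sum.cong refl inner)
  finally have S: "sesq I pf_average \<phi> \<phi> = \<dots>" .
  have "ideal_form \<phi> = of_real ?c * (\<Sum>u\<in>?T. \<Sum>\<sigma>\<in>?P. \<Sum>v\<in>?E. \<Sum>b<m. \<Sum>b'<m. cnj (\<phi> (u \<circ> \<sigma>, b)) * W (v \<circ> \<sigma>, b) (v, b') * \<phi> (u, b'))"
    unfolding ideal_form_def by (intro arg_cong2[where f = "(*)"] refl sum.cong sum.swap)
  also have "(\<Sum>u\<in>?T. \<Sum>\<sigma>\<in>?P. \<Sum>v\<in>?E. \<Sum>b<m. \<Sum>b'<m. cnj (\<phi> (u \<circ> \<sigma>, b)) * W (v \<circ> \<sigma>, b) (v, b') * \<phi> (u, b'))
     = (\<Sum>u\<in>?E. \<Sum>\<sigma>\<in>?P. \<Sum>v\<in>?E. \<Sum>b<m. \<Sum>b'<m. cnj (\<phi> (u \<circ> \<sigma>, b)) * W (v \<circ> \<sigma>, b) (v, b') * \<phi> (u, b'))"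
    by (rule restr) (simp add: supp)
  also have "\<dots> = (\<Sum>u\<in>?E. \<Sum>\<sigma>\<in>?P. \<Sum>b<m. \<Sum>v\<in>?E. \<Sum>b'<m. cnj (\<phi> (u \<circ> \<sigma>, b)) * W (v \<circ> \<sigma>, b) (v, b') * \<phi> (u, b'))"
    by (intro sum.cong refl sum.swap)
  also have "\<dots> = (\<Sum>u\<in>?E. \<Sum>\<sigma>\<in>?P. \<Sum>b<m. \<Sum>b'<m. \<Sum>v\<in>?E. cnj (\<phi> (u \<circ> \<sigma>, b)) * W (v \<circ> \<sigma>, b) (v, b') * \<phi> (u, b'))"
    by (intro sum.cong refl sum.swap)
  finally have g: "ideal_form \<phi> = (\<Sum>u\<in>?E. \<Sum>\<sigma>\<in>?P. \<Sum>b<m. \<Sum>b'<m. cnj (\<phi> (u \<circ> \<sigma>, b)) * (\<Sum>v\<in>?E. of_real ?c * W (v \<circ> \<sigma>, b) (v, b')) * \<phi> (u, b'))"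
    by (simp add: sum_distrib_left sum_distrib_right mult_ac)
  show ?thesis unfolding S g e_def sum_subtractf[symmetric]
    by (intro sum.cong refl) (simp add: algebra_simps sum_subtractf)
qed

end


section \<open>Tensor powers and collisions\<close>

definition tensor_coeff :: "nat \<Rightarrow> (nat \<Rightarrow> nat \<Rightarrow> complex) \<Rightarrow> (nat \<Rightarrow> nat) \<Rightarrow> (nat \<Rightarrow> nat) \<Rightarrow> complex" where
  "tensor_coeff t R u v = (\<Prod>k<t. R (u k) (v k))"

text \<open>The vector obtained from \<open>\<phi>\<close> by R^(\<otimes>t) on the tuple part and
  the identity on the reference index.\<close>

definition tensor_apply ::
  "nat \<Rightarrow> nat \<Rightarrow> (nat \<Rightarrow> nat \<Rightarrow> complex) \<Rightarrow> ((nat \<Rightarrow> nat) \<times> nat \<Rightarrow> complex) \<Rightarrow> (nat \<Rightarrow> nat) \<times> nat \<Rightarrow> complex" where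
  "tensor_apply t d R \<phi> p = (\<Sum>v\<in>tuples t d. tensor_coeff t R (fst p) v * \<phi> (v, snd p))"

definition unitary_fun :: "nat \<Rightarrow> (nat \<Rightarrow> nat \<Rightarrow> complex) \<Rightarrow> bool" where
  "unitary_fun d R \<longleftrightarrow> (\<forall>x<d. \<forall>y<d. (\<Sum>w<d. cnj (R w x) * R w y) = (if x = y then 1 else 0))"

lemma sum_tuples_prod: "(\<Sum>u\<in>tuples t d. \<Prod>k<t. f k (u k)) = (\<Prod>k<t. \<Sum>x<d. f k x :: complex)"
  unfolding tuples_def by (subst prod_sum_PiE) auto

lemma tuples_eq_iff: "u \<in> tuples t d \<Longrightarrow> v \<in> tuples t d \<Longrightarrow> u = v \<longleftrightarrow> (\<forall>k<t. u k = v k)"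
  by (metis PiE_ext lessThan_iff tuples_def)

lemma tuples_less: "u \<in> tuples t d \<Longrightarrow> k < t \<Longrightarrow> u k < d"
  by (auto simp: tuples_def PiE_iff)

lemma prod_delta: "finite A \<Longrightarrow> (\<Prod>k\<in>A. if P k then 1 else 0) = (if \<forall>k\<in>A. P k then 1 else 0 :: complex)"
  by (induction A rule: finite_induct) auto

lemma tensor_coeff_inner:
  assumes "unitary_fun d R" "v \<in> tuples t d" "v' \<in> tuples t d"
  shows "(\<Sum>u\<in>tuples t d. cnj (tensor_coeff t R u v) * tensor_coeff t R u v') = (if v = v' then 1 else 0)"
proof -
  have "(\<Sum>u\<in>tuples t d. cnj (tensor_coeff t R u v) * tensor_coeff t R u v')
      = (\<Sum>u\<in>tuples t d. \<Prod>k<t. cnj (R (u k) (v k)) * R (u k) (v' k))"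
    by (simp add: tensor_coeff_def prod.distrib)
  also have "\<dots> = (\<Prod>k<t. \<Sum>x<d. cnj (R x (v k)) * R x (v' k))"
    by (rule sum_tuples_prod)
  also have "\<dots> = (\<Prod>k<t. if v k = v' k then 1 else 0)"
    using assms by (intro prod.cong refl) (auto simp: unitary_fun_def tuples_less)
  also have "\<dots> = (if v = v' then 1 else 0)"
    using tuples_eq_iff[OF assms(2,3)] by (subst prod_delta) auto
  finally show ?thesis .
qed

text \<open>Unitarity holds between any two reference slices \<open>b\<close> and \<open>b'\<close>
  and any two vectors, not only for the total norm. The invariance of \<open>ideal_form\<close>
  relies on this form, with a slice of a permuted vector on one side.\<close>

lemma tensor_apply_inner:
  assumes R: "unitary_fun d R"
  shows "(\<Sum>u\<in>tuples t d. cnj (tensor_apply t d R \<phi> (u, b)) * tensor_apply t d R \<xi> (u, b'))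
    = (\<Sum>u\<in>tuples t d. cnj (\<phi> (u, b)) * \<xi> (u, b'))"
proof -
  let ?T = "tuples t d" and ?c = "tensor_coeff t R"
  have "(\<Sum>u\<in>?T. cnj (tensor_apply t d R \<phi> (u, b)) * tensor_apply t d R \<xi> (u, b'))
      = (\<Sum>u\<in>?T. \<Sum>v\<in>?T. \<Sum>v'\<in>?T. cnj (\<phi> (v, b)) * \<xi> (v', b') * (cnj (?c u v) * ?c u v'))"
    unfolding tensor_apply_def fst_conv snd_conv cnj_sum sum_product
    by (intro sum.cong refl) (simp add: mult_ac)
  also have "\<dots> = (\<Sum>v\<in>?T. \<Sum>u\<in>?T. \<Sum>v'\<in>?T. cnj (\<phi> (v, b)) * \<xi> (v', b') * (cnj (?c u v) * ?c u v'))"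
    by (rule sum.swap)
  also have "\<dots> = (\<Sum>v\<in>?T. \<Sum>v'\<in>?T. \<Sum>u\<in>?T. cnj (\<phi> (v, b)) * \<xi> (v', b') * (cnj (?c u v) * ?c u v'))"
    by (intro sum.cong refl sum.swap)
  also have "\<dots> = (\<Sum>v\<in>?T. \<Sum>v'\<in>?T. if v = v' then cnj (\<phi> (v, b)) * \<xi> (v', b') else 0)"
    unfolding sum_distrib_left[symmetric] by (intro sum.cong refl) (simp add: tensor_coeff_inner[OF R])
  also have "\<dots> = (\<Sum>u\<in>?T. cnj (\<phi> (u, b)) * \<xi> (u, b'))" by (intro sum.cong refl) simp
  finally show ?thesis .
qed

lemma norm_sq_tensor_apply:
  assumes "unitary_fun d R"
  shows "norm_sq (tuples t d \<times> {..<m}) (tensor_apply t d R \<phi>) = norm_sq (tuples t d \<times> {..<m}) \<phi>"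
proof -
  have n: "complex_of_real (norm_sq (tuples t d \<times> {..<m}) \<xi>) = (\<Sum>b<m. \<Sum>u\<in>tuples t d. cnj (\<xi> (u, b)) * \<xi> (u, b))" for \<xi>
    unfolding norm_sq_Times by (subst sum.swap) (simp add: complex_norm_square mult.commute del: of_real_power)
  have "complex_of_real (norm_sq (tuples t d \<times> {..<m}) (tensor_apply t d R \<phi>)) = of_real (norm_sq (tuples t d \<times> {..<m}) \<phi>)"
    unfolding n tensor_apply_inner[OF assms] ..
  thus ?thesis by (simp only: of_real_eq_iff)
qed

text \<open>A tensor power commutes with permutations of its factors, since the product over
  positions can be reordered.\<close>

lemma tensor_apply_perm:
  assumes \<sigma>: "\<sigma> \<in> perms t"
  shows "tensor_apply t d R \<phi> (u \<circ> \<sigma>, b) = tensor_apply t d R (\<lambda>p. \<phi> (fst p \<circ> \<sigma>, snd p)) (u, b)"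
proof -
  have p: "\<sigma> permutes {..<t}" using \<sigma> by simp
  have "tensor_coeff t R (u \<circ> \<sigma>) (v \<circ> \<sigma>) = tensor_coeff t R u v" for v
    unfolding tensor_coeff_def using prod.permute[OF p, of "\<lambda>k. R (u k) (v k)"] by (simp add: o_def)
  moreover have "tensor_apply t d R \<phi> (u \<circ> \<sigma>, b) = (\<Sum>v\<in>tuples t d. tensor_coeff t R (u \<circ> \<sigma>) (v \<circ> \<sigma>) * \<phi> (v \<circ> \<sigma>, b))"
    unfolding tensor_apply_def fst_conv snd_conv
    by (rule sum.reindex_bij_betw[OF perm_comp_bij(1)[OF \<sigma>], symmetric])
  ultimately show ?thesis by (simp add: tensor_apply_def)
qed

section \<open>Weight on tuples with a collision\<close>

definition collision :: "nat \<Rightarrow> nat \<Rightarrow> nat \<Rightarrow> nat \<Rightarrow> nat \<Rightarrow> ((nat \<Rightarrow> nat) \<times> nat \<Rightarrow> complex) \<Rightarrow> real" where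
  "collision t d m i j \<phi> = (\<Sum>b<m. \<Sum>u\<in>{u \<in> tuples t d. u i = u j}. (cmod (\<phi> (u, b)))\<^sup>2)"

text \<open>The constraint \<open>u i = u j\<close> is replaced by a sum over the common value
  \<open>w\<close> with indicators at positions \<open>i\<close> and \<open>j\<close>. For fixed
  \<open>w\<close> the summand is a product over positions, so the sum over tuples
  factorises.\<close>

lemma sum_tuples_pair:
  assumes ij: "i < t" "j < t"
  shows "(\<Sum>u\<in>{u \<in> tuples t d. u i = u j}. \<Prod>k<t. f k (u k) :: complex)
     = (\<Sum>w<d. \<Prod>k<t. if k \<in> {i, j} then f k w else \<Sum>x<d. f k x)"
proof -
  have "(\<Sum>w<d. \<Prod>k<t. if k \<in> {i, j} then f k w else \<Sum>x<d. f k x)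
      = (\<Sum>w<d. \<Prod>k<t. \<Sum>x<d. f k x * (if k \<in> {i, j} \<and> x \<noteq> w then 0 else 1))"
  proof (intro sum.cong prod.cong refl)
    fix w k assume "w \<in> {..<d}"
    hence "(\<Sum>x<d. f k x * (if k \<in> {i, j} \<and> x \<noteq> w then 0 else 1)) = f k w" if "k \<in> {i, j}"
    proof -
      have "(\<Sum>x<d. f k x * (if k \<in> {i, j} \<and> x \<noteq> w then 0 else 1)) = (\<Sum>x<d. if x = w then f k w else 0)"
        using that by (intro sum.cong refl) auto
      thus ?thesis using \<open>w \<in> {..<d}\<close> by simp
    qed
    thus "(if k \<in> {i, j} then f k w else \<Sum>x<d. f k x) = (\<Sum>x<d. f k x * (if k \<in> {i, j} \<and> x \<noteq> w then 0 else 1))"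
      by (cases "k \<in> {i, j}") auto
  qed
  also have "\<dots> = (\<Sum>w<d. \<Sum>u\<in>tuples t d. \<Prod>k<t. f k (u k) * (if k \<in> {i, j} \<and> u k \<noteq> w then 0 else 1))"
    by (intro sum.cong refl sum_tuples_prod[symmetric])
  also have "\<dots> = (\<Sum>u\<in>tuples t d. \<Sum>w<d. \<Prod>k<t. f k (u k) * (if k \<in> {i, j} \<and> u k \<noteq> w then 0 else 1))"
    by (rule sum.swap)
  also have "\<dots> = (\<Sum>u\<in>tuples t d. if u i = u j then \<Prod>k<t. f k (u k) else 0)"
  proof (rule sum.cong[OF refl])
    fix u assume u: "u \<in> tuples t d"
    \<comment> \<open>The indicators leave only w = u i, and this only if u j has the same
      value.\<close>
    have "(\<Prod>k<t. f k (u k) * (if k \<in> {i, j} \<and> u k \<noteq> w then 0 else 1)) = (if w = u i then if u i = u j then \<Prod>k<t. f k (u k) else 0 else 0)" for w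
    proof (cases "u i = w \<and> u j = w")
      case True
      hence "(\<Prod>k<t. f k (u k) * (if k \<in> {i, j} \<and> u k \<noteq> w then 0 else 1)) = (\<Prod>k<t. f k (u k))"
        by (intro prod.cong refl) auto
      thus ?thesis using True by auto
    next
      case False
      then obtain k where "k < t" "k \<in> {i, j}" "u k \<noteq> w" using ij by auto
      hence z: "(\<Prod>k<t. f k (u k) * (if k \<in> {i, j} \<and> u k \<noteq> w then 0 else 1)) = 0"
        by (intro prod_zero) (auto intro!: bexI[of _ k])
      show ?thesis unfolding z using False by auto
    qed
    thus "(\<Sum>w<d. \<Prod>k<t. f k (u k) * (if k \<in> {i, j} \<and> u k \<noteq> w then 0 else 1)) = (if u i = u j then \<Prod>k<t. f k (u k) else 0)"
      using tuples_less[OF u ij(1)] by simp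
  qed
  also have "\<dots> = (\<Sum>u\<in>{u \<in> tuples t d. u i = u j}. \<Prod>k<t. f k (u k))"
    by (simp add: sum.inter_filter)
  finally show ?thesis ..
qed

text \<open>At positions other than \<open>i\<close> and \<open>j\<close> orthonormality of the
  columns forces \<open>v\<close> and \<open>v'\<close> to agree; the two colliding positions leave
  a fourth-order expression in \<open>R\<close>.\<close>

lemma tensor_coeff_collision:
  assumes R: "unitary_fun d R" and v: "v \<in> tuples t d" "v' \<in> tuples t d" and ij: "i < t" "j < t" "i \<noteq> j"
  shows "(\<Sum>u\<in>{u \<in> tuples t d. u i = u j}. tensor_coeff t R u v * cnj (tensor_coeff t R u v'))
    = (if \<forall>k<t. k \<notin> {i, j} \<longrightarrow> v k = v' k
       then \<Sum>w<d. R w (v i) * R w (v j) * cnj (R w (v' i)) * cnj (R w (v' j)) else 0)"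
proof -
  define f where "f k x = R x (v k) * cnj (R x (v' k))" for k x
  define P where "P \<longleftrightarrow> (\<forall>k<t. k \<notin> {i, j} \<longrightarrow> v k = v' k)"
  have "(\<Sum>u\<in>{u \<in> tuples t d. u i = u j}. tensor_coeff t R u v * cnj (tensor_coeff t R u v'))
      = (\<Sum>u\<in>{u \<in> tuples t d. u i = u j}. \<Prod>k<t. f k (u k))"
    by (simp add: tensor_coeff_def f_def prod.distrib)
  also have "\<dots> = (\<Sum>w<d. \<Prod>k<t. if k \<in> {i, j} then f k w else \<Sum>x<d. f k x)"
    by (rule sum_tuples_pair[OF ij(1,2)])
  also have "\<dots> = (\<Sum>w<d. (f i w * f j w) * (if \<forall>k\<in>{..<t} - {i, j}. v k = v' k then 1 else 0))"
  proof (rule sum.cong[OF refl])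
    fix w
    have d: "(\<Sum>x<d. f k x) = (if v k = v' k then 1 else 0)" if "k < t" for k
    proof -
      have "(\<Sum>x<d. cnj (R x (v' k)) * R x (v k)) = (if v' k = v k then 1 else 0)"
        using R tuples_less[OF v(1) that] tuples_less[OF v(2) that] unfolding unitary_fun_def by blast
      thus ?thesis by (simp add: f_def mult.commute eq_commute[of "v k" "v' k"])
    qed
    have "(\<Prod>k<t. if k \<in> {i, j} then f k w else \<Sum>x<d. f k x)
       = (\<Prod>k\<in>{i, j}. if k \<in> {i, j} then f k w else \<Sum>x<d. f k x) * (\<Prod>k\<in>{..<t} - {i, j}. if k \<in> {i, j} then f k w else \<Sum>x<d. f k x)"
      using ij by (subst prod.subset_diff[of "{i, j}" "{..<t}"]) (auto simp: mult.commute)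
    also have "(\<Prod>k\<in>{i, j}. if k \<in> {i, j} then f k w else \<Sum>x<d. f k x) = f i w * f j w"
      using ij by simp
    also have "(\<Prod>k\<in>{..<t} - {i, j}. if k \<in> {i, j} then f k w else \<Sum>x<d. f k x) = (\<Prod>k\<in>{..<t} - {i, j}. if v k = v' k then 1 else 0)"
      by (intro prod.cong refl) (auto simp: d)
    also have "\<dots> = (if \<forall>k\<in>{..<t} - {i, j}. v k = v' k then 1 else 0)" by (rule prod_delta) simp
    finally show "(\<Prod>k<t. if k \<in> {i, j} then f k w else \<Sum>x<d. f k x) = (f i w * f j w) * (if \<forall>k\<in>{..<t} - {i, j}. v k = v' k then 1 else 0)" .
  qed
  also have "(\<forall>k\<in>{..<t} - {i, j}. v k = v' k) \<longleftrightarrow> (\<forall>k<t. k \<notin> {i, j} \<longrightarrow> v k = v' k)" by auto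
  finally show ?thesis
    unfolding P_def[symmetric] by (cases P) (simp_all add: f_def mult_ac)
qed

text \<open>By \<open>avg\<close>, the expanded square pairs \<open>v\<close> only with itself and
  with its transposition at \<open>i\<close> and \<open>j\<close>. The first pairing costs K times
  the squared norm, and so does the second by the inequality of arithmetic and geometric
  means.\<close>

lemma collision_average:
  assumes \<Theta>: "finite \<Theta>" and V: "\<And>\<theta>. \<theta> \<in> \<Theta> \<Longrightarrow> unitary_fun d (V \<theta>)" and K: "K \<ge> 0"
    and avg: "\<And>x y x' y'. x < d \<Longrightarrow> y < d \<Longrightarrow> x' < d \<Longrightarrow> y' < d \<Longrightarrow>
      (\<Sum>\<theta>\<in>\<Theta>. \<Sum>w<d. V \<theta> w x * V \<theta> w y * cnj (V \<theta> w x') * cnj (V \<theta> w y'))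
        = (if x' = x \<and> y' = y \<or> x' = y \<and> y' = x then of_real K else 0)"
    and ij: "i < t" "j < t" "i \<noteq> j"
  shows "(\<Sum>\<theta>\<in>\<Theta>. collision t d m i j (tensor_apply t d (V \<theta>) \<xi>)) \<le> 2 * K * norm_sq (tuples t d \<times> {..<m}) \<xi>"
proof -
  let ?T = "tuples t d" and ?C = "{u \<in> tuples t d. u i = u j}" and ?c = "\<lambda>\<theta>. tensor_coeff t (V \<theta>)"
  let ?\<tau> = "Transposition.transpose i j"
  have \<tau>: "?\<tau> \<in> perms t" using ij by (simp add: permutes_swap_id)
  have pair: "(\<Sum>\<theta>\<in>\<Theta>. \<Sum>u\<in>?C. ?c \<theta> u v * cnj (?c \<theta> u v')) = (if v' = v \<or> v' = v \<circ> ?\<tau> then of_real K else 0)"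
    if v: "v \<in> ?T" "v' \<in> ?T" for v v'
  proof -
    define P where "P \<longleftrightarrow> (\<forall>k<t. k \<notin> {i, j} \<longrightarrow> v k = v' k)"
    have "(\<Sum>u\<in>?C. ?c \<theta> u v * cnj (?c \<theta> u v')) =
        (if P then \<Sum>w<d. V \<theta> w (v i) * V \<theta> w (v j) * cnj (V \<theta> w (v' i)) * cnj (V \<theta> w (v' j)) else 0)"
      if "\<theta> \<in> \<Theta>" for \<theta>
      unfolding P_def by (rule tensor_coeff_collision[OF V[OF that] v ij])
    hence "(\<Sum>\<theta>\<in>\<Theta>. \<Sum>u\<in>?C. ?c \<theta> u v * cnj (?c \<theta> u v')) = (if P
       then \<Sum>\<theta>\<in>\<Theta>. \<Sum>w<d. V \<theta> w (v i) * V \<theta> w (v j) * cnj (V \<theta> w (v' i)) * cnj (V \<theta> w (v' j)) else 0)"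
      by (cases P) simp_all
    also have "\<dots> = (if P \<and> (v' i = v i \<and> v' j = v j \<or> v' i = v j \<and> v' j = v i) then of_real K else 0)"
      using v ij by (cases P) (simp_all add: avg tuples_less)
    also have "P \<and> (v' i = v i \<and> v' j = v j \<or> v' i = v j \<and> v' j = v i) \<longleftrightarrow> v' = v \<or> v' = v \<circ> ?\<tau>"
    proof -
      have split: "(\<forall>k<t. Q k) \<longleftrightarrow> Q i \<and> Q j \<and> (\<forall>k<t. k \<notin> {i, j} \<longrightarrow> Q k)" for Q
        using ij by blast
      have other: "?\<tau> k = k" if "k \<notin> {i, j}" for k using that by (simp add: Transposition.transpose_def)
      have "v' = v \<longleftrightarrow> v' i = v i \<and> v' j = v j \<and> (\<forall>k<t. k \<notin> {i, j} \<longrightarrow> v k = v' k)"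
        unfolding tuples_eq_iff[OF v(2,1)] by (subst split) metis
      moreover have "v' = v \<circ> ?\<tau> \<longleftrightarrow> v' i = v j \<and> v' j = v i \<and> (\<forall>k<t. k \<notin> {i, j} \<longrightarrow> v k = v' k)"
        unfolding tuples_eq_iff[OF v(2) perm_comp_tuples[OF \<tau> v(1)]] comp_apply
        by (subst split, unfold transpose_apply_first transpose_apply_second) (metis other)
      ultimately show ?thesis unfolding P_def by blast
    qed
    finally show ?thesis .
  qed
  have sl: "(\<Sum>\<theta>\<in>\<Theta>. \<Sum>u\<in>?C. (cmod (tensor_apply t d (V \<theta>) \<xi> (u, b)))\<^sup>2) \<le> 2 * K * (\<Sum>v\<in>?T. (cmod (\<xi> (v, b)))\<^sup>2)" for b
  proof -
    define \<psi> where "\<psi> v = \<xi> (v, b)" for v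
    have "complex_of_real (\<Sum>\<theta>\<in>\<Theta>. \<Sum>u\<in>?C. (cmod (tensor_apply t d (V \<theta>) \<xi> (u, b)))\<^sup>2)
       = (\<Sum>\<theta>\<in>\<Theta>. \<Sum>u\<in>?C. (\<Sum>v\<in>?T. ?c \<theta> u v * \<psi> v) * cnj (\<Sum>v'\<in>?T. ?c \<theta> u v' * \<psi> v'))"
      by (simp add: complex_norm_square tensor_apply_def \<psi>_def del: of_real_power cnj_sum)
    also have "\<dots> = (\<Sum>\<theta>\<in>\<Theta>. \<Sum>u\<in>?C. \<Sum>v\<in>?T. \<Sum>v'\<in>?T. \<psi> v * cnj (\<psi> v') * (?c \<theta> u v * cnj (?c \<theta> u v')))"
      unfolding cnj_sum sum_product by (intro sum.cong refl) (simp add: mult_ac)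
    also have "\<dots> = (\<Sum>\<theta>\<in>\<Theta>. \<Sum>v\<in>?T. \<Sum>u\<in>?C. \<Sum>v'\<in>?T. \<psi> v * cnj (\<psi> v') * (?c \<theta> u v * cnj (?c \<theta> u v')))"
      by (intro sum.cong refl sum.swap)
    also have "\<dots> = (\<Sum>v\<in>?T. \<Sum>\<theta>\<in>\<Theta>. \<Sum>u\<in>?C. \<Sum>v'\<in>?T. \<psi> v * cnj (\<psi> v') * (?c \<theta> u v * cnj (?c \<theta> u v')))"
      by (rule sum.swap)
    also have "\<dots> = (\<Sum>v\<in>?T. \<Sum>\<theta>\<in>\<Theta>. \<Sum>v'\<in>?T. \<Sum>u\<in>?C. \<psi> v * cnj (\<psi> v') * (?c \<theta> u v * cnj (?c \<theta> u v')))"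
      by (intro sum.cong refl sum.swap)
    also have "\<dots> = (\<Sum>v\<in>?T. \<Sum>v'\<in>?T. \<Sum>\<theta>\<in>\<Theta>. \<Sum>u\<in>?C. \<psi> v * cnj (\<psi> v') * (?c \<theta> u v * cnj (?c \<theta> u v')))"
      by (intro sum.cong refl sum.swap)
    also have "\<dots> = (\<Sum>v\<in>?T. \<Sum>v'\<in>?T. \<psi> v * cnj (\<psi> v') * (if v' = v \<or> v' = v \<circ> ?\<tau> then of_real K else 0))"
      unfolding sum_distrib_left[symmetric] by (intro sum.cong refl) (simp add: pair)
    finally have eq: "complex_of_real (\<Sum>\<theta>\<in>\<Theta>. \<Sum>u\<in>?C. (cmod (tensor_apply t d (V \<theta>) \<xi> (u, b)))\<^sup>2) = \<dots>" .
    have nn: "(\<Sum>\<theta>\<in>\<Theta>. \<Sum>u\<in>?C. (cmod (tensor_apply t d (V \<theta>) \<xi> (u, b)))\<^sup>2) \<ge> 0"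
      by (intro sum_nonneg) auto
    have "(\<Sum>\<theta>\<in>\<Theta>. \<Sum>u\<in>?C. (cmod (tensor_apply t d (V \<theta>) \<xi> (u, b)))\<^sup>2)
       = cmod (\<Sum>v\<in>?T. \<Sum>v'\<in>?T. \<psi> v * cnj (\<psi> v') * (if v' = v \<or> v' = v \<circ> ?\<tau> then of_real K else 0))"
      unfolding eq[symmetric] norm_of_real using nn by simp
    \<comment> \<open>A tuple fixed by the transposition occurs in both summands on the right but
      only once on the left, which is harmless for an upper bound.\<close>
    also have "\<dots> \<le> (\<Sum>v\<in>?T. \<Sum>v'\<in>?T. (if v' = v then K * (cmod (\<psi> v))\<^sup>2 else 0) +
          (if v' = v \<circ> ?\<tau> then K * ((cmod (\<psi> v))\<^sup>2 + (cmod (\<psi> (v \<circ> ?\<tau>)))\<^sup>2) / 2 else 0))"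
    proof (intro order.trans[OF norm_sum] sum_mono)
      fix v v'
      have "cmod (\<psi> v) * cmod (\<psi> v') \<le> ((cmod (\<psi> v))\<^sup>2 + (cmod (\<psi> v'))\<^sup>2) / 2"
        using sum_squares_bound[of "cmod (\<psi> v)" "cmod (\<psi> v')"] by simp
      hence "K * (cmod (\<psi> v) * cmod (\<psi> v')) \<le> K * (((cmod (\<psi> v))\<^sup>2 + (cmod (\<psi> v'))\<^sup>2) / 2)"
        by (rule mult_left_mono[OF _ K])
      thus "cmod (\<psi> v * cnj (\<psi> v') * (if v' = v \<or> v' = v \<circ> ?\<tau> then of_real K else 0))
        \<le> (if v' = v then K * (cmod (\<psi> v))\<^sup>2 else 0) +
          (if v' = v \<circ> ?\<tau> then K * ((cmod (\<psi> v))\<^sup>2 + (cmod (\<psi> (v \<circ> ?\<tau>)))\<^sup>2) / 2 else 0)"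
        using K by (auto simp: norm_mult mult_ac power2_eq_square)
    qed
    also have "\<dots> = (\<Sum>v\<in>?T. K * (cmod (\<psi> v))\<^sup>2 + K * ((cmod (\<psi> v))\<^sup>2 + (cmod (\<psi> (v \<circ> ?\<tau>)))\<^sup>2) / 2)"
      by (intro sum.cong refl) (simp add: sum.distrib perm_comp_tuples[OF \<tau>])
    also have "\<dots> = K * (\<Sum>v\<in>?T. (cmod (\<psi> v))\<^sup>2) + K * ((\<Sum>v\<in>?T. (cmod (\<psi> v))\<^sup>2) + (\<Sum>v\<in>?T. (cmod (\<psi> (v \<circ> ?\<tau>)))\<^sup>2)) / 2"
      by (simp add: sum.distrib sum_distrib_left[symmetric] sum_divide_distrib[symmetric])
    also have "(\<Sum>v\<in>?T. (cmod (\<psi> (v \<circ> ?\<tau>)))\<^sup>2) = (\<Sum>v\<in>?T. (cmod (\<psi> v))\<^sup>2)"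
      by (rule sum.reindex_bij_betw[OF perm_comp_bij(1)[OF \<tau>]])
    finally show ?thesis by (simp add: \<psi>_def)
  qed
  have "(\<Sum>\<theta>\<in>\<Theta>. collision t d m i j (tensor_apply t d (V \<theta>) \<xi>))
      = (\<Sum>b<m. \<Sum>\<theta>\<in>\<Theta>. \<Sum>u\<in>?C. (cmod (tensor_apply t d (V \<theta>) \<xi> (u, b)))\<^sup>2)"
    unfolding collision_def by (rule sum.swap)
  also have "\<dots> \<le> (\<Sum>b<m. 2 * K * (\<Sum>v\<in>?T. (cmod (\<xi> (v, b)))\<^sup>2))" by (intro sum_mono sl)
  also have "\<dots> = 2 * K * (\<Sum>b<m. \<Sum>v\<in>?T. (cmod (\<xi> (v, b)))\<^sup>2)" by (simp add: sum_distrib_left)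
  also have "(\<Sum>b<m. \<Sum>v\<in>?T. (cmod (\<xi> (v, b)))\<^sup>2) = norm_sq (?T \<times> {..<m}) \<xi>"
    unfolding norm_sq_Times by (rule sum.swap)
  finally show ?thesis .
qed

context pf_twirl
begin

text \<open>Exhibits that \<open>\<phi>\<close> enters only through overlaps of a slice with a
  permuted slice, quantities that every R^(\<otimes>t) preserves.\<close>

lemma ideal_form_regroup: "ideal_form \<phi> = of_real (inverse (\<Prod>i<t. real d - real i)) *
   (\<Sum>y\<in>inj_tuples t d. \<Sum>\<sigma>\<in>perms t. \<Sum>b<m. \<Sum>b'<m. W (y \<circ> \<sigma>, b) (y, b') *
      (\<Sum>z\<in>tuples t d. cnj (\<phi> (z \<circ> \<sigma>, b)) * \<phi> (z, b')))"
proof -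
  let ?f = "\<lambda>z y \<sigma> b b'. cnj (\<phi> (z \<circ> \<sigma>, b)) * W (y \<circ> \<sigma>, b) (y, b') * \<phi> (z, b')"
  let ?T = "tuples t d" and ?E = "inj_tuples t d" and ?P = "perms t"
  have "(\<Sum>z\<in>?T. \<Sum>y\<in>?E. \<Sum>\<sigma>\<in>?P. \<Sum>b<m. \<Sum>b'<m. ?f z y \<sigma> b b')
     = (\<Sum>y\<in>?E. \<Sum>z\<in>?T. \<Sum>\<sigma>\<in>?P. \<Sum>b<m. \<Sum>b'<m. ?f z y \<sigma> b b')" by (rule sum.swap)
  also have "\<dots> = (\<Sum>y\<in>?E. \<Sum>\<sigma>\<in>?P. \<Sum>z\<in>?T. \<Sum>b<m. \<Sum>b'<m. ?f z y \<sigma> b b')"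
    by (intro sum.cong refl sum.swap)
  also have "\<dots> = (\<Sum>y\<in>?E. \<Sum>\<sigma>\<in>?P. \<Sum>b<m. \<Sum>z\<in>?T. \<Sum>b'<m. ?f z y \<sigma> b b')"
    by (intro sum.cong refl sum.swap)
  also have "\<dots> = (\<Sum>y\<in>?E. \<Sum>\<sigma>\<in>?P. \<Sum>b<m. \<Sum>b'<m. \<Sum>z\<in>?T. ?f z y \<sigma> b b')"
    by (intro sum.cong refl sum.swap)
  finally show ?thesis unfolding ideal_form_def by (simp add: sum_distrib_left mult_ac)
qed

lemma ideal_form_tensor_apply:
  assumes "unitary_fun d R"
  shows "ideal_form (tensor_apply t d R \<phi>) = ideal_form \<phi>"
proof -
  have "(\<Sum>z\<in>tuples t d. cnj (tensor_apply t d R \<phi> (z \<circ> \<sigma>, b)) * tensor_apply t d R \<phi> (z, b'))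
      = (\<Sum>z\<in>tuples t d. cnj (\<phi> (z \<circ> \<sigma>, b)) * \<phi> (z, b'))" if "\<sigma> \<in> perms t" for \<sigma> b b'
    by (simp only: tensor_apply_perm[OF that] tensor_apply_inner[OF assms] fst_conv snd_conv)
  thus ?thesis unfolding ideal_form_regroup by simp
qed

lemma \<delta>_nonneg: "\<delta> \<ge> 0"
proof -
  have "card (inj_tuples t d) \<noteq> 0"
    using card_inj_tuples[of t d] prod_falling_pos td by (metis add_leD1 mult_2 of_nat_0 less_irrefl)
  then obtain u where "u \<in> inj_tuples t d" by fastforce
  thus ?thesis using approx_twise_tuple_prob[OF D, of u u] by linarith
qed

text \<open>A crude entrywise estimate. Entries of \<open>W\<close> are at most 1 and there are at
  most d^t images \<open>v\<close>, giving \<delta> d^t for each coefficient. As the orbits are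
  free, the remaining sum is at most the squared l1-norm of \<open>\<phi>\<close>, which
  Cauchy-Schwarz bounds by the dimension d^t m times the squared norm.\<close>

lemma pf_average_ideal_bound:
  assumes supp: "\<And>p. fst p \<notin> inj_tuples t d \<Longrightarrow> \<phi> p = 0"
  shows "cmod (sesq I pf_average \<phi> \<phi> - ideal_form \<phi>) \<le> \<delta> * real (d ^ t) * real (d ^ t * m) * norm_sq I \<phi>"
proof -
  let ?T = "tuples t d" and ?E = "inj_tuples t d" and ?P = "perms t"
  define e where "e u v = measure_pmf.prob \<D> {\<pi>. tuple_map t \<pi> u = v} - inverse (\<Prod>i<t. real d - real i)" for u v
  let ?B = "\<delta> * real (d ^ t)"
  have B0: "?B \<ge> 0" using \<delta>_nonneg by simp
  have cE: "card ?E \<le> d ^ t" using card_mono[OF finite_tuples inj_tuples_subset] card_tuples by metis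
  have inner: "cmod (\<Sum>v\<in>?E. of_real (e u v) * W (v \<circ> \<sigma>, b) (v, b')) \<le> ?B"
    if "u \<in> ?E" "\<sigma> \<in> ?P" "b < m" "b' < m" for u \<sigma> b b'
  proof -
    have "cmod (\<Sum>v\<in>?E. of_real (e u v) * W (v \<circ> \<sigma>, b) (v, b')) \<le> (\<Sum>v\<in>?E. \<delta> * 1)"
    proof (intro order.trans[OF norm_sum] sum_mono)
      fix v assume v: "v \<in> ?E"
      hence vT: "v \<in> ?T" using inj_tuples_subset by blast
      have "cmod (W (v \<circ> \<sigma>, b) (v, b')) \<le> 1"
        using vT perm_comp_tuples[OF that(2) vT] that by (intro contraction_entry[OF W]) auto
      moreover have "\<bar>e u v\<bar> \<le> \<delta>" unfolding e_def by (rule approx_twise_tuple_prob[OF D that(1) v])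
      ultimately show "cmod (of_real (e u v) * W (v \<circ> \<sigma>, b) (v, b')) \<le> \<delta> * 1"
        unfolding norm_mult norm_of_real using \<delta>_nonneg by (intro mult_mono) auto
    qed
    also have "\<dots> = \<delta> * real (card ?E)" by (simp add: mult.commute)
    also have "\<dots> \<le> ?B" using cE by (intro mult_left_mono \<delta>_nonneg) (simp only: of_nat_le_iff)
    finally show ?thesis .
  qed
  have diff: "sesq I pf_average \<phi> \<phi> - ideal_form \<phi> =
    (\<Sum>u\<in>?E. \<Sum>\<sigma>\<in>?P. \<Sum>b<m. \<Sum>b'<m. cnj (\<phi> (u \<circ> \<sigma>, b)) *
       (\<Sum>v\<in>?E. of_real (e u v) * W (v \<circ> \<sigma>, b) (v, b')) * \<phi> (u, b'))"
    unfolding e_def by (rule pf_average_ideal_diff) (rule supp)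
  define a where "a u = (\<Sum>b<m. cmod (\<phi> (u, b)))" for u
  have a0: "a u \<ge> 0" for u unfolding a_def by (simp add: sum_nonneg)
  have "cmod (sesq I pf_average \<phi> \<phi> - ideal_form \<phi>)
     \<le> (\<Sum>u\<in>?E. \<Sum>\<sigma>\<in>?P. \<Sum>b<m. \<Sum>b'<m. cmod (\<phi> (u \<circ> \<sigma>, b)) * ?B * cmod (\<phi> (u, b')))"
    unfolding diff
    by (intro order.trans[OF norm_sum] sum_mono) (auto simp: norm_mult simp del: of_nat_power intro!: mult_mono mult_nonneg_nonneg inner B0)
  also have "\<dots> = ?B * (\<Sum>u\<in>?E. (\<Sum>\<sigma>\<in>?P. a (u \<circ> \<sigma>)) * a u)"
    unfolding a_def by (simp add: sum_distrib_left sum_distrib_right mult_ac)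
  also have "\<dots> \<le> ?B * (\<Sum>u\<in>?T. (\<Sum>w\<in>?T. a w) * a u)"
  proof (rule mult_left_mono[OF _ B0])
    have "(\<Sum>u\<in>?E. (\<Sum>\<sigma>\<in>?P. a (u \<circ> \<sigma>)) * a u) \<le> (\<Sum>u\<in>?E. (\<Sum>w\<in>?T. a w) * a u)"
    proof (intro sum_mono mult_right_mono a0)
      fix u assume "u \<in> ?E"
      hence "(\<Sum>\<sigma>\<in>?P. a (u \<circ> \<sigma>)) = (\<Sum>w\<in>{w \<in> ?E. w ` {..<t} = u ` {..<t}}. a w)"
        by (rule sum_same_image(1)[symmetric])
      also have "\<dots> \<le> (\<Sum>w\<in>?T. a w)" using inj_tuples_subset by (intro sum_mono2) (auto simp: a0)
      finally show "(\<Sum>\<sigma>\<in>?P. a (u \<circ> \<sigma>)) \<le> (\<Sum>w\<in>?T. a w)" .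
    qed
    also have "\<dots> \<le> (\<Sum>u\<in>?T. (\<Sum>w\<in>?T. a w) * a u)"
      using inj_tuples_subset by (intro sum_mono2) (auto simp: a0 sum_nonneg)
    finally show "(\<Sum>u\<in>?E. (\<Sum>\<sigma>\<in>?P. a (u \<circ> \<sigma>)) * a u) \<le> (\<Sum>u\<in>?T. (\<Sum>w\<in>?T. a w) * a u)" .
  qed
  also have "(\<Sum>u\<in>?T. (\<Sum>w\<in>?T. a w) * a u) = (\<Sum>p\<in>I. 1 * cmod (\<phi> p))\<^sup>2"
    unfolding a_def sum.cartesian_product' by (simp add: sum_distrib_left[symmetric] power2_eq_square)
  finally have "cmod (sesq I pf_average \<phi> \<phi> - ideal_form \<phi>) \<le> ?B * (\<Sum>p\<in>I. 1 * cmod (\<phi> p))\<^sup>2" .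
  also have "\<dots> \<le> ?B * ((\<Sum>p\<in>I. 1\<^sup>2) * (\<Sum>p\<in>I. (cmod (\<phi> p))\<^sup>2))"
    by (rule mult_left_mono[OF Cauchy_Schwarz_ineq_sum B0])
  finally show ?thesis
    by (simp add: card_tuples card_cartesian_product norm_sq_def mult.assoc)
qed

text \<open>Splitting the rotated vector into its parts on and off the distinct tuples gives four
  errors: the permutation error on the distinct part, two cross terms of size at most sqrt q, and
  the ideal form of the remainder, at most q.\<close>

lemma pf_average_tensor_apply:
  assumes R: "unitary_fun d R" and n: "norm_sq I \<phi> = 1" and s: "s > 0"
  defines "q \<equiv> norm_sq I (off_inj (tensor_apply t d R \<phi>))"
  shows "cmod (sesq I pf_average (tensor_apply t d R \<phi>) (tensor_apply t d R \<phi>) - ideal_form \<phi>)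
    \<le> (s + 1) * q + 1 / s + \<delta> * real (d ^ t) * real (d ^ t * m)"
proof -
  define \<phi>' where "\<phi>' = tensor_apply t d R \<phi>"
  have n': "norm_sq I \<phi>' = 1" using n norm_sq_tensor_apply[OF R] by (simp add: \<phi>'_def)
  have sp: "\<phi>' p = on_inj \<phi>' p + off_inj \<phi>' p" for p by (simp add: on_inj_def off_inj_def)
  have on1: "norm_sq I (on_inj \<phi>') \<le> 1"
    unfolding n'[symmetric] norm_sq_def on_inj_def by (intro sum_mono) auto
  note c = contractionD[OF contraction_pf_average]
  \<comment> \<open>Trades the square root for a bound linear in q, valid for every s > 0, so that q
    can later be integrated over R with s fixed.\<close>
  have sq: "2 * sqrt q \<le> s * q + 1 / s"
  proof -
    have "0 \<le> (sqrt s * sqrt q - 1 / sqrt s)\<^sup>2" by simp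
    also have "\<dots> = s * q - 2 * sqrt q + 1 / s"
      using s by (simp add: power2_diff power_mult_distrib power_divide q_def)
    finally show ?thesis by simp
  qed
  have "sesq I pf_average \<phi>' \<phi>' = sesq I pf_average \<phi>' (on_inj \<phi>') + sesq I pf_average \<phi>' (off_inj \<phi>')"
    by (subst sesq_add_right[symmetric]) (simp flip: sp)
  also have "sesq I pf_average \<phi>' (on_inj \<phi>') = sesq I pf_average (on_inj \<phi>') (on_inj \<phi>') + sesq I pf_average (off_inj \<phi>') (on_inj \<phi>')"
    by (subst sesq_add_left[symmetric]) (simp flip: sp)
  finally have e1: "sesq I pf_average \<phi>' \<phi>' - ideal_form \<phi> =
     (sesq I pf_average (on_inj \<phi>') (on_inj \<phi>') - ideal_form (on_inj \<phi>'))
     + sesq I pf_average (off_inj \<phi>') (on_inj \<phi>') + sesq I pf_average \<phi>' (off_inj \<phi>') - ideal_form (off_inj \<phi>')"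
    using ideal_form_split[of \<phi>'] ideal_form_tensor_apply[OF R, of \<phi>] by (simp add: \<phi>'_def)
  have b1: "cmod (sesq I pf_average (on_inj \<phi>') (on_inj \<phi>') - ideal_form (on_inj \<phi>')) \<le> \<delta> * real (d ^ t) * real (d ^ t * m)"
  proof -
    have "cmod (sesq I pf_average (on_inj \<phi>') (on_inj \<phi>') - ideal_form (on_inj \<phi>')) \<le> \<delta> * real (d ^ t) * real (d ^ t * m) * norm_sq I (on_inj \<phi>')"
      by (rule pf_average_ideal_bound) (simp add: on_inj_def)
    also have "\<dots> \<le> \<delta> * real (d ^ t) * real (d ^ t * m) * 1"
      using \<delta>_nonneg by (intro mult_left_mono on1) auto
    finally show ?thesis by simp
  qed
  have b2: "cmod (sesq I pf_average (off_inj \<phi>') (on_inj \<phi>')) \<le> sqrt q"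
  proof -
    have "cmod (sesq I pf_average (off_inj \<phi>') (on_inj \<phi>')) \<le> sqrt q * sqrt (norm_sq I (on_inj \<phi>'))"
      using c[of "off_inj \<phi>'" "on_inj \<phi>'"] by (simp add: q_def \<phi>'_def)
    also have "\<dots> \<le> sqrt q * 1" using on1 by (intro mult_left_mono) (auto simp: q_def)
    finally show ?thesis by simp
  qed
  have b3: "cmod (sesq I pf_average \<phi>' (off_inj \<phi>')) \<le> sqrt q"
    using c[of \<phi>' "off_inj \<phi>'"] n' by (simp add: q_def \<phi>'_def)
  have b4: "cmod (ideal_form (off_inj \<phi>')) \<le> q"
    using ideal_form_bound[of "off_inj \<phi>'"] by (simp add: q_def \<phi>'_def)
  have "cmod (sesq I pf_average \<phi>' \<phi>' - ideal_form \<phi>) \<le>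
     cmod (sesq I pf_average (on_inj \<phi>') (on_inj \<phi>') - ideal_form (on_inj \<phi>'))
     + cmod (sesq I pf_average (off_inj \<phi>') (on_inj \<phi>')) + cmod (sesq I pf_average \<phi>' (off_inj \<phi>')) + cmod (ideal_form (off_inj \<phi>'))"
  proof -
    have "cmod (a + b + x - y) \<le> cmod a + cmod b + cmod x + cmod y" for a b x y
      using norm_triangle_ineq4[of "a + b + x" y] norm_triangle_ineq[of "a + b" x] norm_triangle_ineq[of a b] by linarith
    thus ?thesis unfolding e1 .
  qed
  also have "\<dots> \<le> (s + 1) * q + 1 / s + \<delta> * real (d ^ t) * real (d ^ t * m)"
    using b1 b2 b3 b4 sq by (simp add: algebra_simps)
  finally show ?thesis by (simp add: \<phi>'_def)
qed

text \<open>Union bound: a tuple that is not distinct has a collision at some ordered pair of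
  positions.\<close>

lemma off_inj_collision:
  "norm_sq I (off_inj \<phi>) \<le> (\<Sum>(i, j)\<in>{(i, j). i < t \<and> j < t \<and> i \<noteq> j}. collision t d m i j \<phi>)"
proof -
  let ?Q = "{(i, j). i < t \<and> j < t \<and> i \<noteq> j}" and ?T = "tuples t d"
  have fQ: "finite ?Q" by (rule finite_subset[of _ "{..<t} \<times> {..<t}"]) auto
  have "norm_sq I (off_inj \<phi>) = (\<Sum>b<m. \<Sum>u\<in>?T. (cmod (off_inj \<phi> (u, b)))\<^sup>2)"
    unfolding norm_sq_Times by (rule sum.swap)
  also have "\<dots> \<le> (\<Sum>b<m. \<Sum>u\<in>?T. \<Sum>(i, j)\<in>?Q. if u i = u j then (cmod (\<phi> (u, b)))\<^sup>2 else 0)"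
  proof (intro sum_mono)
    fix b u assume u: "u \<in> ?T"
    show "(cmod (off_inj \<phi> (u, b)))\<^sup>2 \<le> (\<Sum>(i, j)\<in>?Q. if u i = u j then (cmod (\<phi> (u, b)))\<^sup>2 else 0)"
    proof (cases "u \<in> inj_tuples t d")
      case True
      thus ?thesis by (auto simp: off_inj_def intro!: sum_nonneg)
    next
      case False
      then obtain i j where ij: "(i, j) \<in> ?Q" "u i = u j" using u by (auto simp: inj_tuples_def inj_on_def)
      have "(cmod (off_inj \<phi> (u, b)))\<^sup>2 = (case (i, j) of (i, j) \<Rightarrow> if u i = u j then (cmod (\<phi> (u, b)))\<^sup>2 else 0)"
        using False ij by (simp add: off_inj_def)
      also have "\<dots> \<le> (\<Sum>(i, j)\<in>?Q. if u i = u j then (cmod (\<phi> (u, b)))\<^sup>2 else 0)"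
        by (rule member_le_sum[OF ij(1)]) (auto simp: fQ split: if_splits)
      finally show ?thesis .
    qed
  qed
  also have "\<dots> = (\<Sum>b<m. \<Sum>(i, j)\<in>?Q. \<Sum>u\<in>?T. if u i = u j then (cmod (\<phi> (u, b)))\<^sup>2 else 0)"
    unfolding case_prod_beta by (intro sum.cong refl sum.swap)
  also have "\<dots> = (\<Sum>(i, j)\<in>?Q. \<Sum>b<m. \<Sum>u\<in>?T. if u i = u j then (cmod (\<phi> (u, b)))\<^sup>2 else 0)"
    unfolding case_prod_beta by (rule sum.swap)
  also have "\<dots> = (\<Sum>(i, j)\<in>?Q. collision t d m i j \<phi>)"
    unfolding collision_def by (simp add: sum.inter_filter)
  finally show ?thesis .
qed

end


section \<open>Collisions after a random Clifford\<close>

text \<open>Identifies numbers below d^t with tuples; position 0 holds the least significant digit,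
  in accordance with \<open>tensor_power_index\<close>.\<close>

definition digits :: "nat \<Rightarrow> nat \<Rightarrow> nat \<Rightarrow> nat \<Rightarrow> nat" where
  "digits t d i = (\<lambda>k\<in>{..<t}. i div d ^ k mod d)"

lemma digits_inj:
  fixes i j d :: nat
  shows "i < d ^ t \<Longrightarrow> j < d ^ t \<Longrightarrow> (\<And>k. k < t \<Longrightarrow> i div d ^ k mod d = j div d ^ k mod d) \<Longrightarrow> i = j"
proof (induction t arbitrary: i j)
  case (Suc t)
  have ij: "i < d * d ^ t" "j < d * d ^ t" using Suc.prems by auto
  have "(i mod d ^ t) div d ^ k mod d = (j mod d ^ t) div d ^ k mod d" if "k < t" for k
    using Suc.prems(3)[of k] that by (simp add: mod_power_div_mod)
  hence "i mod d ^ t = j mod d ^ t"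
    by (rule Suc.IH[OF mod_less_of_less_mult[OF ij(1)] mod_less_of_less_mult[OF ij(2)]])
  moreover have "i div d ^ t = j div d ^ t"
    using Suc.prems(3)[of t] ij by (simp add: less_mult_imp_div_less)
  ultimately show ?case by (metis div_mult_mod_eq)
qed auto

lemma digits_bij:
  assumes "d > 0"
  shows "bij_betw (digits t d) {..<d ^ t} (tuples t d)"
proof -
  have inj: "inj_on (digits t d) {..<d ^ t}"
  proof (rule inj_onI)
    fix i j assume ij: "i \<in> {..<d ^ t}" "j \<in> {..<d ^ t}" "digits t d i = digits t d j"
    have "i div d ^ k mod d = j div d ^ k mod d" if "k < t" for k
      using fun_cong[OF ij(3), of k] that by (simp add: digits_def)
    thus "i = j" using ij by (intro digits_inj[of i d t j]) auto
  qed
  have "digits t d ` {..<d ^ t} \<subseteq> tuples t d"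
    using assms unfolding digits_def tuples_def by (auto intro!: restrict_PiE_iff[THEN iffD2])
  moreover have "card (digits t d ` {..<d ^ t}) = card (tuples t d)"
    using card_image[OF inj] by (simp add: card_tuples)
  ultimately have "digits t d ` {..<d ^ t} = tuples t d" by (rule card_subset_eq[OF finite_tuples])
  thus ?thesis using inj by (simp add: bij_betw_def)
qed

lemma sum_prod_digits:
  fixes d :: nat
  assumes "d > 0"
  shows "(\<Sum>w<d ^ t. \<Prod>k<t. f k (w div d ^ k mod d)) = (\<Prod>k<t. \<Sum>x<d. f k x :: complex)"
proof -
  have "(\<Sum>w<d ^ t. \<Prod>k<t. f k (w div d ^ k mod d)) = (\<Sum>w<d ^ t. \<Prod>k<t. f k (digits t d w k))"
    by (simp add: digits_def)
  also have "\<dots> = (\<Sum>u\<in>tuples t d. \<Prod>k<t. f k (u k))"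
    by (rule sum.reindex_bij_betw[OF digits_bij[OF assms]])
  finally show ?thesis by (simp add: sum_tuples_prod)
qed

lemma hadamard1_index:
  assumes "a < 2" "b < 2"
  shows "hadamard1 $$ (a, b) = (1 / of_real (sqrt 2)) * (- 1) ^ (a * b)"
proof -
  have "a = 0 \<or> a = Suc 0" "b = 0 \<or> b = Suc 0" using assms by auto
  thus ?thesis by (auto simp: hadamard1_def)
qed

text \<open>For numbers below 2^n it says that the four bit vectors sum to zero over the field with
  two elements.\<close>

abbreviation "balanced_bits n x y x' y' \<equiv>
  (\<forall>k<n. even (x div 2 ^ k + y div 2 ^ k + x' div 2 ^ k + y' div 2 ^ k :: nat))"

text \<open>The sum over \<open>w\<close> factorises over qubits. One qubit gives 1/4 times 1 +
  (-1)^(sum of the four bits), that is 1/2 or 0.\<close>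

lemma hadamard_fourth_moment:
  assumes "x < 2 ^ n" "y < 2 ^ n" "x' < 2 ^ n" "y' < 2 ^ n"
  shows "(\<Sum>w<2 ^ n. hadamard n $$ (w, x) * hadamard n $$ (w, y) * cnj (hadamard n $$ (w, x')) * cnj (hadamard n $$ (w, y')))
    = (if balanced_bits n x y x' y' then 1 / 2 ^ n else 0)"
proof -
  let ?b = "\<lambda>x k. x div 2 ^ k mod 2 :: nat"
  define s where "s = 1 / complex_of_real (sqrt 2)"
  have s: "s * s = 1 / 2" "cnj s = s" using sqrt2_inverse_square by (simp_all add: s_def)
  define F where "F k c = s * (- 1) ^ (c * ?b x k) * (s * (- 1) ^ (c * ?b y k)) * (s * (- 1) ^ (c * ?b x' k)) * (s * (- 1) ^ (c * ?b y' k))" for k c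
  have h: "hadamard n $$ (w, z) = (\<Prod>k<n. s * (- 1) ^ (?b w k * ?b z k))" if "w < 2 ^ n" "z < 2 ^ n" for w z
    using that by (simp add: tensor_power_index[OF hadamard1_carrier] hadamard1_index s_def)
  have "(\<Sum>w<2 ^ n. hadamard n $$ (w, x) * hadamard n $$ (w, y) * cnj (hadamard n $$ (w, x')) * cnj (hadamard n $$ (w, y')))
      = (\<Sum>w<2 ^ n. \<Prod>k<n. F k (?b w k))"
    using assms by (intro sum.cong refl) (simp add: h F_def prod.distrib s)
  also have "\<dots> = (\<Prod>k<n. \<Sum>c<2. F k c)" by (rule sum_prod_digits) simp
  also have "\<dots> = (\<Prod>k<n. (1 / 2) * (if even (x div 2 ^ k + y div 2 ^ k + x' div 2 ^ k + y' div 2 ^ k) then 1 else 0))"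
  proof (intro prod.cong refl)
    fix k
    have "F k c = (s * s) * (s * s) * (- 1) ^ (c * (?b x k + ?b y k + ?b x' k + ?b y' k))" for c
      by (simp add: F_def power_add algebra_simps)
    hence "(\<Sum>c<2. F k c) = (1 / 4) * (1 + (- 1) ^ (?b x k + ?b y k + ?b x' k + ?b y' k))"
      by (simp add: s numeral_2_eq_2)
    also have "even (?b x k + ?b y k + ?b x' k + ?b y' k) = even (x div 2 ^ k + y div 2 ^ k + x' div 2 ^ k + y' div 2 ^ k)"
      by simp
    hence "(1 / 4) * (1 + (- 1) ^ (?b x k + ?b y k + ?b x' k + ?b y' k))
      = (1 / 2) * (if even (x div 2 ^ k + y div 2 ^ k + x' div 2 ^ k + y' div 2 ^ k) then 1 else 0 :: complex)"
      by (simp add: minus_one_power_iff)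
    finally show "(\<Sum>c<2. F k c) = (1 / 2) * (if even (x div 2 ^ k + y div 2 ^ k + x' div 2 ^ k + y' div 2 ^ k) then 1 else 0)" .
  qed
  also have "\<dots> = (1 / 2) ^ n * (if balanced_bits n x y x' y' then 1 else 0)"
    unfolding prod.distrib by (subst prod_delta) (auto simp: prod_constant)
  finally show ?thesis by (simp add: power_one_over)
qed

section \<open>Diagonal Clifford phases\<close>

lemma z_sign_balanced:
  assumes "balanced_bits n x y x' y'"
  shows "z_sign n S x * z_sign n S y * z_sign n S x' * z_sign n S y' = 1"
  unfolding z_sign_def prod.distrib[symmetric] using assms by (intro prod.neutral) auto

lemma z_sign_singleton: "k < n \<Longrightarrow> z_sign n {k} x = (if odd (x div 2 ^ k) then - 1 else 1)"
proof -
  assume k: "k < n"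
  have "z_sign n {k} x = (\<Prod>l<n. if l = k then if odd (x div 2 ^ k) then - 1 else 1 else 1)"
    unfolding z_sign_def by (intro prod.cong) auto
  thus ?thesis using k by (simp add: prod.delta)
qed

lemma z_sign_insert:
  assumes "k \<notin> S"
  shows "z_sign n (insert k S) x = z_sign n {k} x * z_sign n S x"
  unfolding z_sign_def prod.distrib[symmetric] using assms by (intro prod.cong) auto

text \<open>
  Some \<open>half_phase\<close> distinguishes \<open>{x, y}\<close> from \<open>{x', y'}\<close>: take a linear form that vanishes on
  \<open>x + y\<close> but not on \<open>x + x'\<close>.
\<close>

lemma half_phase_separates:
  assumes b: "balanced_bits n x y x' y'" and lt: "x < 2 ^ n" "y < 2 ^ n" "x' < 2 ^ n" "y' < 2 ^ n"
    and ne: "\<not> (x' = x \<and> y' = y \<or> x' = y \<and> y' = x)"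
  obtains S where "half_phase n S x * half_phase n S y * cnj (half_phase n S x') * cnj (half_phase n S y') \<noteq> 1"
proof -
  have eqI: "a = c" if "a < 2 ^ n" "c < 2 ^ n" "\<And>k. k < n \<Longrightarrow> odd (a div 2 ^ k) = odd (c div 2 ^ k)" for a c :: nat
    using that(1,2) by (rule digits_inj) (use that(3) in \<open>metis odd_iff_mod_2_eq_one even_iff_mod_2_eq_zero\<close>)
  \<comment> \<open>Balance determines \<open>y'\<close> as the bitwise sum of the other three, so
    the two pairs coincide as soon as \<open>x'\<close> equals \<open>x\<close> or
    \<open>y\<close>.\<close>
  have bb: "odd (y' div 2 ^ k) = (odd (x div 2 ^ k) \<noteq> (odd (y div 2 ^ k) \<noteq> odd (x' div 2 ^ k)))" if "k < n" for k
    using b that by auto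
  have "x' \<noteq> x" using ne eqI[OF lt(4) lt(2)] bb by blast
  then obtain k where k: "k < n" "odd (x' div 2 ^ k) \<noteq> odd (x div 2 ^ k)" using eqI[OF lt(3) lt(1)] by blast
  have "x' \<noteq> y" using ne eqI[OF lt(4) lt(1)] bb by blast
  then obtain l where l: "l < n" "odd (x' div 2 ^ l) \<noteq> odd (y div 2 ^ l)" using eqI[OF lt(3) lt(2)] by blast
  have "\<exists>S. z_sign n S y = z_sign n S x \<and> z_sign n S x' = - z_sign n S x"
  \<comment> \<open>One bit suffices if some position separates \<open>x'\<close> from
    \<open>x\<close> but not \<open>y\<close> from \<open>x\<close>. Otherwise position
    \<open>k\<close> separates both from \<open>x\<close>, position \<open>l\<close> separates
    \<open>y\<close> but not \<open>x'\<close> from \<open>x\<close>, and the parity of the two bits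
    works.\<close>
  proof (cases "\<exists>j<n. odd (x' div 2 ^ j) \<noteq> odd (x div 2 ^ j) \<and> odd (y div 2 ^ j) = odd (x div 2 ^ j)")
    case True
    then obtain j where "j < n" "odd (x' div 2 ^ j) \<noteq> odd (x div 2 ^ j)" "odd (y div 2 ^ j) = odd (x div 2 ^ j)" by blast
    thus ?thesis by (intro exI[of _ "{j}"]) (auto simp: z_sign_singleton)
  next
    case False
    hence "odd (y div 2 ^ k) \<noteq> odd (x div 2 ^ k)" using k by blast
    moreover have "odd (x' div 2 ^ l) = odd (x div 2 ^ l)" using False l by blast
    moreover from this have "odd (y div 2 ^ l) \<noteq> odd (x div 2 ^ l)" using l by blast
    moreover have "k \<noteq> l" using k calculation by blast
    moreover from this have "z_sign n {k, l} z = z_sign n {k} z * z_sign n {l} z" for z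
      using z_sign_insert[of k "{l}"] by simp
    ultimately show ?thesis using k l
      by (intro exI[of _ "{k, l}"]) (auto simp: z_sign_singleton)
  qed
  then obtain S where S: "z_sign n S y = z_sign n S x" "z_sign n S x' = - z_sign n S x" by blast
  have v: "z_sign n S x = 1 \<or> z_sign n S x = - 1" using z_sign_values[of n S x] by blast
  hence "z_sign n S y' = - z_sign n S x" using z_sign_balanced[OF b, of S] z_sign_values[of n S y'] S by auto
  \<comment> \<open>Characters multiply to 1 on a balanced quadruple, but their square roots need
    not: \<open>x\<close> and \<open>y\<close> carry one sign and \<open>x'\<close> and
    \<open>y'\<close> the other, so one pair contributes 1 and the other the square of \<i> or of
    its conjugate.\<close>
  hence "half_phase n S x * half_phase n S y * cnj (half_phase n S x') * cnj (half_phase n S y') = - 1"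
    using v S by (auto simp: half_phase_def)
  thus thesis by (intro that[of S]) simp
qed

text \<open>Diagonal Cliffords with entries among the fourth roots of unity. They form a finite set
  closed under products that contains all the half phases, so sums over it can be shifted by an
  element.\<close>

definition clifford_phases :: "nat \<Rightarrow> (nat \<Rightarrow> complex) set" where
  "clifford_phases n = {\<theta> \<in> {..<2 ^ n} \<rightarrow>\<^sub>E phases. diag_of (2 ^ n) \<theta> \<in> pauli_normalizer n}"

lemma finite_clifford_phases: "finite (clifford_phases n)"
  by (rule finite_subset[of _ "{..<2 ^ n} \<rightarrow>\<^sub>E phases"]) (auto simp: clifford_phases_def phases_def intro!: finite_PiE)

lemma half_phase_clifford: "restrict (half_phase n S) {..<2 ^ n} \<in> clifford_phases n"
proof -
  have "diag_of (2 ^ n) (restrict (half_phase n S) {..<2 ^ n}) = diag_of (2 ^ n) (half_phase n S)"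
    by (rule diag_of_cong) simp
  thus ?thesis using half_phase_normalizer[of n S]
    by (auto simp: clifford_phases_def half_phase_def phases_def)
qed

lemma clifford_phases_mult:
  assumes "\<theta> \<in> clifford_phases n" "\<eta> \<in> clifford_phases n"
  shows "(\<lambda>x\<in>{..<2 ^ n}. \<theta> x * \<eta> x) \<in> clifford_phases n"
proof -
  have "diag_of (2 ^ n) (\<lambda>x\<in>{..<2 ^ n}. \<theta> x * \<eta> x) = diag_of (2 ^ n) \<theta> * diag_of (2 ^ n) \<eta>"
    unfolding diag_of_mult by (rule diag_of_cong) simp
  thus ?thesis using assms pauli_normalizer_mult[of "diag_of (2 ^ n) \<theta>" n "diag_of (2 ^ n) \<eta>"]
    by (auto simp: clifford_phases_def intro!: phases_mult)
qed

text \<open>Shifting the sum by a half phase that separates the two pairs multiplies it by a factor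
  different from 1, so it vanishes. If the pairs coincide, every phase cancels against its
  conjugate.\<close>

lemma clifford_phases_fourth_moment:
  assumes b: "balanced_bits n x y x' y'" and lt: "x < 2 ^ n" "y < 2 ^ n" "x' < 2 ^ n" "y' < 2 ^ n"
  shows "(\<Sum>\<theta>\<in>clifford_phases n. \<theta> x * \<theta> y * cnj (\<theta> x') * cnj (\<theta> y'))
    = (if x' = x \<and> y' = y \<or> x' = y \<and> y' = x then of_nat (card (clifford_phases n)) else 0)"
proof (cases "x' = x \<and> y' = y \<or> x' = y \<and> y' = x")
  case True
  have "\<theta> x * \<theta> y * cnj (\<theta> x') * cnj (\<theta> y') = 1" if "\<theta> \<in> clifford_phases n" for \<theta>
  proof -
    have "\<theta> x * cnj (\<theta> x) = 1" "\<theta> y * cnj (\<theta> y) = 1"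
      using that lt by (auto simp: clifford_phases_def PiE_iff intro!: phases_cnj)
    moreover have "\<theta> x * \<theta> y * cnj (\<theta> x') * cnj (\<theta> y') = (\<theta> x * cnj (\<theta> x)) * (\<theta> y * cnj (\<theta> y))"
      using True by auto
    ultimately show ?thesis by simp
  qed
  thus ?thesis using True by simp
next
  case False
  obtain S where S: "half_phase n S x * half_phase n S y * cnj (half_phase n S x') * cnj (half_phase n S y') \<noteq> 1"
    using half_phase_separates[OF b lt False] by blast
  define \<eta> where "\<eta> = restrict (half_phase n S) {..<2 ^ n}"
  have \<eta>: "\<eta> \<in> clifford_phases n" unfolding \<eta>_def by (rule half_phase_clifford)
  have \<eta>1: "\<eta> x * \<eta> y * cnj (\<eta> x') * cnj (\<eta> y') \<noteq> 1" using S lt by (simp add: \<eta>_def)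
  have \<eta>0: "\<eta> z \<noteq> 0" if "z < 2 ^ n" for z using that by (simp add: \<eta>_def half_phase_def)
  let ?m = "\<lambda>\<theta>. \<lambda>z\<in>{..<2 ^ n}. \<eta> z * \<theta> z" and ?c = "\<lambda>\<theta>. \<theta> x * \<theta> y * cnj (\<theta> x') * cnj (\<theta> y') :: complex"
  have "inj_on ?m (clifford_phases n)"
  proof (rule inj_onI)
    fix \<theta> \<theta>' assume t: "\<theta> \<in> clifford_phases n" "\<theta>' \<in> clifford_phases n" "?m \<theta> = ?m \<theta>'"
    have "\<theta> z = \<theta>' z" if "z \<in> {..<2 ^ n}" for z
      using fun_cong[OF t(3), of z] \<eta>0[of z] that by simp
    thus "\<theta> = \<theta>'" using t(1,2) by (intro PiE_ext[of \<theta> "{..<2 ^ n}" "\<lambda>_. phases" \<theta>']) (auto simp: clifford_phases_def)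
  qed
  moreover from this have "?m ` clifford_phases n = clifford_phases n"
    using clifford_phases_mult[OF \<eta>] by (intro endo_inj_surj finite_clifford_phases) auto
  ultimately have "bij_betw ?m (clifford_phases n) (clifford_phases n)" by (simp add: bij_betw_def)
  hence "(\<Sum>\<theta>\<in>clifford_phases n. ?c \<theta>) = (\<Sum>\<theta>\<in>clifford_phases n. ?c (?m \<theta>))"
    by (rule sum.reindex_bij_betw[symmetric])
  also have "\<dots> = ?c \<eta> * (\<Sum>\<theta>\<in>clifford_phases n. ?c \<theta>)"
    using lt by (simp add: sum_distrib_left mult_ac)
  finally have "(\<Sum>\<theta>\<in>clifford_phases n. ?c \<theta>) = 0" using \<eta>1 by simp
  thus ?thesis unfolding if_not_P[OF False] .
qed

definition mixing_clifford :: "nat \<Rightarrow> (nat \<Rightarrow> complex) \<Rightarrow> complex mat" where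
  "mixing_clifford n \<theta> = hadamard n * diag_of (2 ^ n) \<theta>"

lemma mixing_clifford_normalizer: "\<theta> \<in> clifford_phases n \<Longrightarrow> mixing_clifford n \<theta> \<in> pauli_normalizer n"
  unfolding mixing_clifford_def clifford_phases_def
  by (intro pauli_normalizer_mult hadamard_normalizer) auto

abbreviation entries :: "complex mat \<Rightarrow> nat \<Rightarrow> nat \<Rightarrow> complex" where
  "entries U i j \<equiv> U $$ (i, j)"

lemma unitary_fun_entries:
  assumes "U \<in> unitary_group d"
  shows "unitary_fun d (entries U)"
  unfolding unitary_fun_def
proof (intro allI impI)
  fix x y assume xy: "x < d" "y < d"
  note u = unitary_groupD[OF assms]
  have "(mat_adjoint U * U) $$ (x, y) = (\<Sum>w<d. cnj (U $$ (w, x)) * U $$ (w, y))"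
    using u(1) xy by (subst index_mult_mat_sum) auto
  thus "(\<Sum>w<d. cnj (U $$ (w, x)) * U $$ (w, y)) = (if x = y then 1 else 0)"
    using u(2) xy by simp
qed

text \<open>The summand separates into a function of the phases and one of \<open>w\<close>. The
  Hadamard sum enforces balance, and on balanced quadruples the phase sum leaves only the two
  pairings.\<close>

lemma mixing_clifford_fourth_moment:
  assumes lt: "x < 2 ^ n" "y < 2 ^ n" "x' < 2 ^ n" "y' < 2 ^ n"
  shows "(\<Sum>\<theta>\<in>clifford_phases n. \<Sum>w<2 ^ n. entries (mixing_clifford n \<theta>) w x * entries (mixing_clifford n \<theta>) w y *
      cnj (entries (mixing_clifford n \<theta>) w x') * cnj (entries (mixing_clifford n \<theta>) w y'))
    = (if x' = x \<and> y' = y \<or> x' = y \<and> y' = x then of_real (real (card (clifford_phases n)) / 2 ^ n) else 0)"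
proof -
  have e: "entries (mixing_clifford n \<theta>) w z = hadamard n $$ (w, z) * \<theta> z" if "w < 2 ^ n" "z < 2 ^ n" for \<theta> w z
  proof -
    have "hadamard n \<in> carrier_mat (2 ^ n) (2 ^ n)" by simp
    thus ?thesis using that unfolding mixing_clifford_def by (subst diag_of_mult_right) auto
  qed
  let ?c = "\<lambda>\<theta>. \<theta> x * \<theta> y * cnj (\<theta> x') * cnj (\<theta> y') :: complex"
  let ?h = "\<lambda>w. hadamard n $$ (w, x) * hadamard n $$ (w, y) * cnj (hadamard n $$ (w, x')) * cnj (hadamard n $$ (w, y'))"
  have "(\<Sum>\<theta>\<in>clifford_phases n. \<Sum>w<2 ^ n. entries (mixing_clifford n \<theta>) w x * entries (mixing_clifford n \<theta>) w y *
      cnj (entries (mixing_clifford n \<theta>) w x') * cnj (entries (mixing_clifford n \<theta>) w y'))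
    = (\<Sum>\<theta>\<in>clifford_phases n. \<Sum>w<2 ^ n. ?c \<theta> * ?h w)"
    using lt by (intro sum.cong refl) (simp add: e)
  also have "\<dots> = (\<Sum>\<theta>\<in>clifford_phases n. ?c \<theta>) * (\<Sum>w<2 ^ n. ?h w)"
    by (rule sum_product[symmetric])
  also have "\<dots> = (if x' = x \<and> y' = y \<or> x' = y \<and> y' = x then of_real (real (card (clifford_phases n)) / 2 ^ n) else 0)"
  proof (cases "balanced_bits n x y x' y'")
    case True
    show ?thesis
      unfolding hadamard_fourth_moment[OF lt] clifford_phases_fourth_moment[OF True lt] using True by simp
  next
    case False
    hence ne: "\<not> (x' = x \<and> y' = y \<or> x' = y \<and> y' = x)" by auto
    show ?thesis unfolding hadamard_fourth_moment[OF lt] if_not_P[OF False] if_not_P[OF ne] by simp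
  qed
  finally show ?thesis .
qed


section \<open>Moment operators as quadratic forms\<close>

definition bipartite_index :: "nat \<Rightarrow> nat \<Rightarrow> nat \<Rightarrow> (nat \<Rightarrow> nat) \<times> nat" where
  "bipartite_index t d i = (digits t d (i div d ^ t), i mod d ^ t)"

abbreviation "bipartite t d \<equiv> tuples t d \<times> {..<d ^ t}"

lemma bipartite_index_bij:
  assumes d: "d > 0"
  shows "bij_betw (bipartite_index t d) {..<d ^ t * d ^ t} (bipartite t d)"
proof -
  let ?D = "d ^ t"
  note b = digits_bij[OF d, of t]
  have inj: "inj_on (bipartite_index t d) {..<?D * ?D}"
  proof (rule inj_onI)
    fix i j assume ij: "i \<in> {..<?D * ?D}" "j \<in> {..<?D * ?D}" "bipartite_index t d i = bipartite_index t d j"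
    hence "digits t d (i div ?D) = digits t d (j div ?D)" "i mod ?D = j mod ?D" by (simp_all add: bipartite_index_def)
    moreover from this have "i div ?D = j div ?D"
      using inj_onD[OF bij_betw_imp_inj_on[OF b]] ij by (simp add: less_mult_imp_div_less)
    ultimately show "i = j" by (metis div_mult_mod_eq)
  qed
  have "bipartite_index t d ` {..<?D * ?D} \<subseteq> bipartite t d"
    using bij_betw_apply[OF b] d by (auto simp: bipartite_index_def less_mult_imp_div_less)
  moreover have "card (bipartite_index t d ` {..<?D * ?D}) = card (bipartite t d)"
    using card_image[OF inj] by (simp add: card_tuples card_cartesian_product)
  ultimately have "bipartite_index t d ` {..<?D * ?D} = bipartite t d"
    by (intro card_subset_eq) auto
  thus ?thesis using inj by (simp add: bij_betw_def)
qed

definition bipartite_fun :: "nat \<Rightarrow> nat \<Rightarrow> complex Matrix.vec \<Rightarrow> (nat \<Rightarrow> nat) \<times> nat \<Rightarrow> complex" where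
  "bipartite_fun t d \<psi> p = vec_index \<psi> (the_inv_into {..<d ^ t * d ^ t} (bipartite_index t d) p)"

lemma bipartite_fun_index:
  assumes "d > 0" "i < d ^ t * d ^ t"
  shows "bipartite_fun t d \<psi> (bipartite_index t d i) = vec_index \<psi> i"
  using assms bij_betw_imp_inj_on[OF bipartite_index_bij[OF assms(1), of t]]
  by (simp add: bipartite_fun_def the_inv_into_f_f)

lemma norm_sq_bipartite_fun:
  assumes "d > 0" "\<psi> \<in> carrier_vec (d ^ t * d ^ t)" "\<psi> \<bullet>c \<psi> = 1"
  shows "norm_sq (bipartite t d) (bipartite_fun t d \<psi>) = 1"
proof -
  have "complex_of_real (norm_sq (bipartite t d) (bipartite_fun t d \<psi>))
     = of_real (\<Sum>i<d ^ t * d ^ t. (cmod (bipartite_fun t d \<psi> (bipartite_index t d i)))\<^sup>2)"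
    unfolding norm_sq_def by (subst sum.reindex_bij_betw[OF bipartite_index_bij[OF assms(1)]]) (rule refl)
  also have "\<dots> = (\<Sum>i<d ^ t * d ^ t. vec_index \<psi> i * cnj (vec_index \<psi> i))"
    using assms(1) by (simp add: bipartite_fun_index complex_norm_square del: of_real_power)
  also have "\<dots> = \<psi> \<bullet>c \<psi>"
    using assms(2) by (auto simp: scalar_prod_def atLeast0LessThan intro!: sum.cong)
  finally show ?thesis using assms(3) by (metis of_real_eq_1_iff)
qed

text \<open>Conjugation of the rank-one operator |f><g| by A gives |Af><Ag|.\<close>

lemma index_conj_mult:
  fixes A X :: "complex mat"
  assumes A: "A \<in> carrier_mat n n" and ij: "i < n" "j < n"
  shows "(A * Matrix.mat n n (\<lambda>(a, b). f a * cnj (g b)) * mat_adjoint A) $$ (i, j)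
    = (\<Sum>a<n. A $$ (i, a) * f a) * cnj (\<Sum>b<n. A $$ (j, b) * g b)"
proof -
  let ?X = "Matrix.mat n n (\<lambda>(a, b). f a * cnj (g b))"
  have "(A * ?X * mat_adjoint A) $$ (i, j) = (\<Sum>b<n. (\<Sum>a<n. A $$ (i, a) * (f a * cnj (g b))) * cnj (A $$ (j, b)))"
    using A ij by (subst index_mult_mat_sum) (auto simp: index_mult_mat_sum simp del: index_mult_mat(1) intro!: sum.cong)
  also have "\<dots> = (\<Sum>b<n. (\<Sum>a<n. A $$ (i, a) * f a) * cnj (A $$ (j, b) * g b))"
  proof (intro sum.cong refl)
    fix b
    have "(\<Sum>a<n. A $$ (i, a) * (f a * cnj (g b))) = (\<Sum>a<n. A $$ (i, a) * f a) * cnj (g b)"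
      by (simp add: sum_distrib_right mult.assoc)
    thus "(\<Sum>a<n. A $$ (i, a) * (f a * cnj (g b))) * cnj (A $$ (j, b)) = (\<Sum>a<n. A $$ (i, a) * f a) * cnj (A $$ (j, b) * g b)"
      by simp
  qed
  finally show ?thesis by (simp add: sum_distrib_left)
qed

lemma tensor_power_apply:
  assumes d: "d > 0" and R: "R \<in> carrier_mat d d" and i: "i < d ^ t * d ^ t"
  shows "(\<Sum>a<d ^ t. tensor_power t R $$ (i div d ^ t, a) * vec_index \<psi> (a * d ^ t + i mod d ^ t))
    = tensor_apply t d (entries R) (bipartite_fun t d \<psi>) (bipartite_index t d i)"
proof -
  let ?D = "d ^ t"
  have im: "i div ?D < ?D" "i mod ?D < ?D" using i d by (auto simp: less_mult_imp_div_less)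
  have "tensor_apply t d (entries R) (bipartite_fun t d \<psi>) (bipartite_index t d i) =
      (\<Sum>a<?D. tensor_coeff t (entries R) (digits t d (i div ?D)) (digits t d a) * bipartite_fun t d \<psi> (digits t d a, i mod ?D))"
    unfolding tensor_apply_def bipartite_index_def fst_conv snd_conv
    by (rule sum.reindex_bij_betw[OF digits_bij[OF d], symmetric])
  also have "\<dots> = (\<Sum>a<?D. tensor_power t R $$ (i div ?D, a) * vec_index \<psi> (a * ?D + i mod ?D))"
  proof (intro sum.cong refl arg_cong2[where f = "(*)"])
    fix a assume "a \<in> {..<?D}"
    hence a: "a < ?D" by simp
    show "tensor_coeff t (entries R) (digits t d (i div ?D)) (digits t d a) = tensor_power t R $$ (i div ?D, a)"
      using im a by (simp add: tensor_power_index[OF R] tensor_coeff_def digits_def)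
    have lt: "a * ?D + i mod ?D < ?D * ?D"
    proof -
      have "a * ?D + i mod ?D < (a + 1) * ?D" using im by simp
      also have "\<dots> \<le> ?D * ?D" using a by (intro mult_right_mono) auto
      finally show ?thesis .
    qed
    have "bipartite_index t d (a * ?D + i mod ?D) = (digits t d a, i mod ?D)"
      using im d by (simp add: bipartite_index_def)
    thus "bipartite_fun t d \<psi> (digits t d a, i mod ?D) = vec_index \<psi> (a * ?D + i mod ?D)"
      using bipartite_fun_index[OF d lt] by metis
  qed
  finally show ?thesis ..
qed

text \<open>The common interface of discrete ensembles and the Haar measure, whose sigma-algebras
  differ. The condition \<open>measurable_on_unitary\<close> lets a matrix expression be replaced by
  an amplitude formula that agrees with it only on unitaries. It holds for a pmf because every
  function is measurable, and for Haar because the space is the unitary group.\<close>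

locale unitary_ensemble = prob_space \<nu> for \<nu> :: "complex mat measure" +
  fixes d :: nat
  assumes d_pos: "d > 0"
    and AE_unitary: "AE R in \<nu>. R \<in> unitary_group d"
    and measurable_entry: "\<And>i j. i < d \<Longrightarrow> j < d \<Longrightarrow> (\<lambda>R. R $$ (i, j)) \<in> borel_measurable \<nu>"
    and measurable_on_unitary: "\<And>f g :: complex mat \<Rightarrow> complex. g \<in> borel_measurable \<nu> \<Longrightarrow>
      (\<And>R. R \<in> unitary_group d \<Longrightarrow> f R = g R) \<Longrightarrow> f \<in> borel_measurable \<nu>"
begin

lemma integral_on_unitary:
  fixes f g :: "complex mat \<Rightarrow> complex"
  assumes "g \<in> borel_measurable \<nu>" "\<And>R. R \<in> unitary_group d \<Longrightarrow> f R = g R"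
  shows "integral\<^sup>L \<nu> f = integral\<^sup>L \<nu> g"
  using assms AE_unitary by (intro integral_cong_AE measurable_on_unitary[of g f]) auto

lemma measurable_tensor_apply:
  assumes "fst p \<in> tuples t d"
  shows "(\<lambda>R. tensor_apply t d (entries R) \<phi> p) \<in> borel_measurable \<nu>"
  unfolding tensor_apply_def tensor_coeff_def
  using assms by (intro borel_measurable_sum borel_measurable_times borel_measurable_prod borel_measurable_const measurable_entry)
    (auto simp: tuples_less)

lemma tensor_apply_bound:
  assumes "R \<in> unitary_group d" "p \<in> tuples t d \<times> {..<m}"
  shows "cmod (tensor_apply t d (entries R) \<phi> p) \<le> sqrt (norm_sq (tuples t d \<times> {..<m}) \<phi>)"
proof -
  have "(cmod (tensor_apply t d (entries R) \<phi> p))\<^sup>2 \<le> norm_sq (tuples t d \<times> {..<m}) (tensor_apply t d (entries R) \<phi>)"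
    unfolding norm_sq_def using assms(2) by (intro member_le_sum) auto
  also have "\<dots> = norm_sq (tuples t d \<times> {..<m}) \<phi>"
    by (rule norm_sq_tensor_apply[OF unitary_fun_entries[OF assms(1)]])
  finally show ?thesis by (rule real_le_rsqrt)
qed

lemma integrable_tensor_apply:
  assumes pq: "p \<in> tuples t d \<times> {..<m}" "q \<in> tuples t d \<times> {..<m}"
  shows "integrable \<nu> (\<lambda>R. tensor_apply t d (entries R) \<phi> p * cnj (tensor_apply t d (entries R) \<phi> q))"
proof (rule integrable_const_bound)
  let ?N = "norm_sq (tuples t d \<times> {..<m}) \<phi>"
  have "cmod (tensor_apply t d (entries R) \<phi> p * cnj (tensor_apply t d (entries R) \<phi> q)) \<le> sqrt ?N * sqrt ?N"
    if "R \<in> unitary_group d" for R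
    unfolding norm_mult complex_mod_cnj using tensor_apply_bound[OF that] pq by (intro mult_mono) auto
  thus "AE R in \<nu>. cmod (tensor_apply t d (entries R) \<phi> p * cnj (tensor_apply t d (entries R) \<phi> q)) \<le> sqrt ?N * sqrt ?N"
    using AE_unitary by auto
  have "cnj \<in> borel_measurable borel" by (intro borel_measurable_continuous_onI continuous_intros)
  thus "(\<lambda>R. tensor_apply t d (entries R) \<phi> p * cnj (tensor_apply t d (entries R) \<phi> q)) \<in> borel_measurable \<nu>"
    using pq by (intro borel_measurable_times measurable_tensor_apply measurable_compose[of _ \<nu> borel cnj]) auto
qed

lemma integrable_tensor_apply_sq:
  assumes "p \<in> tuples t d \<times> {..<m}"
  shows "integrable \<nu> (\<lambda>R. (cmod (tensor_apply t d (entries R) \<phi> p))\<^sup>2)"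
proof -
  have "integrable \<nu> (\<lambda>R. Re (tensor_apply t d (entries R) \<phi> p * cnj (tensor_apply t d (entries R) \<phi> p)))"
    by (intro integrable_Re integrable_tensor_apply[OF assms assms])
  thus ?thesis by (simp add: complex_norm_square[symmetric] del: of_real_power)
qed

lemma integrable_sesq:
  "integrable \<nu> (\<lambda>R. sesq (tuples t d \<times> {..<m}) W (tensor_apply t d (entries R) \<phi>) (tensor_apply t d (entries R) \<phi>))"
proof -
  have "integrable \<nu> (\<lambda>R. \<Sum>p\<in>tuples t d \<times> {..<m}. \<Sum>q\<in>tuples t d \<times> {..<m}.
      W p q * (tensor_apply t d (entries R) \<phi> q * cnj (tensor_apply t d (entries R) \<phi> p)))"
    by (intro Bochner_Integration.integrable_sum integrable_mult_right integrable_tensor_apply) auto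
  thus ?thesis unfolding sesq_def by (simp add: mult_ac)
qed

lemma integral_sesq:
  "(\<integral>R. sesq (tuples t d \<times> {..<m}) W (tensor_apply t d (entries R) \<phi>) (tensor_apply t d (entries R) \<phi>) \<partial>\<nu>)
   = (\<Sum>p\<in>tuples t d \<times> {..<m}. \<Sum>q\<in>tuples t d \<times> {..<m}. W p q *
       (\<integral>R. tensor_apply t d (entries R) \<phi> q * cnj (tensor_apply t d (entries R) \<phi> p) \<partial>\<nu>))"
proof -
  let ?I = "tuples t d \<times> {..<m}" and ?\<Phi> = "\<lambda>R. tensor_apply t d (entries R) \<phi>"
  have "(\<integral>R. sesq ?I W (?\<Phi> R) (?\<Phi> R) \<partial>\<nu>) = (\<integral>R. (\<Sum>p\<in>?I. \<Sum>q\<in>?I. W p q * (?\<Phi> R q * cnj (?\<Phi> R p))) \<partial>\<nu>)"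
    unfolding sesq_def by (simp add: mult_ac)
  also have "\<dots> = (\<Sum>p\<in>?I. (\<integral>R. (\<Sum>q\<in>?I. W p q * (?\<Phi> R q * cnj (?\<Phi> R p))) \<partial>\<nu>))"
    by (intro Bochner_Integration.integral_sum Bochner_Integration.integrable_sum integrable_mult_right integrable_tensor_apply) auto
  also have "\<dots> = (\<Sum>p\<in>?I. \<Sum>q\<in>?I. (\<integral>R. W p q * (?\<Phi> R q * cnj (?\<Phi> R p)) \<partial>\<nu>))"
    by (intro sum.cong refl Bochner_Integration.integral_sum integrable_mult_right integrable_tensor_apply) auto
  also have "\<dots> = (\<Sum>p\<in>?I. \<Sum>q\<in>?I. W p q * (\<integral>R. ?\<Phi> R q * cnj (?\<Phi> R p) \<partial>\<nu>))"
    by (simp add: integral_mult_right_zero)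
  finally show ?thesis .
qed

text \<open>The trivial bound, which settles the case t \<ge> sqrt d.\<close>

lemma integral_sesq_bound:
  assumes W: "contraction (tuples t d \<times> {..<m}) W" and \<phi>: "norm_sq (tuples t d \<times> {..<m}) \<phi> = 1"
  shows "cmod (\<integral>R. sesq (tuples t d \<times> {..<m}) W (tensor_apply t d (entries R) \<phi>) (tensor_apply t d (entries R) \<phi>) \<partial>\<nu>) \<le> 1"
proof -
  let ?I = "tuples t d \<times> {..<m}" and ?\<Phi> = "\<lambda>R. tensor_apply t d (entries R) \<phi>"
  have b: "cmod (sesq ?I W (?\<Phi> R) (?\<Phi> R)) \<le> 1" if "R \<in> unitary_group d" for R
    using contraction_diagD[OF W, of "?\<Phi> R"] norm_sq_tensor_apply[OF unitary_fun_entries[OF that]] \<phi> by simp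
  have "cmod (\<integral>R. sesq ?I W (?\<Phi> R) (?\<Phi> R) \<partial>\<nu>) \<le> (\<integral>R. cmod (sesq ?I W (?\<Phi> R) (?\<Phi> R)) \<partial>\<nu>)"
    by (rule integral_norm_bound)
  also have "\<dots> \<le> (\<integral>R. 1 \<partial>\<nu>)"
    using b AE_unitary integrable_sesq by (intro integral_mono_AE) auto
  finally show ?thesis by (simp add: prob_space)
qed

text \<open>For a pure input, the block at fixed reference indices i mod d^t and j mod d^t is of
  rank one, so the entry under the integral is one amplitude times the conjugate of another.\<close>

lemma tensor_id_moment_operator:
  assumes ij: "i < d ^ t * d ^ t" "j < d ^ t * d ^ t" and \<psi>: "\<psi> \<in> carrier_vec (d ^ t * d ^ t)"
  shows "tensor_id (d ^ t) (moment_operator d t \<nu>) (ket_bra \<psi>) $$ (i, j)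
    = (\<integral>R. tensor_apply t d (entries R) (bipartite_fun t d \<psi>) (bipartite_index t d i) *
        cnj (tensor_apply t d (entries R) (bipartite_fun t d \<psi>) (bipartite_index t d j)) \<partial>\<nu>)"
proof -
  let ?D = "d ^ t"
  have lt: "a * ?D + k mod ?D < ?D * ?D" if "a < ?D" for a k
  proof -
    have "a * ?D + k mod ?D < (a + 1) * ?D" using d_pos by simp
    also have "\<dots> \<le> ?D * ?D" using that by (intro mult_right_mono) auto
    finally show ?thesis .
  qed
  define X where "X = Matrix.mat ?D ?D (\<lambda>(a, b). vec_index \<psi> (a * ?D + i mod ?D) * cnj (vec_index \<psi> (b * ?D + j mod ?D)))"
  have X: "Matrix.mat ?D ?D (\<lambda>(a, a'). ket_bra \<psi> $$ (a * ?D + i mod ?D, a' * ?D + j mod ?D)) = X"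
    unfolding X_def using \<psi> by (intro eq_matI) (auto simp: ket_bra_def lt)
  have im: "i div ?D < ?D" "j div ?D < ?D" using ij by (simp_all add: less_mult_imp_div_less)
  have "tensor_id ?D (moment_operator d t \<nu>) (ket_bra \<psi>) $$ (i, j)
      = (\<integral>R. (tensor_power t R * X * mat_adjoint (tensor_power t R)) $$ (i div ?D, j div ?D) \<partial>\<nu>)"
    using ij im by (simp add: tensor_id_def X moment_operator_def)
  also have "\<dots> = (\<integral>R. tensor_apply t d (entries R) (bipartite_fun t d \<psi>) (bipartite_index t d i) *
        cnj (tensor_apply t d (entries R) (bipartite_fun t d \<psi>) (bipartite_index t d j)) \<partial>\<nu>)"
  proof (rule integral_on_unitary)
    have "bipartite_index t d i \<in> bipartite t d" "bipartite_index t d j \<in> bipartite t d"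
      using bij_betw_apply[OF bipartite_index_bij[OF d_pos]] ij by auto
    thus "(\<lambda>R. tensor_apply t d (entries R) (bipartite_fun t d \<psi>) (bipartite_index t d i) *
        cnj (tensor_apply t d (entries R) (bipartite_fun t d \<psi>) (bipartite_index t d j))) \<in> borel_measurable \<nu>"
      using integrable_tensor_apply[where m = "d ^ t"] by (intro borel_measurable_integrable)
    fix R assume "R \<in> unitary_group d"
    hence R: "R \<in> carrier_mat d d" by (rule unitary_groupD)
    show "(tensor_power t R * X * mat_adjoint (tensor_power t R)) $$ (i div ?D, j div ?D) =
      tensor_apply t d (entries R) (bipartite_fun t d \<psi>) (bipartite_index t d i) *
        cnj (tensor_apply t d (entries R) (bipartite_fun t d \<psi>) (bipartite_index t d j))"
      unfolding X_def index_conj_mult[OF tensor_power_carrier[OF R] im]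
      unfolding tensor_power_apply[OF d_pos R ij(1)] tensor_power_apply[OF d_pos R ij(2)] ..
  qed
  finally show ?thesis .
qed

end

text \<open>Cauchy-Schwarz applied to x and Wy, where Wy has the norm of y.\<close>

lemma unitary_contraction:
  assumes W: "W \<in> unitary_group n"
  shows "contraction {..<n} (entries W)"
  unfolding contraction_def
proof (intro allI)
  fix x y :: "nat \<Rightarrow> complex"
  define z where "z i = (\<Sum>j<n. W $$ (i, j) * y j)" for i
  have "complex_of_real (norm_sq {..<n} z) = (\<Sum>i<n. cnj (\<Sum>j<n. W $$ (i, j) * y j) * (\<Sum>k<n. W $$ (i, k) * y k))"
    by (simp add: norm_sq_def z_def complex_norm_square mult.commute del: of_real_power cnj_sum)
  also have "\<dots> = (\<Sum>i<n. \<Sum>j<n. \<Sum>k<n. cnj (y j) * y k * (cnj (W $$ (i, j)) * W $$ (i, k)))"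
    unfolding cnj_sum sum_product by (intro sum.cong refl) (simp add: mult_ac)
  also have "\<dots> = (\<Sum>j<n. \<Sum>i<n. \<Sum>k<n. cnj (y j) * y k * (cnj (W $$ (i, j)) * W $$ (i, k)))"
    by (rule sum.swap)
  also have "\<dots> = (\<Sum>j<n. \<Sum>k<n. \<Sum>i<n. cnj (y j) * y k * (cnj (W $$ (i, j)) * W $$ (i, k)))"
    by (intro sum.cong refl sum.swap)
  also have "\<dots> = (\<Sum>j<n. \<Sum>k<n. if j = k then cnj (y j) * y k else 0)"
    using unitary_fun_entries[OF W] unfolding sum_distrib_left[symmetric] unitary_fun_def
    by (intro sum.cong refl) simp
  also have "\<dots> = of_real (norm_sq {..<n} y)"
    by (simp add: norm_sq_def complex_norm_square mult.commute del: of_real_power)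
  finally have z: "norm_sq {..<n} z = norm_sq {..<n} y" by (simp only: of_real_eq_iff)
  have "cmod (sesq {..<n} (entries W) x y) = cmod (\<Sum>i<n. cnj (x i) * z i)"
    by (simp add: sesq_def z_def sum_distrib_left mult.assoc)
  also have "\<dots> \<le> (\<Sum>i<n. cmod (x i) * cmod (z i))"
    by (rule order.trans[OF norm_sum]) (simp add: norm_mult)
  also have "\<dots> \<le> sqrt (norm_sq {..<n} x * norm_sq {..<n} z)"
    unfolding norm_sq_def by (intro real_le_rsqrt Cauchy_Schwarz_ineq_sum)
  finally show "cmod (sesq {..<n} (entries W) x y) \<le> sqrt (norm_sq {..<n} x) * sqrt (norm_sq {..<n} y)"
    by (simp add: z real_sqrt_mult)
qed

text \<open>The difference of the two outputs is Hermitian, so its trace norm is the pairing with a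
  unitary. Relabelled by tuples and reference indices, this unitary becomes a kernel
  \<open>W\<close> that depends on \<open>\<psi>\<close> and on both ensembles but not on R, and the
  pairing becomes a difference of averaged quadratic forms.\<close>

lemma moment_difference_trace_norm:
  assumes \<nu>: "unitary_ensemble \<nu> d" and \<mu>: "unitary_ensemble \<mu> d"
    and \<psi>: "\<psi> \<in> carrier_vec (d ^ t * d ^ t)"
  obtains W where "contraction (bipartite t d) W"
    "trace_norm (tensor_id (d ^ t) (moment_operator d t \<nu>) (ket_bra \<psi>) - tensor_id (d ^ t) (moment_operator d t \<mu>) (ket_bra \<psi>)) =
      Re ((\<integral>R. sesq (bipartite t d) W (tensor_apply t d (entries R) (bipartite_fun t d \<psi>)) (tensor_apply t d (entries R) (bipartite_fun t d \<psi>)) \<partial>\<nu>)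
        - (\<integral>R. sesq (bipartite t d) W (tensor_apply t d (entries R) (bipartite_fun t d \<psi>)) (tensor_apply t d (entries R) (bipartite_fun t d \<psi>)) \<partial>\<mu>))"
proof -
  interpret n: unitary_ensemble \<nu> d by fact
  interpret m: unitary_ensemble \<mu> d by fact
  let ?n = "d ^ t * d ^ t" and ?e = "bipartite_index t d" and ?I = "bipartite t d"
  let ?\<Phi> = "\<lambda>R. tensor_apply t d (entries R) (bipartite_fun t d \<psi>)"
  define M where "M \<nu> p q = (\<integral>R. ?\<Phi> R p * cnj (?\<Phi> R q) \<partial>\<nu>)" for \<nu> p q
  let ?A = "tensor_id (d ^ t) (moment_operator d t \<nu>) (ket_bra \<psi>) - tensor_id (d ^ t) (moment_operator d t \<mu>) (ket_bra \<psi>)"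
  have Ac: "?A \<in> carrier_mat ?n ?n" by (auto simp: tensor_id_def)
  have Aij: "?A $$ (i, j) = M \<nu> (?e i) (?e j) - M \<mu> (?e i) (?e j)" if "i < ?n" "j < ?n" for i j
    using that n.tensor_id_moment_operator[OF that \<psi>] m.tensor_id_moment_operator[OF that \<psi>]
    by (simp add: M_def tensor_id_def)
  have Mc: "cnj (M \<nu> p q) = M \<nu> q p" for \<nu> p q
    unfolding M_def by (subst Bochner_Integration.integral_cnj[symmetric]) (simp add: mult.commute)
  have "mat_adjoint ?A = ?A"
    using Ac by (intro eq_matI) (auto simp: Aij Mc simp del: index_minus_mat)
  then obtain U where U: "U \<in> unitary_group ?n" "trace_norm ?A = Re (\<Sum>i<?n. \<Sum>j<?n. U $$ (i, j) * ?A $$ (j, i))"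
    by (rule trace_norm_hermitian_dual[OF Ac])
  note bij = bipartite_index_bij[OF n.d_pos, of t]
  let ?inv = "the_inv_into {..<?n} ?e"
  define W where "W p q = entries U (?inv p) (?inv q)" for p q
  have We: "W (?e i) (?e j) = U $$ (i, j)" if "i < ?n" "j < ?n" for i j
    using that bij_betw_imp_inj_on[OF bij] by (simp add: W_def the_inv_into_f_f)
  have "contraction ?I W"
    unfolding W_def
  proof (rule contraction_inj_on[OF unitary_contraction[OF U(1)]])
    show "inj_on ?inv ?I" "?inv ` ?I \<subseteq> {..<?n}"
      using bij_betw_the_inv_into[OF bij] by (auto simp: bij_betw_def)
  qed simp
  moreover have "trace_norm ?A = Re ((\<integral>R. sesq ?I W (?\<Phi> R) (?\<Phi> R) \<partial>\<nu>) - (\<integral>R. sesq ?I W (?\<Phi> R) (?\<Phi> R) \<partial>\<mu>))"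
  proof -
    have r: "(\<Sum>p\<in>?I. \<Sum>q\<in>?I. X p q) = (\<Sum>i<?n. \<Sum>j<?n. X (?e i) (?e j))" for X :: "_ \<Rightarrow> _ \<Rightarrow> complex"
    proof -
      have "(\<Sum>p\<in>?I. \<Sum>q\<in>?I. X p q) = (\<Sum>i<?n. \<Sum>q\<in>?I. X (?e i) q)"
        by (rule sum.reindex_bij_betw[OF bij, symmetric])
      also have "\<dots> = (\<Sum>i<?n. \<Sum>j<?n. X (?e i) (?e j))"
        by (intro sum.cong refl sum.reindex_bij_betw[OF bij, symmetric])
      finally show ?thesis .
    qed
    have "(\<integral>R. sesq ?I W (?\<Phi> R) (?\<Phi> R) \<partial>\<nu>) - (\<integral>R. sesq ?I W (?\<Phi> R) (?\<Phi> R) \<partial>\<mu>)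
        = (\<Sum>p\<in>?I. \<Sum>q\<in>?I. W p q * (M \<nu> q p - M \<mu> q p))"
      unfolding n.integral_sesq m.integral_sesq M_def by (simp add: sum_subtractf[symmetric] right_diff_distrib)
    also have "\<dots> = (\<Sum>i<?n. \<Sum>j<?n. U $$ (i, j) * ?A $$ (j, i))"
      unfolding r by (intro sum.cong refl) (simp add: We Aij del: index_minus_mat)
    finally show ?thesis using U(2) by simp
  qed
  ultimately show thesis by (rule that)
qed


section \<open>Ensembles with few collisions\<close>

lemma tensor_apply_mult:
  assumes U: "U \<in> carrier_mat d d" and V: "V \<in> carrier_mat d d" and p: "fst p \<in> tuples t d"
  shows "tensor_apply t d (entries (U * V)) \<phi> p = tensor_apply t d (entries U) (tensor_apply t d (entries V) \<phi>) p"
proof -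
  let ?T = "tuples t d" and ?u = "fst p" and ?b = "snd p"
  have c: "tensor_coeff t (entries (U * V)) ?u v = (\<Sum>w\<in>?T. tensor_coeff t (entries U) ?u w * tensor_coeff t (entries V) w v)"
    if v: "v \<in> ?T" for v
  proof -
    have "tensor_coeff t (entries (U * V)) ?u v = (\<Prod>k<t. \<Sum>x<d. U $$ (?u k, x) * V $$ (x, v k))"
      unfolding tensor_coeff_def
      using U V tuples_less[OF p] tuples_less[OF v] by (intro prod.cong refl) (subst index_mult_mat_sum, auto)
    also have "\<dots> = (\<Sum>w\<in>?T. \<Prod>k<t. U $$ (?u k, w k) * V $$ (w k, v k))"
      by (rule sum_tuples_prod[symmetric])
    finally show ?thesis by (simp add: tensor_coeff_def prod.distrib)
  qed
  have "tensor_apply t d (entries (U * V)) \<phi> p = (\<Sum>v\<in>?T. \<Sum>w\<in>?T. tensor_coeff t (entries U) ?u w * (tensor_coeff t (entries V) w v * \<phi> (v, ?b)))"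
    unfolding tensor_apply_def by (intro sum.cong refl) (simp add: c sum_distrib_right mult.assoc)
  also have "\<dots> = (\<Sum>w\<in>?T. \<Sum>v\<in>?T. tensor_coeff t (entries U) ?u w * (tensor_coeff t (entries V) w v * \<phi> (v, ?b)))"
    by (rule sum.swap)
  finally show ?thesis by (simp add: tensor_apply_def sum_distrib_left)
qed

lemma collision_cong:
  "(\<And>u b. u \<in> tuples t d \<Longrightarrow> b < m \<Longrightarrow> \<phi> (u, b) = \<xi> (u, b)) \<Longrightarrow> collision t d m i j \<phi> = collision t d m i j \<xi>"
  unfolding collision_def by (intro sum.cong refl) auto

lemma sesq_cong:
  "(\<And>p. p \<in> I \<Longrightarrow> x p = x' p) \<Longrightarrow> (\<And>p. p \<in> I \<Longrightarrow> y p = y' p) \<Longrightarrow> sesq I W x y = sesq I W x' y'"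
  unfolding sesq_def by (intro sum.cong refl) auto

context unitary_ensemble
begin

lemma integrable_collision:
  assumes V: "V \<in> unitary_group d"
  shows "integrable \<nu> (\<lambda>R. collision t d m i j (tensor_apply t d (entries V) (tensor_apply t d (entries R) \<phi>)))"
  unfolding collision_def
proof (intro Bochner_Integration.integrable_sum)
  fix b u assume b: "b \<in> {..<m}" and u: "u \<in> {u \<in> tuples t d. u i = u j}"
  let ?I = "tuples t d \<times> {..<m}" and ?f = "\<lambda>R. tensor_apply t d (entries V) (tensor_apply t d (entries R) \<phi>) (u, b)"
  show "integrable \<nu> (\<lambda>R. (cmod (?f R))\<^sup>2)"
  proof (rule integrable_const_bound)
    have "(cmod (?f R))\<^sup>2 \<le> norm_sq ?I \<phi>" if R: "R \<in> unitary_group d" for R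
    proof -
      have "(cmod (?f R))\<^sup>2 \<le> norm_sq ?I (tensor_apply t d (entries V) (tensor_apply t d (entries R) \<phi>))"
        unfolding norm_sq_def using b u by (intro member_le_sum) auto
      thus ?thesis by (simp add: norm_sq_tensor_apply unitary_fun_entries R V)
    qed
    thus "AE R in \<nu>. norm ((cmod (?f R))\<^sup>2) \<le> norm_sq ?I \<phi>" using AE_unitary by auto
    have "?f \<in> borel_measurable \<nu>"
      unfolding tensor_apply_def[of t d "entries V"]
      by (intro borel_measurable_sum borel_measurable_times borel_measurable_const measurable_tensor_apply) simp
    thus "(\<lambda>R. (cmod (?f R))\<^sup>2) \<in> borel_measurable \<nu>" by measurable
  qed
qed

end

text \<open>Invariance is required of collision weights only, because
  \<open>uniform_clifford\<close> lives on chosen representatives and is left invariant merely up to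
  phases, to which collision weights are blind.\<close>

locale clifford_invariant_ensemble = unitary_ensemble +
  fixes n :: nat
  assumes d_power: "d = 2 ^ n"
    and collision_invariant: "\<And>t m i j \<phi> V. V \<in> pauli_normalizer n \<Longrightarrow>
      (\<integral>R. collision t d m i j (tensor_apply t d (entries V) (tensor_apply t d (entries R) \<phi>)) \<partial>\<nu>)
      = (\<integral>R. collision t d m i j (tensor_apply t d (entries R) \<phi>) \<partial>\<nu>)"
begin

text \<open>By invariance each mixing Clifford may be inserted on the left without changing the
  integral. After averaging over them, the bound holds for every single unitary R, so nothing
  further about the ensemble is used.\<close>

lemma expectation_collision:
  assumes ij: "i < t" "j < t" "i \<noteq> j" and \<phi>: "norm_sq (tuples t d \<times> {..<m}) \<phi> = 1"
  shows "(\<integral>R. collision t d m i j (tensor_apply t d (entries R) \<phi>) \<partial>\<nu>) \<le> 2 / real d"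
proof -
  let ?\<Theta> = "clifford_phases n" and ?V = "\<lambda>\<theta>. entries (mixing_clifford n \<theta>)" and ?N = "real (card (clifford_phases n))"
  let ?\<Phi> = "\<lambda>R. tensor_apply t d (entries R) \<phi>"
  have N: "?N > 0" using half_phase_clifford[of n "{}"] finite_clifford_phases[of n] by (auto simp: card_gt_0_iff)
  have Vu: "mixing_clifford n \<theta> \<in> unitary_group d" if "\<theta> \<in> ?\<Theta>" for \<theta>
    using pauli_normalizer_unitary[OF mixing_clifford_normalizer[OF that]] by (simp add: d_power)
  have avg: "(\<Sum>\<theta>\<in>?\<Theta>. collision t d m i j (tensor_apply t d (?V \<theta>) (?\<Phi> R))) \<le> 2 * (?N / real d)"
    if R: "R \<in> unitary_group d" for R
  proof -
    have "(\<Sum>\<theta>\<in>?\<Theta>. collision t d m i j (tensor_apply t d (?V \<theta>) (?\<Phi> R))) \<le> 2 * (?N / real d) * norm_sq (tuples t d \<times> {..<m}) (?\<Phi> R)"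
    proof (rule collision_average[OF finite_clifford_phases _ _ _ ij])
      show "unitary_fun d (?V \<theta>)" if "\<theta> \<in> ?\<Theta>" for \<theta> by (rule unitary_fun_entries[OF Vu[OF that]])
      show "(\<Sum>\<theta>\<in>?\<Theta>. \<Sum>w<d. ?V \<theta> w x * ?V \<theta> w y * cnj (?V \<theta> w x') * cnj (?V \<theta> w y'))
        = (if x' = x \<and> y' = y \<or> x' = y \<and> y' = x then of_real (?N / real d) else 0)"
        if "x < d" "y < d" "x' < d" "y' < d" for x y x' y'
        using mixing_clifford_fourth_moment[of x n y x' y'] that by (simp add: d_power)
    qed simp
    thus ?thesis using norm_sq_tensor_apply[OF unitary_fun_entries[OF R]] \<phi> by simp
  qed
  have "?N * (\<integral>R. collision t d m i j (?\<Phi> R) \<partial>\<nu>) = (\<Sum>\<theta>\<in>?\<Theta>. \<integral>R. collision t d m i j (tensor_apply t d (?V \<theta>) (?\<Phi> R)) \<partial>\<nu>)"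
    by (simp add: collision_invariant[OF mixing_clifford_normalizer])
  also have "\<dots> = (\<integral>R. (\<Sum>\<theta>\<in>?\<Theta>. collision t d m i j (tensor_apply t d (?V \<theta>) (?\<Phi> R))) \<partial>\<nu>)"
    by (intro Bochner_Integration.integral_sum[symmetric] integrable_collision Vu)
  also have "\<dots> \<le> (\<integral>R. 2 * (?N / real d) \<partial>\<nu>)"
    using avg AE_unitary by (intro integral_mono_AE Bochner_Integration.integrable_sum integrable_collision Vu) auto
  also have "\<dots> = ?N * (2 / real d)" by (simp add: prob_space)
  finally show ?thesis using N by (simp only: mult_le_cancel_left_pos)
qed

end

context pf_twirl
begin

text \<open>The pointwise estimate is affine in q, so integrating it needs only the expectation of
  q: at most t^2 ordered pairs of positions with 2/d each.\<close>

lemma expectation_pf_average: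
  assumes "clifford_invariant_ensemble \<nu> d n" and \<phi>: "norm_sq I \<phi> = 1" and s: "s > 0"
  shows "cmod ((\<integral>R. sesq I pf_average (tensor_apply t d (entries R) \<phi>) (tensor_apply t d (entries R) \<phi>) \<partial>\<nu>) - ideal_form \<phi>)
    \<le> (s + 1) * (2 * (real t)\<^sup>2 / real d) + 1 / s + \<delta> * real (d ^ t) * real (d ^ t * m)"
proof -
  interpret clifford_invariant_ensemble \<nu> d n by fact
  let ?\<Phi> = "\<lambda>R. tensor_apply t d (entries R) \<phi>" and ?Q = "{(i, j). i < t \<and> j < t \<and> i \<noteq> j}"
  define q where "q R = norm_sq I (off_inj (?\<Phi> R))" for R
  define e where "e = 1 / s + \<delta> * real (d ^ t) * real (d ^ t * m)"
  have coll: "integrable \<nu> (\<lambda>R. collision t d m i j (?\<Phi> R))" for i j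
    unfolding collision_def by (intro Bochner_Integration.integrable_sum integrable_tensor_apply_sq[where m = m]) auto
  have qi: "integrable \<nu> q"
  proof -
    have "integrable \<nu> (\<lambda>R. (cmod (off_inj (?\<Phi> R) p))\<^sup>2)" if "p \<in> I" for p
      using integrable_tensor_apply_sq[OF that, of \<phi>] by (cases "fst p \<in> inj_tuples t d") (simp_all add: off_inj_def)
    thus ?thesis unfolding q_def norm_sq_def by (intro Bochner_Integration.integrable_sum) auto
  qed
  have cQ: "card ?Q \<le> t\<^sup>2"
  proof -
    have sub: "?Q \<subseteq> {..<t} \<times> {..<t}" by auto
    show "card ?Q \<le> t\<^sup>2" using card_mono[OF _ sub] by (simp add: card_cartesian_product power2_eq_square)
  qed
  have "(\<integral>R. q R \<partial>\<nu>) \<le> (\<integral>R. (\<Sum>(i, j)\<in>?Q. collision t d m i j (?\<Phi> R)) \<partial>\<nu>)"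
    using off_inj_collision qi coll unfolding q_def case_prod_beta
    by (intro integral_mono Bochner_Integration.integrable_sum) auto
  also have "\<dots> = (\<Sum>(i, j)\<in>?Q. \<integral>R. collision t d m i j (?\<Phi> R) \<partial>\<nu>)"
    unfolding case_prod_beta by (intro Bochner_Integration.integral_sum coll)
  also have "\<dots> \<le> (\<Sum>(i, j)\<in>?Q. 2 / real d)"
    using expectation_collision \<phi> by (intro sum_mono) auto
  also have "\<dots> = real (card ?Q) * (2 / real d)" by (simp add: case_prod_beta)
  also have "\<dots> \<le> real (t\<^sup>2) * (2 / real d)" using cQ by (intro mult_right_mono) auto
  finally have Eq: "(\<integral>R. q R \<partial>\<nu>) \<le> 2 * (real t)\<^sup>2 / real d" by (simp add: mult.commute)
  have Si: "integrable \<nu> (\<lambda>R. sesq I pf_average (?\<Phi> R) (?\<Phi> R))" by (rule integrable_sesq)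
  have eq: "(\<integral>R. sesq I pf_average (?\<Phi> R) (?\<Phi> R) \<partial>\<nu>) - ideal_form \<phi> = (\<integral>R. sesq I pf_average (?\<Phi> R) (?\<Phi> R) - ideal_form \<phi> \<partial>\<nu>)"
    using Si by (simp add: prob_space)
  have "cmod ((\<integral>R. sesq I pf_average (?\<Phi> R) (?\<Phi> R) \<partial>\<nu>) - ideal_form \<phi>)
      \<le> (\<integral>R. cmod (sesq I pf_average (?\<Phi> R) (?\<Phi> R) - ideal_form \<phi>) \<partial>\<nu>)"
    unfolding eq by (rule integral_norm_bound)
  also have "\<dots> \<le> (\<integral>R. (s + 1) * q R + e \<partial>\<nu>)"
  proof (rule integral_mono_AE)
    have "cmod (sesq I pf_average (?\<Phi> R) (?\<Phi> R) - ideal_form \<phi>) \<le> (s + 1) * q R + e" if R: "R \<in> unitary_group d" for R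
    proof -
      have "unitary_fun d (entries R)" by (rule unitary_fun_entries[OF R])
      from pf_average_tensor_apply[OF this \<phi> s] show ?thesis unfolding q_def e_def by (simp only: add.assoc)
    qed
    thus "AE R in \<nu>. cmod (sesq I pf_average (?\<Phi> R) (?\<Phi> R) - ideal_form \<phi>) \<le> (s + 1) * q R + e"
      using AE_unitary by auto
  qed (use Si qi in auto)
  also have "\<dots> = (s + 1) * (\<integral>R. q R \<partial>\<nu>) + e" using qi by (simp add: prob_space)
  also have "\<dots> \<le> (s + 1) * (2 * (real t)\<^sup>2 / real d) + e"
    using Eq s by (intro add_right_mono mult_left_mono) auto
  finally show ?thesis unfolding e_def by (simp only: add.assoc)
qed

text \<open>(P_\<pi> F_f)^(\<otimes>t) sends the basis vector of a tuple to a signed basis vector,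
  and the induced map on labels is a bijection. Reindexing both sums by it moves the operator from
  the vector into the kernel.\<close>

lemma sesq_pf_form:
  assumes \<pi>: "\<pi> permutes {..<d}"
  shows "sesq I W (tensor_apply t d (entries (perm_matrix d \<pi> * phase_matrix d f)) \<xi>)
      (tensor_apply t d (entries (perm_matrix d \<pi> * phase_matrix d f)) \<xi>) = sesq I (pf_form (\<pi>, f)) \<xi> \<xi>"
proof -
  let ?U = "perm_matrix d \<pi> * phase_matrix d f" and ?\<iota> = "\<lambda>p. (tuple_map t \<pi> (fst p), snd p)"
  have ph: "phase_matrix d f = diag_of d (\<lambda>x. (- 1) ^ f x)"
    by (intro eq_matI) (auto simp: phase_matrix_def diag_of_def)
  have ent: "?U $$ (a, x) = (if a = \<pi> x then (- 1) ^ f x else 0)" if "a < d" "x < d" for a x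
    using that unfolding ph by (subst diag_of_mult_right) (auto simp: perm_matrix_def)
  have act: "tensor_apply t d (entries ?U) \<xi> (?\<iota> p) = tuple_sign t f (fst p) * \<xi> p" if p: "p \<in> I" for p
  proof -
    have u: "fst p \<in> tuples t d" using p by auto
    have "tensor_coeff t (entries ?U) (tuple_map t \<pi> (fst p)) v = (if v = fst p then tuple_sign t f (fst p) else 0)"
      if v: "v \<in> tuples t d" for v
    proof -
      have pd: "\<pi> (fst p k) < d" if "k < t" for k
        using permutes_in_image[OF \<pi>, of "fst p k"] tuples_less[OF u that] by simp
      have "tensor_coeff t (entries ?U) (tuple_map t \<pi> (fst p)) v = (\<Prod>k<t. (- 1) ^ f (v k) * (if v k = fst p k then 1 else 0))"
        unfolding tensor_coeff_def
        by (intro prod.cong refl) (use tuples_less[OF v] pd permutes_inj[OF \<pi>] in \<open>auto simp: tuple_map_def ent inj_eq\<close>)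
      also have "\<dots> = tuple_sign t f v * (if \<forall>k\<in>{..<t}. v k = fst p k then 1 else 0)"
        unfolding prod.distrib tuple_sign_def by (subst prod_delta) auto
      finally show ?thesis using tuples_eq_iff[OF v u] by auto
    qed
    hence "tensor_apply t d (entries ?U) \<xi> (?\<iota> p) = (\<Sum>v\<in>tuples t d. if v = fst p then tuple_sign t f (fst p) * \<xi> (v, snd p) else 0)"
      unfolding tensor_apply_def by (intro sum.cong refl) auto
    thus ?thesis using u by simp
  qed
  have "inj_on ?\<iota> I" using tuple_map_inj[OF \<pi>] by (auto simp: inj_on_def)
  moreover from this have "?\<iota> ` I = I"
    using tuple_map_tuples(1)[OF \<pi>] by (intro endo_inj_surj) auto
  ultimately have bij: "bij_betw ?\<iota> I I" by (simp add: bij_betw_def)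
  let ?x = "tensor_apply t d (entries ?U) \<xi>"
  have "sesq I W ?x ?x = (\<Sum>p\<in>I. \<Sum>q\<in>I. cnj (?x (?\<iota> p)) * W (?\<iota> p) q * ?x q)"
    unfolding sesq_def by (rule sum.reindex_bij_betw[OF bij, symmetric])
  also have "\<dots> = (\<Sum>p\<in>I. \<Sum>q\<in>I. cnj (?x (?\<iota> p)) * W (?\<iota> p) (?\<iota> q) * ?x (?\<iota> q))"
    by (intro sum.cong refl sum.reindex_bij_betw[OF bij, symmetric])
  also have "\<dots> = sesq I (pf_form (\<pi>, f)) \<xi> \<xi>"
    unfolding sesq_def pf_form_def by (intro sum.cong refl) (simp add: act mult_ac)
  finally show ?thesis .
qed

end

section \<open>Clifford and Haar ensembles\<close>

lemma perm_matrix_unitary: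
  assumes "\<pi> permutes {..<d}"
  shows "perm_matrix d \<pi> \<in> unitary_group d"
proof (rule unitary_groupI)
  show "mat_adjoint (perm_matrix d \<pi>) * perm_matrix d \<pi> = 1\<^sub>m d"
  proof (intro eq_matI)
    fix i j assume "i < dim_row (1\<^sub>m d :: complex mat)" "j < dim_col (1\<^sub>m d :: complex mat)"
    hence ij: "i < d" "j < d" by auto
    have "(mat_adjoint (perm_matrix d \<pi>) * perm_matrix d \<pi>) $$ (i, j) = (\<Sum>k<d. cnj (perm_matrix d \<pi> $$ (k, i)) * perm_matrix d \<pi> $$ (k, j))"
      using ij by (subst index_mult_mat_sum) (auto simp: perm_matrix_def simp del: complex_cnj_cancel_iff)
    also have "\<dots> = (\<Sum>k<d. if k = \<pi> i then (if \<pi> i = \<pi> j then 1 else 0) else 0)"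
      using ij by (intro sum.cong refl) (auto simp: perm_matrix_def)
    also have "\<dots> = (if i = j then 1 else 0)"
      using permutes_in_image[OF assms, of i] permutes_inj[OF assms] ij by (simp add: inj_eq)
    finally show "(mat_adjoint (perm_matrix d \<pi>) * perm_matrix d \<pi>) $$ (i, j) = 1\<^sub>m d $$ (i, j)"
      using ij by simp
  qed (auto simp: perm_matrix_def)
qed (simp add: perm_matrix_def)

lemma phase_matrix_unitary: "phase_matrix d f \<in> unitary_group d"
proof -
  have "phase_matrix d f = diag_of d (\<lambda>x. (- 1) ^ f x)"
    by (intro eq_matI) (auto simp: phase_matrix_def diag_of_def)
  thus ?thesis by (simp add: diag_of_unitary norm_power)
qed

lemma unitary_ensemble_pmf:
  assumes "set_pmf p \<subseteq> unitary_group d" "d > 0"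
  shows "unitary_ensemble (measure_pmf p) d"
proof (intro unitary_ensemble.intro unitary_ensemble_axioms.intro)
  show "AE R in measure_pmf p. R \<in> unitary_group d" using assms(1) by (auto simp: AE_measure_pmf_iff)
qed (use assms(2) in \<open>auto intro: prob_space_measure_pmf\<close>)

lemma clifford_ensemble:
  "clifford_invariant_ensemble (measure_pmf (uniform_clifford n)) (2 ^ n) n"
proof (intro clifford_invariant_ensemble.intro clifford_invariant_ensemble_axioms.intro unitary_ensemble_pmf)
  let ?d = "2 ^ n :: nat"
  show "set_pmf (uniform_clifford n) \<subseteq> unitary_group ?d"
    using set_uniform_clifford pauli_normalizer_unitary by blast
  fix t m i j \<phi> and V :: "complex mat"
  assume V: "V \<in> pauli_normalizer n"
  let ?f = "\<lambda>R. collision t ?d m i j (tensor_apply t ?d (entries R) \<phi>)"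
  have Vc: "V \<in> carrier_mat ?d ?d" using unitary_groupD pauli_normalizer_unitary V by blast
  have "(\<integral>R. collision t ?d m i j (tensor_apply t ?d (entries V) (tensor_apply t ?d (entries R) \<phi>)) \<partial>uniform_clifford n)
      = (\<integral>R. ?f (V * R) \<partial>uniform_clifford n)"
  proof (intro integral_cong_AE)
    have "collision t ?d m i j (tensor_apply t ?d (entries V) (tensor_apply t ?d (entries R) \<phi>)) = ?f (V * R)"
      if "R \<in> pauli_normalizer n" for R
    proof -
      have Rc: "R \<in> carrier_mat ?d ?d" using unitary_groupD pauli_normalizer_unitary that by blast
      show ?thesis by (rule collision_cong) (simp add: tensor_apply_mult[OF Vc Rc])
    qed
    thus "AE R in uniform_clifford n. collision t ?d m i j (tensor_apply t ?d (entries V) (tensor_apply t ?d (entries R) \<phi>)) = ?f (V * R)"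
      using set_uniform_clifford by (auto simp: AE_measure_pmf_iff)
  qed auto
  also have "\<dots> = (\<integral>R. ?f R \<partial>uniform_clifford n)"
  proof (rule uniform_clifford_left_invariant[OF V])
    fix z U assume z: "cmod z = 1" and U: "U \<in> pauli_normalizer n"
    have Uc: "U \<in> carrier_mat ?d ?d" using unitary_groupD pauli_normalizer_unitary U by blast
    \<comment> \<open>A phase z of the unitary becomes the global phase z^t of the vector, invisible
      to squared moduli.\<close>
    have c: "tensor_coeff t (entries (z \<cdot>\<^sub>m U)) u v = z ^ t * tensor_coeff t (entries U) u v"
      if "u \<in> tuples t ?d" "v \<in> tuples t ?d" for u v
    proof -
      have "tensor_coeff t (entries (z \<cdot>\<^sub>m U)) u v = (\<Prod>k<t. z * U $$ (u k, v k))"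
        unfolding tensor_coeff_def using Uc tuples_less[OF that(1)] tuples_less[OF that(2)] by (intro prod.cong refl) auto
      thus ?thesis by (simp add: tensor_coeff_def prod.distrib)
    qed
    have "tensor_apply t ?d (entries (z \<cdot>\<^sub>m U)) \<phi> (u, b) = z ^ t * tensor_apply t ?d (entries U) \<phi> (u, b)"
      if "u \<in> tuples t ?d" for u b
      using that by (simp add: tensor_apply_def c sum_distrib_left mult.assoc)
    thus "?f (z \<cdot>\<^sub>m U) = ?f U"
      unfolding collision_def by (intro sum.cong refl) (auto simp: norm_mult norm_power z)
  qed
  finally show "(\<integral>R. collision t ?d m i j (tensor_apply t ?d (entries V) (tensor_apply t ?d (entries R) \<phi>)) \<partial>uniform_clifford n)
      = (\<integral>R. ?f R \<partial>uniform_clifford n)" .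
qed auto

locale haar_ensemble =
  fixes \<mu> :: "complex mat measure" and d :: nat
  assumes haar: "is_haar_measure d \<mu>" and d_pos': "d > 0"
begin

lemma sets_haar: "sets \<mu> = sets (unitary_borel d)" and prob_haar: "prob_space \<mu>"
  using haar by (auto simp: is_haar_measure_def)

lemma space_haar: "space \<mu> = unitary_group d"
  using sets_eq_imp_space_eq[OF sets_haar] by (simp add: unitary_borel_def)

lemma measurable_haar_entry:
  assumes "i < d" "j < d"
  shows "(\<lambda>R. R $$ (i, j)) \<in> borel_measurable \<mu>"
proof -
  let ?J = "{..<d} \<times> {..<d}" and ?g = "\<lambda>U. \<lambda>ij\<in>{..<d} \<times> {..<d}. (U :: complex mat) $$ ij"
  have "?g \<in> measurable (unitary_borel d) (Pi\<^sub>M ?J (\<lambda>_. borel))"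
    unfolding unitary_borel_def by (rule measurable_vimage_algebra1) (auto simp: space_PiM)
  moreover have "(\<lambda>x. x (i, j)) \<in> borel_measurable (Pi\<^sub>M ?J (\<lambda>_. borel :: complex measure))"
    using assms by (intro measurable_component_singleton) auto
  ultimately have "(\<lambda>R. ?g R (i, j)) \<in> borel_measurable (unitary_borel d)" by (rule measurable_compose)
  thus ?thesis using assms by (simp add: measurable_cong_sets[OF sets_haar refl])
qed

sublocale unitary_ensemble \<mu> d
proof (intro unitary_ensemble.intro prob_haar unitary_ensemble_axioms.intro)
  show "AE R in \<mu>. R \<in> unitary_group d" by (rule AE_I2) (simp add: space_haar)
  show "f \<in> borel_measurable \<mu>" if "g \<in> borel_measurable \<mu>" "\<And>R. R \<in> unitary_group d \<Longrightarrow> f R = g R" for f g :: "complex mat \<Rightarrow> complex"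
    using that measurable_cong[of \<mu> f g borel] by (simp add: space_haar)
qed (auto intro: measurable_haar_entry d_pos')

text \<open>The sigma-algebra is generated by entries, and the entries of VU are linear combinations
  of those of U.\<close>

lemma measurable_left_mult:
  assumes V: "V \<in> unitary_group d"
  shows "(\<lambda>U. V * U) \<in> measurable \<mu> \<mu>"
proof -
  let ?J = "{..<d} \<times> {..<d}"
  have "(\<lambda>U. V * U) \<in> measurable \<mu> (unitary_borel d)"
    unfolding unitary_borel_def
  proof (rule measurable_vimage_algebra2)
    show "(\<lambda>U. V * U) \<in> space \<mu> \<rightarrow> unitary_group d" using unitary_group_mult[OF V] by (auto simp: space_haar)
    show "(\<lambda>x. \<lambda>ij\<in>?J. (V * x) $$ ij) \<in> measurable \<mu> (Pi\<^sub>M ?J (\<lambda>_. borel))"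
    proof (rule measurable_restrict)
      fix ij assume "ij \<in> ?J"
      then obtain i j where ij: "ij = (i, j)" "i < d" "j < d" by auto
      have "(\<lambda>x. \<Sum>k<d. V $$ (i, k) * x $$ (k, j)) \<in> borel_measurable \<mu>"
        using ij by (intro borel_measurable_sum borel_measurable_times borel_measurable_const measurable_haar_entry) auto
      moreover have eq: "(V * x) $$ (i, j) = (\<Sum>k<d. V $$ (i, k) * x $$ (k, j))" if "x \<in> space \<mu>" for x
      proof -
        have "x \<in> carrier_mat d d" using that unitary_groupD(1) by (simp add: space_haar)
        thus ?thesis using unitary_groupD(1)[OF V] ij by (subst index_mult_mat_sum) auto
      qed
      ultimately show "(\<lambda>x. (V * x) $$ ij) \<in> borel_measurable \<mu>"
        unfolding ij(1) by (subst measurable_cong[OF eq])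
    qed
  qed
  thus ?thesis by (simp add: measurable_cong_sets[OF refl sets_haar])
qed

lemma integral_left_mult:
  fixes f :: "complex mat \<Rightarrow> 'b :: {banach, second_countable_topology}"
  assumes V: "V \<in> unitary_group d" and f: "f \<in> borel_measurable \<mu>"
  shows "(\<integral>U. f (V * U) \<partial>\<mu>) = (\<integral>U. f U \<partial>\<mu>)"
proof -
  have "(\<integral>U. f U \<partial>\<mu>) = (\<integral>U. f U \<partial>distr \<mu> \<mu> (\<lambda>U. V * U))"
    using haar V by (simp add: is_haar_measure_def)
  also have "\<dots> = (\<integral>U. f (V * U) \<partial>\<mu>)"
    by (rule integral_distr[OF measurable_left_mult[OF V] f])
  finally show ?thesis ..
qed

lemma haar_clifford_invariant:
  assumes d: "d = 2 ^ n"
  shows "clifford_invariant_ensemble \<mu> d n"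
proof (intro clifford_invariant_ensemble.intro unitary_ensemble_axioms clifford_invariant_ensemble_axioms.intro d)
  fix t m i j \<phi> and V :: "complex mat"
  assume "V \<in> pauli_normalizer n"
  hence V: "V \<in> unitary_group d" using pauli_normalizer_unitary d by blast
  let ?f = "\<lambda>R. collision t d m i j (tensor_apply t d (entries R) \<phi>)"
  have "integrable \<mu> ?f"
    unfolding collision_def by (intro Bochner_Integration.integrable_sum integrable_tensor_apply_sq[where m = m]) auto
  hence "(\<integral>R. ?f (V * R) \<partial>\<mu>) = (\<integral>R. ?f R \<partial>\<mu>)" by (intro integral_left_mult[OF V]) simp
  moreover have "(\<integral>R. collision t d m i j (tensor_apply t d (entries V) (tensor_apply t d (entries R) \<phi>)) \<partial>\<mu>) = (\<integral>R. ?f (V * R) \<partial>\<mu>)"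
  proof (rule Bochner_Integration.integral_cong[OF refl])
    fix R assume "R \<in> space \<mu>"
    hence "R \<in> carrier_mat d d" using unitary_groupD(1) by (simp add: space_haar)
    thus "collision t d m i j (tensor_apply t d (entries V) (tensor_apply t d (entries R) \<phi>)) = ?f (V * R)"
      using unitary_groupD(1)[OF V] by (intro collision_cong) (simp add: tensor_apply_mult)
  qed
  ultimately show "(\<integral>R. collision t d m i j (tensor_apply t d (entries V) (tensor_apply t d (entries R) \<phi>)) \<partial>\<mu>) = (\<integral>R. ?f R \<partial>\<mu>)"
    by simp
qed

end


section \<open>The design bound\<close>

lemma set_pfc_ensemble:
  assumes "set_pmf \<D> \<subseteq> {\<pi>. \<pi> permutes {..<2 ^ n}}"
  shows "set_pmf (pfc_ensemble n \<D> F) \<subseteq> unitary_group (2 ^ n)"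
proof -
  have "perm_matrix (2 ^ n) \<pi> * phase_matrix (2 ^ n) f * C \<in> unitary_group (2 ^ n)"
    if "\<pi> \<in> set_pmf \<D>" "C \<in> set_pmf (uniform_clifford n)" for \<pi> f C
    using that assms set_uniform_clifford pauli_normalizer_unitary
    by (intro unitary_group_mult perm_matrix_unitary phase_matrix_unitary) blast+
  thus ?thesis by (auto simp: pfc_ensemble_def)
qed

context pf_twirl
begin

text \<open>Introduces \<pi> and f on the Haar side. Every conjugated form has the same Haar
  integral as \<open>W\<close>, hence so does their convex combination, and both ensembles become
  integrals of \<open>pf_average\<close>.\<close>

lemma integral_haar_average:
  assumes "haar_ensemble \<mu> d"
  shows "(\<integral>R. sesq I W (tensor_apply t d (entries R) \<phi>) (tensor_apply t d (entries R) \<phi>) \<partial>\<mu>)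
    = (\<integral>R. sesq I pf_average (tensor_apply t d (entries R) \<phi>) (tensor_apply t d (entries R) \<phi>) \<partial>\<mu>)"
proof -
  interpret haar_ensemble \<mu> d by fact
  let ?\<Phi> = "\<lambda>R. tensor_apply t d (entries R) \<phi>" and ?\<Omega> = "set_pmf \<D> \<times> set_mset F"
  let ?X = "\<integral>R. sesq I W (?\<Phi> R) (?\<Phi> R) \<partial>\<mu>"
  have each: "(\<integral>R. sesq I (pf_form \<omega>) (?\<Phi> R) (?\<Phi> R) \<partial>\<mu>) = ?X" if "\<omega> \<in> ?\<Omega>" for \<omega>
  proof -
    obtain \<pi> f where \<omega>: "\<omega> = (\<pi>, f)" "\<pi> permutes {..<d}" using \<open>\<omega> \<in> ?\<Omega>\<close> D_permutes by auto
    define V where "V = perm_matrix d \<pi> * phase_matrix d f"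
    have V: "V \<in> unitary_group d"
      unfolding V_def by (intro unitary_group_mult perm_matrix_unitary phase_matrix_unitary \<omega>)
    have "(\<integral>R. sesq I (pf_form \<omega>) (?\<Phi> R) (?\<Phi> R) \<partial>\<mu>) = (\<integral>R. sesq I W (?\<Phi> (V * R)) (?\<Phi> (V * R)) \<partial>\<mu>)"
    proof (rule Bochner_Integration.integral_cong[OF refl])
      fix R assume "R \<in> space \<mu>"
      hence Rc: "R \<in> carrier_mat d d" using unitary_groupD(1) by (simp add: space_haar)
      have "?\<Phi> (V * R) p = tensor_apply t d (entries V) (?\<Phi> R) p" if "p \<in> I" for p
        using that by (intro tensor_apply_mult unitary_groupD(1)[OF V] Rc) auto
      hence "sesq I W (?\<Phi> (V * R)) (?\<Phi> (V * R)) = sesq I W (tensor_apply t d (entries V) (?\<Phi> R)) (tensor_apply t d (entries V) (?\<Phi> R))"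
        by (intro sesq_cong) auto
      thus "sesq I (pf_form \<omega>) (?\<Phi> R) (?\<Phi> R) = sesq I W (?\<Phi> (V * R)) (?\<Phi> (V * R))"
        unfolding V_def sesq_pf_form[OF \<omega>(2)] \<omega>(1) by (rule sym)
    qed
    also have "\<dots> = ?X"
      by (rule integral_left_mult[OF V, where f = "\<lambda>R. sesq I W (?\<Phi> R) (?\<Phi> R)"]) (rule borel_measurable_integrable[OF integrable_sesq])
    finally show ?thesis .
  qed
  have "(\<integral>R. sesq I pf_average (?\<Phi> R) (?\<Phi> R) \<partial>\<mu>) = (\<integral>R. (\<Sum>\<omega>\<in>?\<Omega>. of_real (pf_weight \<omega>) * sesq I (pf_form \<omega>) (?\<Phi> R) (?\<Phi> R)) \<partial>\<mu>)"
    unfolding pf_average_def sesq_sum ..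
  also have "\<dots> = (\<Sum>\<omega>\<in>?\<Omega>. \<integral>R. of_real (pf_weight \<omega>) * sesq I (pf_form \<omega>) (?\<Phi> R) (?\<Phi> R) \<partial>\<mu>)"
    by (intro Bochner_Integration.integral_sum integrable_mult_right integrable_sesq)
  also have "\<dots> = (\<Sum>\<omega>\<in>?\<Omega>. of_real (pf_weight \<omega>) * ?X)"
    using each by (intro sum.cong refl) (simp add: integral_mult_right_zero)
  also have "\<dots> = of_real (\<Sum>\<omega>\<in>?\<Omega>. pf_weight \<omega>) * ?X" by (simp add: sum_distrib_right)
  finally show ?thesis unfolding sum_pf_weight by simp
qed

text \<open>All three distributions have finite support and are independent, so the integral is a
  finite sum with product weights; the sum over \<pi> and f is carried out inside the form.\<close>

lemma integral_pfc_average: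
  assumes d: "d = 2 ^ n"
  shows "(\<integral>R. sesq I W (tensor_apply t d (entries R) \<phi>) (tensor_apply t d (entries R) \<phi>) \<partial>pfc_ensemble n \<D> F)
    = (\<integral>R. sesq I pf_average (tensor_apply t d (entries R) \<phi>) (tensor_apply t d (entries R) \<phi>) \<partial>uniform_clifford n)"
proof -
  let ?\<Phi> = "\<lambda>R. tensor_apply t d (entries R) \<phi>" and ?C = "set_pmf (uniform_clifford n)"
  let ?D = "set_pmf \<D>" and ?F = "set_mset F" and ?u = "\<lambda>C. pmf (uniform_clifford n) C"
  let ?g = "\<lambda>\<pi> f C. sesq I W (?\<Phi> (perm_matrix d \<pi> * phase_matrix d f * C)) (?\<Phi> (perm_matrix d \<pi> * phase_matrix d f * C))"
  have g: "?g \<pi> f C = sesq I (pf_form (\<pi>, f)) (?\<Phi> C) (?\<Phi> C)" if "\<pi> \<in> ?D" "C \<in> ?C" for \<pi> f C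
  proof -
    have V: "perm_matrix d \<pi> * phase_matrix d f \<in> carrier_mat d d"
      by (rule mult_carrier_mat[of _ d d]) (simp_all add: perm_matrix_def phase_matrix_def)
    have Cc: "C \<in> carrier_mat d d"
      using that(2) set_uniform_clifford pauli_normalizer_unitary unitary_groupD(1) unfolding d by blast
    have "?\<Phi> (perm_matrix d \<pi> * phase_matrix d f * C) p = tensor_apply t d (entries (perm_matrix d \<pi> * phase_matrix d f)) (?\<Phi> C) p"
      if "p \<in> I" for p
      using that by (intro tensor_apply_mult V Cc) auto
    hence "?g \<pi> f C = sesq I W (tensor_apply t d (entries (perm_matrix d \<pi> * phase_matrix d f)) (?\<Phi> C))
        (tensor_apply t d (entries (perm_matrix d \<pi> * phase_matrix d f)) (?\<Phi> C))"
      by (intro sesq_cong) auto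
    thus ?thesis unfolding sesq_pf_form[OF D_permutes[OF that(1)]] .
  qed
  have "(\<integral>R. sesq I W (?\<Phi> R) (?\<Phi> R) \<partial>pfc_ensemble n \<D> F)
      = (\<integral>\<omega>. (case \<omega> of (\<pi>, f, C) \<Rightarrow> ?g \<pi> f C) \<partial>pair_pmf \<D> (pair_pmf G (uniform_clifford n)))"
    unfolding pfc_ensemble_def d by (simp add: case_prod_beta)
  also have "\<dots> = (\<Sum>\<omega>\<in>?D \<times> ?F \<times> ?C. pmf (pair_pmf \<D> (pair_pmf G (uniform_clifford n))) \<omega> *\<^sub>R (case \<omega> of (\<pi>, f, C) \<Rightarrow> ?g \<pi> f C))"
    by (rule integral_measure_pmf) (auto simp: finite_D finite_set_uniform_clifford F_nonempty)
  also have "\<dots> = (\<Sum>\<pi>\<in>?D. \<Sum>f\<in>?F. \<Sum>C\<in>?C. of_real (?u C) * (of_real (pf_weight (\<pi>, f)) * sesq I (pf_form (\<pi>, f)) (?\<Phi> C) (?\<Phi> C)))"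
    unfolding sum.cartesian_product' by (intro sum.cong refl) (simp add: pmf_pair pf_weight_def g scaleR_conv_of_real mult_ac)
  also have "\<dots> = (\<Sum>\<omega>\<in>?D \<times> ?F. \<Sum>C\<in>?C. of_real (?u C) * (of_real (pf_weight \<omega>) * sesq I (pf_form \<omega>) (?\<Phi> C) (?\<Phi> C)))"
    unfolding sum.cartesian_product' ..
  also have "\<dots> = (\<Sum>C\<in>?C. \<Sum>\<omega>\<in>?D \<times> ?F. of_real (?u C) * (of_real (pf_weight \<omega>) * sesq I (pf_form \<omega>) (?\<Phi> C) (?\<Phi> C)))"
    by (rule sum.swap)
  also have "\<dots> = (\<Sum>C\<in>?C. ?u C *\<^sub>R sesq I pf_average (?\<Phi> C) (?\<Phi> C))"
    unfolding pf_average_def sesq_sum scaleR_conv_of_real sum_distrib_left ..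
  also have "\<dots> = (\<integral>R. sesq I pf_average (?\<Phi> R) (?\<Phi> R) \<partial>uniform_clifford n)"
    by (rule integral_measure_pmf[symmetric]) (auto simp: finite_set_uniform_clifford)
  finally show ?thesis .
qed

text \<open>Triangle inequality through \<open>ideal_form\<close>; the two sides obey the same
  bound, whence the factor 2.\<close>

lemma pfc_haar_difference:
  assumes d: "d = 2 ^ n" and \<mu>: "haar_ensemble \<mu> d" and \<phi>: "norm_sq I \<phi> = 1" and s: "s > 0"
  shows "cmod ((\<integral>R. sesq I W (tensor_apply t d (entries R) \<phi>) (tensor_apply t d (entries R) \<phi>) \<partial>pfc_ensemble n \<D> F)
      - (\<integral>R. sesq I W (tensor_apply t d (entries R) \<phi>) (tensor_apply t d (entries R) \<phi>) \<partial>\<mu>))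
    \<le> 2 * ((s + 1) * (2 * (real t)\<^sup>2 / real d) + 1 / s + \<delta> * real (d ^ t) * real (d ^ t * m))"
proof -
  let ?J = "\<lambda>\<nu>. \<integral>R. sesq I pf_average (tensor_apply t d (entries R) \<phi>) (tensor_apply t d (entries R) \<phi>) \<partial>\<nu>"
  have "clifford_invariant_ensemble (uniform_clifford n) d n" using clifford_ensemble d by simp
  note b1 = expectation_pf_average[OF this \<phi> s]
  note b2 = expectation_pf_average[OF haar_ensemble.haar_clifford_invariant[OF \<mu> d] \<phi> s]
  have "cmod (?J (uniform_clifford n) - ?J \<mu>) \<le> cmod (?J (uniform_clifford n) - ideal_form \<phi>) + cmod (?J \<mu> - ideal_form \<phi>)"
    using norm_triangle_ineq4[of "?J (uniform_clifford n) - ideal_form \<phi>" "?J \<mu> - ideal_form \<phi>"] by simp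
  from order.trans[OF this add_mono[OF b1 b2]] show ?thesis
    unfolding integral_pfc_average[OF d] integral_haar_average[OF \<mu>] by (simp only: mult_2)
qed

end

text \<open>The error \<delta> d^(3t) meets the denominator d^(4t) sqrt d of the hypothesis, and
  d^(3t) \<le> d^(4t).\<close>

lemma delta_error_bound:
  fixes \<delta> c :: real
  assumes d: "d > 0" and c: "c \<ge> 0" and \<delta>: "\<delta> \<le> c * real t / real d powr (4 * real t + 1 / 2)"
  shows "\<delta> * real (d ^ t) * real (d ^ t * d ^ t) \<le> c * real t / sqrt (real d)"
proof -
  have p: "real d powr (4 * real t + 1 / 2) = real d ^ (4 * t) * sqrt (real d)"
    using d by (simp add: powr_add powr_half_sqrt powr_realpow[symmetric])
  have "\<delta> * real (d ^ t) * real (d ^ t * d ^ t) = \<delta> * real d ^ (3 * t)"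
  proof -
    have "real d ^ (3 * t) = real d ^ t * (real d ^ t * real d ^ t)"
      unfolding power_add[symmetric] by (rule arg_cong[where f = "\<lambda>k. real d ^ k"]) simp
    thus ?thesis by simp
  qed
  also have "\<dots> \<le> c * real t / (real d ^ (4 * t) * sqrt (real d)) * real d ^ (3 * t)"
    using \<delta> unfolding p by (intro mult_right_mono) auto
  also have "\<dots> = (c * real t / sqrt (real d)) * (real d ^ (3 * t) / real d ^ (4 * t))" by (simp add: field_simps)
  also have "\<dots> \<le> (c * real t / sqrt (real d)) * 1"
    using d c by (intro mult_left_mono) (auto simp: divide_le_eq_1 intro!: power_increasing)
  finally show ?thesis by simp
qed

theorem theorem4p4:
  shows "\<forall>c\<^sub>0::real. c\<^sub>0 > 0 \<longrightarrow> (\<exists>c::real. c > 0 \<and>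
    (\<forall>(n::nat) (t::nat) (d::nat) (F :: (nat \<Rightarrow> nat) multiset) (\<D> :: (nat \<Rightarrow> nat) pmf) (\<delta>::real)
       (\<mu> :: complex mat measure).
       n > 0 \<and> t > 0 \<and> d = 2 ^ n \<and>
       is_haar_measure d \<mu> \<and>
       kwise_independent (2 * t) d 2 F \<and>
       approx_twise_independent_perm \<delta> t d \<D> \<and>
       \<delta> \<le> c\<^sub>0 * real t / real d powr (4 * real t + 1 / 2) \<longrightarrow>
       diamond_approx_design d \<mu> t (c * real t / sqrt (real d)) (measure_pmf (pfc_ensemble n \<D> F))))"
proof (intro allI impI, goal_cases)
  case (1 c\<^sub>0)
  show ?case
  \<comment> \<open>Twice 5 + \<open>c\<^sub>0\<close>: inside the bracket of
    \<open>pfc_haar_difference\<close> the collisions give 2x + 2x^2, the summand 1/s gives x, and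
    the permutation error gives at most \<open>c\<^sub>0\<close> x, where x = t / sqrt d <
    1.\<close>
  proof (intro exI[of _ "10 + 2 * c\<^sub>0"] conjI allI impI, goal_cases)
    case 1
    show ?case using \<open>c\<^sub>0 > 0\<close> by simp
  next
    case (2 n t d F \<D> \<delta> \<mu>)
    hence t: "t > 0" and d: "d = 2 ^ n" and haar: "is_haar_measure d \<mu>" and F: "kwise_independent (2 * t) d 2 F"
      and D: "approx_twise_independent_perm \<delta> t d \<D>" and \<delta>: "\<delta> \<le> c\<^sub>0 * real t / real d powr (4 * real t + 1 / 2)" by auto
    have d0: "d > 0" using d by simp
    let ?\<epsilon> = "(10 + 2 * c\<^sub>0) * real t / sqrt (real d)" and ?\<nu> = "measure_pmf (pfc_ensemble n \<D> F)"
    interpret h: haar_ensemble \<mu> d by unfold_locales (fact haar, fact d0)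
    have \<nu>: "unitary_ensemble ?\<nu> d"
      using set_pfc_ensemble[of \<D> n F] D d0 unfolding d approx_twise_independent_perm_def by (intro unitary_ensemble_pmf) auto
    have bound: "trace_norm (tensor_id (d ^ t) (moment_operator d t ?\<nu>) (ket_bra \<psi>) - tensor_id (d ^ t) (moment_operator d t \<mu>) (ket_bra \<psi>)) \<le> ?\<epsilon>"
      if \<psi>: "\<psi> \<in> carrier_vec (d ^ t * d ^ t)" "\<psi> \<bullet>c \<psi> = 1" for \<psi>
    proof -
      let ?\<Phi> = "\<lambda>R. tensor_apply t d (entries R) (bipartite_fun t d \<psi>)"
      obtain W where W: "contraction (bipartite t d) W"
        and tn: "trace_norm (tensor_id (d ^ t) (moment_operator d t ?\<nu>) (ket_bra \<psi>) - tensor_id (d ^ t) (moment_operator d t \<mu>) (ket_bra \<psi>)) =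
          Re ((\<integral>R. sesq (bipartite t d) W (?\<Phi> R) (?\<Phi> R) \<partial>?\<nu>) - (\<integral>R. sesq (bipartite t d) W (?\<Phi> R) (?\<Phi> R) \<partial>\<mu>))"
        by (rule moment_difference_trace_norm[OF \<nu> h.unitary_ensemble_axioms \<psi>(1)])
      have n1: "norm_sq (bipartite t d) (bipartite_fun t d \<psi>) = 1" by (rule norm_sq_bipartite_fun[OF d0 \<psi>])
      \<comment> \<open>The target rate; the free parameter s of the previous bounds is set to
        1/x.\<close>
      define x where "x = real t / sqrt (real d)"
      have eps: "?\<epsilon> = (10 + 2 * c\<^sub>0) * x" by (simp add: x_def)
      have x0: "x > 0" using t d0 by (simp add: x_def)
      have s0: "1 / x > 0" by (rule divide_pos_pos[OF _ x0]) simp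
      have "cmod ((\<integral>R. sesq (bipartite t d) W (?\<Phi> R) (?\<Phi> R) \<partial>?\<nu>) - (\<integral>R. sesq (bipartite t d) W (?\<Phi> R) (?\<Phi> R) \<partial>\<mu>)) \<le> ?\<epsilon>"
      proof (cases "x < 1")
        case True
        have x2: "x\<^sup>2 = (real t)\<^sup>2 / real d" by (simp add: x_def power_divide)
        have "x\<^sup>2 < 1\<^sup>2" using True x0 by (intro power_strict_mono) auto
        hence "(real t)\<^sup>2 < real d" unfolding x2 using d0 by simp
        hence "t\<^sup>2 < d" by (simp only: of_nat_power[symmetric] of_nat_less_iff)
        \<comment> \<open>From (t - 1)^2 \<ge> 0. Together with t^2 < d, that is t^2 + 1 \<le> d, it
          gives the assumption \<open>td\<close> of the twirl.\<close>
        moreover have "2 * t \<le> t\<^sup>2 + 1" using sum_squares_bound[of "real t" 1] by (simp flip: of_nat_power of_nat_mult)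
        ultimately have td: "2 * t \<le> d" by linarith
        interpret pf_twirl t d "d ^ t" W F \<D> \<delta> by unfold_locales (fact W F D td)+
        have "cmod ((\<integral>R. sesq (bipartite t d) W (?\<Phi> R) (?\<Phi> R) \<partial>?\<nu>) - (\<integral>R. sesq (bipartite t d) W (?\<Phi> R) (?\<Phi> R) \<partial>\<mu>))
          \<le> 2 * ((1 / x + 1) * (2 * (real t)\<^sup>2 / real d) + 1 / (1 / x) + \<delta> * real (d ^ t) * real (d ^ t * d ^ t))"
          by (rule pfc_haar_difference[OF d h.haar_ensemble_axioms n1 s0])
        also have "(1 / x + 1) * (2 * (real t)\<^sup>2 / real d) = (1 / x + 1) * (2 * (x * x))"
          using x2 by (simp add: power2_eq_square)
        also have "\<dots> = 2 * x + 2 * (x * x)" using x0 by (simp add: field_simps)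
        also have "2 * (2 * x + 2 * (x * x) + 1 / (1 / x) + \<delta> * real (d ^ t) * real (d ^ t * d ^ t)) \<le> 2 * (2 * x + 2 * x + x + c\<^sub>0 * x)"
        proof -
          have "x * x \<le> x * 1" using True x0 by (intro mult_left_mono) auto
          moreover have "\<delta> * real (d ^ t) * real (d ^ t * d ^ t) \<le> c\<^sub>0 * x"
            using delta_error_bound[OF d0 _ \<delta>] \<open>c\<^sub>0 > 0\<close> by (simp add: x_def)
          ultimately show ?thesis by simp
        qed
        also have "\<dots> = ?\<epsilon>" unfolding eps by (simp add: algebra_simps)
        finally show ?thesis .
      next
        case False
        \<comment> \<open>Each average has modulus at most 1, and the claimed bound exceeds 2 once x
          \<ge> 1.\<close>
        have "cmod ((\<integral>R. sesq (bipartite t d) W (?\<Phi> R) (?\<Phi> R) \<partial>?\<nu>) - (\<integral>R. sesq (bipartite t d) W (?\<Phi> R) (?\<Phi> R) \<partial>\<mu>)) \<le> 1 + 1"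
          by (intro order.trans[OF norm_triangle_ineq4] add_mono unitary_ensemble.integral_sesq_bound[OF \<nu> W n1] h.integral_sesq_bound[OF W n1])
        also have "\<dots> \<le> (10 + 2 * c\<^sub>0) * 1" using \<open>c\<^sub>0 > 0\<close> by simp
        also have "\<dots> \<le> (10 + 2 * c\<^sub>0) * x" using False \<open>c\<^sub>0 > 0\<close> by (intro mult_left_mono) auto
        finally show ?thesis unfolding eps .
      qed
      thus ?thesis unfolding tn using complex_Re_le_cmod order.trans by blast
    qed
    let ?S = "{\<psi> \<in> carrier_vec (d ^ t * d ^ t). \<psi> \<bullet>c \<psi> = (1 :: complex)}"
    \<comment> \<open>The supremum must range over a nonempty set for a pointwise bound to carry
      over.\<close>
    have "unit_vec (d ^ t * d ^ t) 0 \<in> ?S"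
      using d0 by (simp add: scalar_prod_left_unit)
    hence "?S \<noteq> {}" by blast
    thus ?case
      unfolding diamond_approx_design_def diamond_dist_def by (rule cSUP_least) (use bound in auto)
  qed
qed


end
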